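(* Let $\mathfrak g$ be a non-compact semisimple Lie algebra with Cartan decomposition $\mathfrak g=\mathfrak k\oplus\mathfrak s$ and Cartan involution $\theta$, let $\mathfrak a\subset\mathfrak s$ be maximal abelian with a choice of positive Weyl chamber $\mathfrak a^+$, let $G=\mathrm{Aut}_0\,\mathfrak g$, let $K\subset G$ be the connected subgroup with Lie algebra $\mathfrak k$, and let $H\in\mathrm{cl}(\mathfrak a^+)$. For every $r>0$ the manifolds $\mathrm{Ad}_\infty(G)\cdot H$ and $\mathrm{Ad}_r(G)\cdot H$ are diffeomorphic, the diffeomorphisms being given by $$\widetilde\psi:\mathrm{Ad}(G)\cdot H\to\mathrm{Ad}_\infty(G)\cdot H,\quad \mathrm{Ad}(k)(H+X)\mapsto\mathrm{Ad}(k)(H+\psi(X)),$$ $$\widetilde\psi_r:\mathrm{Ad}(G)\cdot H\to\mathrm{Ad}_r(G)\cdot H,\quad \mathrm{Ad}(k)(H+X)\mapsto\mathrm{Ad}(k)(H+\psi_r(X)),$$ for $k\in K$, $X\in\mathfrak n_H^+$ (so that $\widetilde\psi\circ\widetilde\psi_r^{-1}:\mathrm{Ad}_r(G)\cdot H\to\mathrm{Ad}_\infty(G)\cdot H$ is a diffeomorphism).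
   Context: For $r>0$ let $T_r:\mathfrak g\to\mathfrak g$ be the linear map with $T_r(X)=rX$ for $X\in\mathfrak k$ and $T_r(Y)=Y$ for $Y\in\mathfrak s$, and let $\mathfrak g_r$ be the vector space $\mathfrak g$ with the Lie bracket $[X,Y]_r=T_r[T_r^{-1}X,T_r^{-1}Y]$. $\mathrm{Ad}_r(G)\cdot H$ denotes the adjoint orbit of $H$ in $\mathfrak g_r$, i.e. the orbit of $H$ under $\mathrm{Aut}_0\,\mathfrak g_r$, viewed as a submanifold of the vector space $\mathfrak g$. The maps $\psi_r,\psi:\mathfrak g\to\mathfrak g$ are $\psi_r(Z)=Z+\frac{r-1}{r+1}\theta Z$ and $\psi(Z)=Z+\theta Z$ (the limit of $\psi_r$ as $r\to\infty$). With $\Pi$ the set of roots of $\mathfrak a$ and $\mathfrak g_\alpha$ the root spaces in $\mathfrak g$, $\mathfrak n_H^+=\sum_{\alpha(H)>0}\mathfrak g_\alpha$. One has $\mathrm{Ad}(G)\cdot H=\bigcup_{k\in K}\mathrm{Ad}(k)(H+\mathfrak n_H^+)$ and $\mathrm{Ad}_r(G)\cdot H=\bigcup_{k\in K}\mathrm{Ad}(k)(H+\psi_r(\mathfrak n_H^+))$, and by definition $$\mathrm{Ad}_\infty(G)\cdot H:=\bigcup_{k\in K}\mathrm{Ad}(k)\big(H+\psi(\mathfrak n_H^+)\big)\subset\mathfrak g .$$ A complex $\mathfrak g$ is treated as a real Lie algebra. *)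

theory Defs
  imports "HOL-Analysis.Analysis"
begin

section \<open>Real Lie algebras\<close>

text \<open>
  A finite-dimensional real Lie algebra is a bracket on a Euclidean space. The inner product of the
  ambient type is auxiliary: only the topology and the smooth structure it induces are used, and
  these are the same for every inner product.
\<close>

definition lie_algebra :: "('a::euclidean_space \<Rightarrow> 'a \<Rightarrow> 'a) \<Rightarrow> bool" where
  "lie_algebra br \<longleftrightarrow>
     bilinear br \<and> (\<forall>X. br X X = 0) \<and>
     (\<forall>X Y Z. br X (br Y Z) + br Y (br Z X) + br Z (br X Y) = 0)"

definition lie_ideal :: "('a::euclidean_space \<Rightarrow> 'a \<Rightarrow> 'a) \<Rightarrow> 'a set \<Rightarrow> bool" where
  "lie_ideal br I \<longleftrightarrow> subspace I \<and> (\<forall>X. \<forall>Y\<in>I. br X Y \<in> I)"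

definition derived_algebra :: "('a::euclidean_space \<Rightarrow> 'a \<Rightarrow> 'a) \<Rightarrow> 'a set \<Rightarrow> 'a set" where
  "derived_algebra br S = span {br X Y | X Y. X \<in> S \<and> Y \<in> S}"

definition lie_solvable :: "('a::euclidean_space \<Rightarrow> 'a \<Rightarrow> 'a) \<Rightarrow> 'a set \<Rightarrow> bool" where
  "lie_solvable br S \<longleftrightarrow> (\<exists>n. (derived_algebra br ^^ n) S = {0})"

definition semisimple :: "('a::euclidean_space \<Rightarrow> 'a \<Rightarrow> 'a) \<Rightarrow> bool" where
  "semisimple br \<longleftrightarrow> lie_algebra br \<and> (\<forall>I. lie_ideal br I \<and> lie_solvable br I \<longrightarrow> I = {0})"

definition linear_trace :: "('a::euclidean_space \<Rightarrow> 'a) \<Rightarrow> real" where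
  "linear_trace f = (\<Sum>b\<in>Basis. f b \<bullet> b)"

definition killing :: "('a::euclidean_space \<Rightarrow> 'a \<Rightarrow> 'a) \<Rightarrow> 'a \<Rightarrow> 'a \<Rightarrow> real" where
  "killing br X Y = linear_trace (\<lambda>Z. br X (br Y Z))"

section \<open>Groups of automorphisms\<close>

text \<open>
  Linear maps are taken in the type of bounded linear maps (every linear map is bounded here),
  so that they carry the usual topology.
\<close>

definition lie_Aut :: "('a::euclidean_space \<Rightarrow> 'a \<Rightarrow> 'a) \<Rightarrow> ('a \<Rightarrow>\<^sub>L 'a) set" where
  "lie_Aut br = {g. bij (blinfun_apply g) \<and> (\<forall>X Y. g (br X Y) = br (g X) (g Y))}"

definition lie_Aut0 :: "('a::euclidean_space \<Rightarrow> 'a \<Rightarrow> 'a) \<Rightarrow> ('a \<Rightarrow>\<^sub>L 'a) set" where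
  "lie_Aut0 br = connected_component_set (lie_Aut br) id_blinfun"

text \<open>
  A group of automorphisms is identified with a subgroup of its own adjoint group:
  \<open>g \<circ> ad X \<circ> g\<inverse> = ad (g X)\<close>, so \<open>Ad(g)\<close> acts on the Lie algebra as \<open>g\<close> itself.
\<close>

definition adj_orbit :: "('a::euclidean_space \<Rightarrow> 'a \<Rightarrow> 'a) \<Rightarrow> 'a \<Rightarrow> 'a set" where
  "adj_orbit br H = {blinfun_apply g H | g. g \<in> lie_Aut0 br}"

definition lie_ad :: "('a::euclidean_space \<Rightarrow> 'a \<Rightarrow> 'a) \<Rightarrow> 'a \<Rightarrow> ('a \<Rightarrow>\<^sub>L 'a)" where
  "lie_ad br X = Blinfun (br X)"

definition blinfun_exp :: "('a::euclidean_space \<Rightarrow>\<^sub>L 'a) \<Rightarrow> ('a \<Rightarrow>\<^sub>L 'a)" where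
  "blinfun_exp A = (\<Sum>n. (((o\<^sub>L) A ^^ n) id_blinfun) /\<^sub>R fact n)"

text \<open>
  The connected (not a priori closed) Lie subgroup with Lie algebra \<open>S\<close> is the subgroup generated
  by the exponentials of \<open>S\<close>, where \<open>S\<close> is viewed inside the Lie algebra of the automorphism
  group by means of \<open>ad\<close>.
\<close>

inductive_set analytic_subgroup ::
    "('a::euclidean_space \<Rightarrow> 'a \<Rightarrow> 'a) \<Rightarrow> 'a set \<Rightarrow> ('a \<Rightarrow>\<^sub>L 'a) set"
  for br :: "'a \<Rightarrow> 'a \<Rightarrow> 'a" and S :: "'a set" where
    exp: "X \<in> S \<Longrightarrow> blinfun_exp (lie_ad br X) \<in> analytic_subgroup br S"
  | id: "id_blinfun \<in> analytic_subgroup br S"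
  | comp: "g \<in> analytic_subgroup br S \<Longrightarrow> h \<in> analytic_subgroup br S \<Longrightarrow>
      g o\<^sub>L h \<in> analytic_subgroup br S"
  | inverse: "g \<in> analytic_subgroup br S \<Longrightarrow> g o\<^sub>L h = id_blinfun \<Longrightarrow> h o\<^sub>L g = id_blinfun \<Longrightarrow>
      h \<in> analytic_subgroup br S"

text \<open>A Lie algebra is compact if its group of inner automorphisms is.\<close>

definition compact_lie_algebra :: "('a::euclidean_space \<Rightarrow> 'a \<Rightarrow> 'a) \<Rightarrow> bool" where
  "compact_lie_algebra br \<longleftrightarrow> compact (analytic_subgroup br UNIV)"

section \<open>Cartan decomposition, roots and chambers\<close>

definition cartan_involution ::
    "('a::euclidean_space \<Rightarrow> 'a \<Rightarrow> 'a) \<Rightarrow> ('a \<Rightarrow> 'a) \<Rightarrow> bool" where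
  "cartan_involution br \<theta> \<longleftrightarrow>
     linear \<theta> \<and> (\<forall>X. \<theta> (\<theta> X) = X) \<and> (\<forall>X Y. \<theta> (br X Y) = br (\<theta> X) (\<theta> Y)) \<and>
     (\<forall>X. X \<noteq> 0 \<longrightarrow> - killing br X (\<theta> X) > 0)"

definition cartan_k :: "('a::euclidean_space \<Rightarrow> 'a) \<Rightarrow> 'a set" where
  "cartan_k \<theta> = {X. \<theta> X = X}"

definition cartan_s :: "('a::euclidean_space \<Rightarrow> 'a) \<Rightarrow> 'a set" where
  "cartan_s \<theta> = {X. \<theta> X = - X}"

definition abelian_subspace :: "('a::euclidean_space \<Rightarrow> 'a \<Rightarrow> 'a) \<Rightarrow> 'a set \<Rightarrow> bool" where
  "abelian_subspace br A \<longleftrightarrow> subspace A \<and> (\<forall>X\<in>A. \<forall>Y\<in>A. br X Y = 0)"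

definition maximal_abelian_in ::
    "('a::euclidean_space \<Rightarrow> 'a \<Rightarrow> 'a) \<Rightarrow> 'a set \<Rightarrow> 'a set \<Rightarrow> bool" where
  "maximal_abelian_in br S A \<longleftrightarrow>
     abelian_subspace br A \<and> A \<subseteq> S \<and>
     (\<forall>B. abelian_subspace br B \<and> A \<subseteq> B \<and> B \<subseteq> S \<longrightarrow> B = A)"

definition root_space ::
    "('a::euclidean_space \<Rightarrow> 'a \<Rightarrow> 'a) \<Rightarrow> 'a set \<Rightarrow> ('a \<Rightarrow> real) \<Rightarrow> 'a set" where
  "root_space br A \<alpha> = {X. \<forall>H\<in>A. br H X = \<alpha> H *\<^sub>R X}"

text \<open>
  A linear functional on the subspace \<open>A\<close> is represented by its linear extensions to the whole
  space. A root thus occurs several times, which is harmless: its root space and its values on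
  \<open>A\<close> are the same for each extension.
\<close>

definition roots :: "('a::euclidean_space \<Rightarrow> 'a \<Rightarrow> 'a) \<Rightarrow> 'a set \<Rightarrow> ('a \<Rightarrow> real) set" where
  "roots br A = {\<alpha>. linear \<alpha> \<and> (\<exists>H\<in>A. \<alpha> H \<noteq> 0) \<and> root_space br A \<alpha> \<noteq> {0}}"

definition weyl_chamber :: "('a::euclidean_space \<Rightarrow> 'a \<Rightarrow> 'a) \<Rightarrow> 'a set \<Rightarrow> 'a set \<Rightarrow> bool" where
  "weyl_chamber br A C \<longleftrightarrow> C \<in> components {X\<in>A. \<forall>\<alpha>\<in>roots br A. \<alpha> X \<noteq> 0}"

definition n_plus :: "('a::euclidean_space \<Rightarrow> 'a \<Rightarrow> 'a) \<Rightarrow> 'a set \<Rightarrow> 'a \<Rightarrow> 'a set" where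
  "n_plus br A H = span (\<Union>\<alpha>\<in>{\<alpha>\<in>roots br A. \<alpha> H > 0}. root_space br A \<alpha>)"

section \<open>The deformed brackets and the limit orbit\<close>

text \<open>Here \<open>(Z + \<theta> Z) / 2\<close> and \<open>(Z - \<theta> Z) / 2\<close> are the components of \<open>Z\<close> in the two eigenspaces.\<close>

definition deform_map :: "('a::euclidean_space \<Rightarrow> 'a) \<Rightarrow> real \<Rightarrow> 'a \<Rightarrow> 'a" where
  "deform_map \<theta> r Z = r *\<^sub>R ((Z + \<theta> Z) /\<^sub>R 2) + (Z - \<theta> Z) /\<^sub>R 2"

lemma deform_map_unique:
  assumes "cartan_involution br \<theta>"
  shows "linear T \<and> (\<forall>X\<in>cartan_k \<theta>. T X = r *\<^sub>R X) \<and> (\<forall>Y\<in>cartan_s \<theta>. T Y = Y)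
    \<longleftrightarrow> T = deform_map \<theta> r"
proof
  have lin: "linear \<theta>" and inv: "\<And>X. \<theta> (\<theta> X) = X"
    using assms by (auto simp: cartan_involution_def)
  show "T = deform_map \<theta> r"
    if T: "linear T \<and> (\<forall>X\<in>cartan_k \<theta>. T X = r *\<^sub>R X) \<and> (\<forall>Y\<in>cartan_s \<theta>. T Y = Y)"
  proof
    fix Z
    have "(Z + \<theta> Z) /\<^sub>R 2 \<in> cartan_k \<theta>" "(Z - \<theta> Z) /\<^sub>R 2 \<in> cartan_s \<theta>"
      by (auto simp: cartan_k_def cartan_s_def linear_cmul[OF lin] linear_add[OF lin]
          linear_diff[OF lin] inv algebra_simps)
    moreover have "Z = (Z + \<theta> Z) /\<^sub>R 2 + (Z - \<theta> Z) /\<^sub>R 2"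
      by (simp add: algebra_simps flip: scaleR_add_left)
    then have "T Z = T ((Z + \<theta> Z) /\<^sub>R 2) + T ((Z - \<theta> Z) /\<^sub>R 2)"
      using T by (metis linear_add)
    ultimately show "T Z = deform_map \<theta> r Z"
      using T by (simp add: deform_map_def)
  qed
  have "linear (deform_map \<theta> r)"
    by (rule linearI) (simp_all add: deform_map_def linear_cmul[OF lin] linear_add[OF lin]
        algebra_simps)
  moreover have "deform_map \<theta> r X = r *\<^sub>R X" if "X \<in> cartan_k \<theta>" for X
    using that by (simp add: deform_map_def cartan_k_def flip: scaleR_2)
  moreover have "deform_map \<theta> r Y = Y" if "Y \<in> cartan_s \<theta>" for Y
    using that by (simp add: deform_map_def cartan_s_def flip: scaleR_2)
  ultimately show "linear T \<and> (\<forall>X\<in>cartan_k \<theta>. T X = r *\<^sub>R X) \<and> (\<forall>Y\<in>cartan_s \<theta>. T Y = Y)"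
    if "T = deform_map \<theta> r"
    using that by blast
qed

definition deform_bracket ::
    "('a::euclidean_space \<Rightarrow> 'a \<Rightarrow> 'a) \<Rightarrow> ('a \<Rightarrow> 'a) \<Rightarrow> real \<Rightarrow> 'a \<Rightarrow> 'a \<Rightarrow> 'a" where
  "deform_bracket br \<theta> r X Y =
     deform_map \<theta> r (br (inv (deform_map \<theta> r) X) (inv (deform_map \<theta> r) Y))"

definition psi_r :: "('a::euclidean_space \<Rightarrow> 'a) \<Rightarrow> real \<Rightarrow> 'a \<Rightarrow> 'a" where
  "psi_r \<theta> r Z = Z + ((r - 1) / (r + 1)) *\<^sub>R \<theta> Z"

definition psi :: "('a::euclidean_space \<Rightarrow> 'a) \<Rightarrow> 'a \<Rightarrow> 'a" where
  "psi \<theta> Z = Z + \<theta> Z"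

definition limit_orbit ::
    "('a::euclidean_space \<Rightarrow> 'a \<Rightarrow> 'a) \<Rightarrow> ('a \<Rightarrow> 'a) \<Rightarrow> 'a set \<Rightarrow> 'a \<Rightarrow> 'a set" where
  "limit_orbit br \<theta> A H =
     (\<Union>k\<in>analytic_subgroup br (cartan_k \<theta>). {blinfun_apply k (H + psi \<theta> X) | X. X \<in> n_plus br A H})"

text \<open>
  The assignment \<open>k (H + X) \<mapsto> k (H + f X)\<close> for \<open>k \<in> K\<close> and \<open>X \<in> N\<close>, as a function of the point
  \<open>k (H + X)\<close>. That it does not depend on the choice of \<open>k\<close> and \<open>X\<close> has to be proved.
\<close>

definition fiber_map ::
    "('a::euclidean_space \<Rightarrow>\<^sub>L 'a) set \<Rightarrow> 'a set \<Rightarrow> 'a \<Rightarrow> ('a \<Rightarrow> 'a) \<Rightarrow> 'a \<Rightarrow> 'a" where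
  "fiber_map K N H f Z = (THE W. \<exists>k\<in>K. \<exists>X\<in>N. Z = blinfun_apply k (H + X) \<and> W = blinfun_apply k (H + f X))"

section \<open>Submanifolds and diffeomorphisms\<close>

text \<open>On open sets of a Euclidean space, the following is the class \<open>C\<^sup>k\<close>.\<close>

primrec Ck_on ::
    "nat \<Rightarrow> ('a::euclidean_space \<Rightarrow> 'b::euclidean_space) \<Rightarrow> 'a set \<Rightarrow> bool" where
  "Ck_on 0 f U \<longleftrightarrow> continuous_on U f"
| "Ck_on (Suc k) f U \<longleftrightarrow>
     (\<forall>x\<in>U. f differentiable (at x)) \<and> (\<forall>v. Ck_on k (\<lambda>x. frechet_derivative f (at x) v) U)"

definition smooth_on :: "('a::euclidean_space \<Rightarrow> 'b::euclidean_space) \<Rightarrow> 'a set \<Rightarrow> bool" where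
  "smooth_on f U \<longleftrightarrow> (\<forall>k. Ck_on k f U)"

text \<open>Embedded submanifolds without boundary, of dimension \<open>d\<close>, described by slice charts.\<close>

definition submanifold :: "nat \<Rightarrow> 'a::euclidean_space set \<Rightarrow> bool" where
  "submanifold d M \<longleftrightarrow>
     (\<forall>p\<in>M. \<exists>U V (\<phi> :: 'a \<Rightarrow> 'a) \<phi>' L.
        open U \<and> p \<in> U \<and> open V \<and> homeomorphism U V \<phi> \<phi>' \<and> smooth_on \<phi> U \<and> smooth_on \<phi>' V \<and>
        subspace L \<and> dim L = d \<and> \<phi> ` (M \<inter> U) = L \<inter> V)"

text \<open>Smoothness of a map on a submanifold: it extends smoothly to a neighbourhood of each point.\<close>

definition smooth_map_on ::
    "'a::euclidean_space set \<Rightarrow> ('a \<Rightarrow> 'b::euclidean_space) \<Rightarrow> bool" where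
  "smooth_map_on M f \<longleftrightarrow>
     (\<forall>p\<in>M. \<exists>U F. open U \<and> p \<in> U \<and> smooth_on F U \<and> (\<forall>x\<in>M \<inter> U. F x = f x))"

definition diffeomorphism ::
    "'a::euclidean_space set \<Rightarrow> 'b::euclidean_space set \<Rightarrow> ('a \<Rightarrow> 'b) \<Rightarrow> bool" where
  "diffeomorphism M N f \<longleftrightarrow>
     (\<exists>d. submanifold d M) \<and> (\<exists>d. submanifold d N) \<and> bij_betw f M N \<and>
     smooth_map_on M f \<and> smooth_map_on N (inv_into M f)"

end

theory Submission
  imports Defs
begin

section \<open>Deformed adjoint orbits\<close>

text \<open>
  Let \<open>Sig\<close> be the closed set of all \<open>Z\<close> for which \<open>ad Z\<close> is diagonalizable with eigenvalues among
  those of \<open>ad H\<close>, and let \<open>n p\<close> be the sum of the positive eigenspaces of \<open>ad p\<close>. Each point of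
  \<open>M = K (H + n H)\<close> is \<open>p + Y\<close> with \<open>p \<in> K H\<close> and \<open>Y \<in> n p\<close>. Here \<open>p\<close> is unique, because the
  filtration by eigenspaces of \<open>ad (p + Y)\<close> is the one of the symmetric map \<open>ad p\<close>, which is
  determined by its filtration. Near such a point,
  \<open>x \<mapsto> g x (p + Y + E\<^sub>+ x + E\<^sub>0 x)\<close>, where \<open>g x \<in> K\<close> and \<open>E\<^sub>+\<close>, \<open>E\<^sub>0\<close> are the projections to the positive
  and zero eigenspaces of \<open>ad p\<close>, is a chart by the inverse function theorem, and it maps into \<open>Sig\<close>
  only if \<open>E\<^sub>0 x = 0\<close>, since the spectrum is isolated. Hence \<open>M\<close> is a submanifold and open in \<open>Sig\<close>,
  and \<open>p\<close> depends smoothly on the point. As \<open>M\<close> is also closed and the adjoint orbit is a connected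
  subset of \<open>Sig\<close>, the orbit is \<open>M\<close>.

  The map \<open>\<psi>\<close> on fibres is \<open>z \<mapsto> z + \<theta> (z - p)\<close>. The limit orbit has a chart of the same kind, and
  the inverse of \<open>\<psi>\<close> is the restriction of the polynomial map \<open>w \<mapsto> w\<^sub>s + E\<^sub>+ w\<^sub>k\<close>, with \<open>E\<^sub>+\<close> taken at
  the component \<open>w\<^sub>s\<close> of \<open>w\<close> and expressed by Lagrange interpolation. Finally \<open>T\<^sub>r\<close> is an isomorphism onto
  the deformed algebra that fixes \<open>p\<close> and equals \<open>(r + 1) / 2\<close> times \<open>\<psi>\<^sub>r\<close>, so that the deformed orbit is
  \<open>T\<^sub>r M\<close> and the map for \<open>\<psi>\<^sub>r\<close> is \<open>T\<^sub>r\<close> after a scaling of the fibres.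
\<close>

section \<open>Smooth maps\<close>

text \<open>\<open>K\<close> is only the group generated by exponentials, so neither its closedness
  nor its compactness is at hand, and a homogeneous space of \<open>K\<close> cannot serve as a
  model of the base. Hence charts come from finite products of exponentials, and compactness of
  \<open>Orb\<close> is proved directly. Positivity of roots is replaced by positivity of
  eigenvalues of \<open>ad p\<close>, which makes sense at each \<open>p\<close> in
  \<open>Orb\<close> and is carried along by \<open>K\<close>. All these points share one list
  \<open>ls\<close>, the spectrum of \<open>ad H\<close>; therefore spectral projections are
  polynomials in \<open>ad p\<close> with fixed coefficients, and membership in \<open>n p\<close>
  is a polynomial equation, which passes to limits. About the full group only the invariance of
  \<open>Sig\<close> and connectedness are used: together with the charts they stand in for an
  Iwasawa decomposition. The limit orbit need not lie in \<open>Sig\<close>; there the spectral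
  argument is applied to the component in \<open>cartan_s \<theta>\<close> alone, and the fibre over
  \<open>p\<close> is the part of \<open>cartan_k \<theta>\<close> without component in the kernel
  of \<open>ad p\<close>.\<close>

text \<open>\<open>frechet_derivative\<close> sees a full neighbourhood, so agreement on the open
  set \<open>U\<close> passes to all derivatives.\<close>

lemma Ck_on_cong_imp:
  assumes "open U" "\<And>x. x \<in> U \<Longrightarrow> f x = g x" "Ck_on k f U"
  shows "Ck_on k g U"
  using assms(2,3)
proof (induction k arbitrary: f g)
  case 0
  then show ?case by (metis Ck_on.simps(1) continuous_on_cong)
next
  case (Suc k)
  have d: "(g has_derivative frechet_derivative f (at x)) (at x)" if "x \<in> U" for x
    using Suc.prems that assms(1) has_derivative_transform_within_open[of f _ x UNIV U g]
    by (auto simp: frechet_derivative_works)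
  have eq: "frechet_derivative f (at x) = frechet_derivative g (at x)" if "x \<in> U" for x
    using d[OF that] by (rule frechet_derivative_at)
  have "Ck_on k (\<lambda>x. frechet_derivative g (at x) v) U" for v
    by (rule Suc.IH[of "\<lambda>x. frechet_derivative f (at x) v"]) (use Suc.prems eq in auto)
  then show ?case using d by (auto simp: differentiable_def)
qed

text \<open>Allows an explicit formula for the derivative in place of the choice operator behind
  \<open>frechet_derivative\<close>.\<close>

lemma Ck_on_SucI:
  assumes "open U" "\<And>x. x \<in> U \<Longrightarrow> (f has_derivative f' x) (at x)"
    "\<And>v. Ck_on k (\<lambda>x. f' x v) U"
  shows "Ck_on (Suc k) f U"
proof -
  have "Ck_on k (\<lambda>x. frechet_derivative f (at x) v) U" for v
    by (rule Ck_on_cong_imp[OF assms(1) _ assms(3)[of v]])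
      (metis assms(2) frechet_derivative_at)
  then show ?thesis using assms(2) by (auto simp: differentiable_def)
qed

lemma Ck_on_SucD:
  assumes "Ck_on (Suc k) f U"
  shows "x \<in> U \<Longrightarrow> (f has_derivative frechet_derivative f (at x)) (at x)"
    and "Ck_on k (\<lambda>x. frechet_derivative f (at x) v) U"
  using assms by (auto simp: frechet_derivative_works)

lemma Ck_on_Suc_imp: "Ck_on (Suc k) f U \<Longrightarrow> Ck_on k f U"
proof (induction k arbitrary: f)
  case 0
  then show ?case
    by (auto intro!: continuous_at_imp_continuous_on differentiable_imp_continuous_within)
next
  case (Suc k)
  then show ?case by (simp del: Ck_on.simps add: Ck_on.simps(2)[of "Suc k"] Ck_on.simps(2)[of k f])
qed

lemma Ck_on_subset: "Ck_on k f U \<Longrightarrow> T \<subseteq> U \<Longrightarrow> Ck_on k f T"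
  by (induction k arbitrary: f) (auto intro: continuous_on_subset)

lemma Ck_on_const: "open U \<Longrightarrow> Ck_on k (\<lambda>x. c) U"
proof (induction k arbitrary: c)
  case (Suc k)
  show ?case by (rule Ck_on_SucI[where f'="\<lambda>_ _. 0"]) (use Suc in auto)
qed auto

lemma Ck_on_linear:
  fixes f :: "'a::euclidean_space \<Rightarrow> 'b::euclidean_space"
  assumes "open U" "linear f" shows "Ck_on k f U"
proof (cases k)
  case 0
  then show ?thesis using assms linear_continuous_on linear_conv_bounded_linear by auto
next
  case (Suc m)
  show ?thesis unfolding Suc
    by (rule Ck_on_SucI[where f'="\<lambda>_. f"])
      (use assms Ck_on_const in \<open>auto intro!: bounded_linear_imp_has_derivative simp: linear_linear\<close>)
qed

lemma Ck_on_add: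
  assumes "open U" "Ck_on k f U" "Ck_on k g U"
  shows "Ck_on k (\<lambda>x. f x + g x) U"
  using assms(2,3)
proof (induction k arbitrary: f g)
  case (Suc k)
  show ?case
    by (rule Ck_on_SucI[OF assms(1) has_derivative_add[OF Ck_on_SucD(1)[OF Suc.prems(1)] Ck_on_SucD(1)[OF Suc.prems(2)]]])
      (use Suc in auto)
qed (auto intro: continuous_intros)

lemma Ck_on_sum:
  assumes "open U" "finite I" "\<And>i. i \<in> I \<Longrightarrow> Ck_on k (f i) U"
  shows "Ck_on k (\<lambda>x. \<Sum>i\<in>I. f i x) U"
  using assms(2,3) by (induction I) (auto intro: Ck_on_add Ck_on_const assms(1))

lemma Ck_on_bilinear:
  fixes h :: "'b::euclidean_space \<Rightarrow> 'c::euclidean_space \<Rightarrow> 'd::euclidean_space"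
  assumes "open U" "bilinear h" "Ck_on k f U" "Ck_on k g U"
  shows "Ck_on k (\<lambda>x. h (f x) (g x)) U"
  using assms(3,4)
proof (induction k arbitrary: f g)
  case 0
  have "bounded_bilinear h" using assms(2) bilinear_conv_bounded_bilinear by blast
  then show ?case using 0 bounded_bilinear.continuous_on by auto
next
  case (Suc k)
  have bb: "bounded_bilinear h" using assms(2) bilinear_conv_bounded_bilinear by blast
  show ?case
    by (rule Ck_on_SucI[OF assms(1) bounded_bilinear.FDERIV[OF bb Ck_on_SucD(1)[OF Suc.prems(1)] Ck_on_SucD(1)[OF Suc.prems(2)]]])
      (use Suc.prems in \<open>auto intro!: Ck_on_add assms(1) Suc.IH Ck_on_Suc_imp[OF Suc.prems(1)] Ck_on_Suc_imp[OF Suc.prems(2)]\<close>)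
qed

lemma bilinear_scaleR: "bilinear (\<lambda>(c::real) (v::'a::real_vector). c *\<^sub>R v)"
  by (auto simp: bilinear_def intro!: linearI simp: algebra_simps)

lemma Ck_on_scaleR:
  assumes "open U" "Ck_on k f U" "Ck_on k g U"
  shows "Ck_on k (\<lambda>x. f x *\<^sub>R g x) U"
  by (rule Ck_on_bilinear[OF assms(1) bilinear_scaleR assms(2,3)])

lemma Ck_on_linear_comp:
  fixes l :: "'b::euclidean_space \<Rightarrow> 'c::euclidean_space"
  assumes "open U" "linear l" "Ck_on k f U"
  shows "Ck_on k (\<lambda>x. l (f x)) U"
  using assms(3)
proof (induction k arbitrary: f)
  case 0
  then show ?case using assms(2) by (auto intro: linear_continuous_on_compose)
next
  case (Suc k)
  have bl: "bounded_linear l" using assms(2) linear_conv_bounded_linear by auto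
  show ?case
    by (rule Ck_on_SucI[OF assms(1) bounded_linear.has_derivative[OF bl Ck_on_SucD(1)[OF Suc.prems]]])
      (use Suc in auto)
qed

lemma linear_expand:
  fixes f :: "'a::euclidean_space \<Rightarrow> 'b::real_vector"
  assumes "linear f"
  shows "f u = (\<Sum>b\<in>Basis. (u \<bullet> b) *\<^sub>R f b)"
proof -
  have "f (\<Sum>b\<in>Basis. (u \<bullet> b) *\<^sub>R b) = (\<Sum>b\<in>Basis. (u \<bullet> b) *\<^sub>R f b)"
    using assms by (simp add: linear_sum linear_cmul)
  then show ?thesis by (simp add: euclidean_representation)
qed

text \<open>In the chain rule both the base point and the direction of the derivative of
  \<open>f\<close> vary with \<open>x\<close>, whereas \<open>Ck_on\<close> speaks of fixed
  directions. Expanding the direction in the basis leaves products of scalar functions with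
  compositions, to which the induction hypothesis applies.\<close>

lemma Ck_on_compose:
  fixes f :: "'b::euclidean_space \<Rightarrow> 'c::euclidean_space"
  assumes "open U" "open V" "g ` U \<subseteq> V" "Ck_on k f V" "Ck_on k g U"
  shows "Ck_on k (\<lambda>x. f (g x)) U"
  using assms(4,5)
proof (induction k arbitrary: f)
  case 0
  then show ?case using continuous_on_compose2 assms(3) by fastforce
next
  case (Suc k)
  have df: "(f has_derivative frechet_derivative f (at y)) (at y)" if "y \<in> V" for y
    using Ck_on_SucD(1)[OF Suc.prems(1) that] .
  have gU: "\<And>x. x \<in> U \<Longrightarrow> g x \<in> V" using assms(3) by auto
  have exp: "frechet_derivative f (at (g x)) w =
      (\<Sum>b\<in>Basis. (w \<bullet> b) *\<^sub>R frechet_derivative f (at (g x)) b)" if "x \<in> U" for x w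
    by (rule linear_expand[OF has_derivative_linear[OF df[OF gU[OF that]]]])
  have in1: "Ck_on k (\<lambda>x. frechet_derivative g (at x) v \<bullet> b) U" for v b
    using Ck_on_linear_comp[OF assms(1) _ Ck_on_SucD(2)[OF Suc.prems(2)], of "\<lambda>y. y \<bullet> b" v]
    by (simp add: bounded_linear.linear bounded_linear_inner_left)
  have in2: "Ck_on k (\<lambda>x. frechet_derivative f (at (g x)) b) U" for b
    by (rule Suc.IH[OF Ck_on_SucD(2)[OF Suc.prems(1)] Ck_on_Suc_imp[OF Suc.prems(2)]])
  have "Ck_on k (\<lambda>x. \<Sum>b\<in>Basis. (frechet_derivative g (at x) v \<bullet> b) *\<^sub>R
      frechet_derivative f (at (g x)) b) U" for v
    by (rule Ck_on_sum[OF assms(1)]) (auto intro: Ck_on_scaleR[OF assms(1) in1 in2])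
  then have in3: "Ck_on k (\<lambda>x. frechet_derivative f (at (g x)) (frechet_derivative g (at x) v)) U" for v
    by (rule Ck_on_cong_imp[OF assms(1), rotated]) (use exp in auto)
  show ?case
    by (rule Ck_on_SucI[OF assms(1) has_derivative_compose[OF Ck_on_SucD(1)[OF Suc.prems(2)] df[OF gU]] in3])
qed

lemma Ck_on_Pair:
  assumes "open U" "Ck_on k f U" "Ck_on k g U"
  shows "Ck_on k (\<lambda>x. (f x, g x)) U"
proof -
  have "Ck_on k (\<lambda>x. (f x, 0) + (0, g x)) U"
    by (intro Ck_on_add assms(1) Ck_on_linear_comp[OF assms(1) _ assms(2)] Ck_on_linear_comp[OF assms(1) _ assms(3)])
      (auto intro!: linearI)
  then show ?thesis by simp
qed

lemma smooth_on_linear: "open U \<Longrightarrow> linear f \<Longrightarrow> smooth_on f U"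
  by (simp add: smooth_on_def Ck_on_linear)

lemma smooth_on_const: "open U \<Longrightarrow> smooth_on (\<lambda>x. c) U"
  by (simp add: smooth_on_def Ck_on_const)

lemma smooth_on_add:
  "open U \<Longrightarrow> smooth_on f U \<Longrightarrow> smooth_on g U \<Longrightarrow> smooth_on (\<lambda>x. f x + g x) U"
  by (simp add: smooth_on_def Ck_on_add)

lemma smooth_on_sum:
  "open U \<Longrightarrow> finite I \<Longrightarrow> (\<And>i. i \<in> I \<Longrightarrow> smooth_on (f i) U) \<Longrightarrow> smooth_on (\<lambda>x. \<Sum>i\<in>I. f i x) U"
  by (simp add: smooth_on_def Ck_on_sum)

lemma smooth_on_linear_comp:
  "open U \<Longrightarrow> linear l \<Longrightarrow> smooth_on f U \<Longrightarrow> smooth_on (\<lambda>x. l (f x)) U"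
  by (simp add: smooth_on_def Ck_on_linear_comp)

lemma smooth_on_scaleR:
  "open U \<Longrightarrow> smooth_on f U \<Longrightarrow> smooth_on g U \<Longrightarrow> smooth_on (\<lambda>x. f x *\<^sub>R g x) U"
  by (simp add: smooth_on_def Ck_on_scaleR)

lemma smooth_on_cmul: "open U \<Longrightarrow> smooth_on f U \<Longrightarrow> smooth_on (\<lambda>x. c *\<^sub>R f x) U"
  by (simp add: smooth_on_const smooth_on_scaleR)

lemma smooth_on_diff:
  assumes "open U" "smooth_on f U" "smooth_on g U"
  shows "smooth_on (\<lambda>x. f x - g x) U"
  using smooth_on_add[OF assms(1,2) smooth_on_cmul[OF assms(1,3), of "-1"]] by simp

lemma smooth_on_bilinear:
  "open U \<Longrightarrow> bilinear h \<Longrightarrow> smooth_on f U \<Longrightarrow> smooth_on g U \<Longrightarrow> smooth_on (\<lambda>x. h (f x) (g x)) U"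
  by (simp add: smooth_on_def Ck_on_bilinear)

lemma smooth_on_Pair:
  "open U \<Longrightarrow> smooth_on f U \<Longrightarrow> smooth_on g U \<Longrightarrow> smooth_on (\<lambda>x. (f x, g x)) U"
  by (simp add: smooth_on_def Ck_on_Pair)

lemma smooth_on_compose:
  "open U \<Longrightarrow> open V \<Longrightarrow> g ` U \<subseteq> V \<Longrightarrow> smooth_on f V \<Longrightarrow> smooth_on g U \<Longrightarrow> smooth_on (\<lambda>x. f (g x)) U"
  unfolding smooth_on_def by (blast intro: Ck_on_compose)

lemma smooth_on_subset: "smooth_on f U \<Longrightarrow> T \<subseteq> U \<Longrightarrow> smooth_on f T"
  unfolding smooth_on_def by (blast intro: Ck_on_subset)

lemma smooth_on_imp_continuous: "smooth_on f U \<Longrightarrow> continuous_on U f"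
  unfolding smooth_on_def using Ck_on.simps(1) by blast

lemma smooth_on_frechet:
  assumes "smooth_on f U"
  shows "x \<in> U \<Longrightarrow> (f has_derivative frechet_derivative f (at x)) (at x)"
    and "smooth_on (\<lambda>x. frechet_derivative f (at x) v) U"
  using assms Ck_on_SucD unfolding smooth_on_def by blast+

section \<open>The smooth inverse function theorem\<close>

text \<open>A product rule in which the scalar factor is merely continuous: its variation is
  multiplied by \<open>f\<close>, which vanishes at \<open>x\<close>. This upgrades continuity of an
  inverse to differentiability.\<close>

lemma has_derivative_scaleR_zero:
  fixes f :: "'a::real_normed_vector \<Rightarrow> 'b::real_normed_vector"
  assumes "(f has_derivative f') (at x)" "f x = 0" "isCont c x"
  shows "((\<lambda>y. c y *\<^sub>R f y) has_derivative (\<lambda>v. c x *\<^sub>R f' v)) (at x)"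
proof -
  have bl: "bounded_linear f'" using assms(1) has_derivative_bounded_linear by blast
  have 1: "((\<lambda>y. norm (f y - f x - f' (y - x)) / norm (y - x)) \<longlongrightarrow> 0) (at x)"
    using assms(1) by (simp add: has_derivative_iff_norm)
  obtain B where B: "\<And>v. norm (f' v) \<le> norm v * B" using bounded_linear.bounded[OF bl] by blast
  have c0: "((\<lambda>y. \<bar>c y - c x\<bar>) \<longlongrightarrow> 0) (at x)"
    using assms(3) by (simp add: isCont_def LIM_zero tendsto_rabs_zero)
  have cb: "((\<lambda>y. \<bar>c y\<bar>) \<longlongrightarrow> \<bar>c x\<bar>) (at x)"
    using assms(3) by (simp add: isCont_def tendsto_rabs)
  have lim: "((\<lambda>y. \<bar>c y\<bar> * (norm (f y - f x - f' (y - x)) / norm (y - x)) + \<bar>c y - c x\<bar> * B) \<longlongrightarrow> 0) (at x)"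
    using tendsto_add[OF tendsto_mult[OF cb 1] tendsto_mult_right[OF c0, of B]] by simp
  have bound: "norm (c y *\<^sub>R f y - c x *\<^sub>R f x - c x *\<^sub>R f' (y - x)) / norm (y - x)
      \<le> \<bar>c y\<bar> * (norm (f y - f x - f' (y - x)) / norm (y - x)) + \<bar>c y - c x\<bar> * B" if "y \<noteq> x" for y
  proof -
    have "c y *\<^sub>R f y - c x *\<^sub>R f x - c x *\<^sub>R f' (y - x)
        = c y *\<^sub>R (f y - f x - f' (y - x)) + (c y - c x) *\<^sub>R f' (y - x)"
      using assms(2) by (simp add: algebra_simps)
    then have "norm (c y *\<^sub>R f y - c x *\<^sub>R f x - c x *\<^sub>R f' (y - x))
        \<le> \<bar>c y\<bar> * norm (f y - f x - f' (y - x)) + \<bar>c y - c x\<bar> * norm (f' (y - x))"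
      using norm_triangle_ineq[of "c y *\<^sub>R (f y - f x - f' (y - x))" "(c y - c x) *\<^sub>R f' (y - x)"] by simp
    also have "\<dots> \<le> \<bar>c y\<bar> * norm (f y - f x - f' (y - x)) + \<bar>c y - c x\<bar> * (norm (y - x) * B)"
      using B by (intro add_left_mono mult_left_mono) auto
    finally show ?thesis using that by (simp add: field_simps)
  qed
  have "((\<lambda>y. norm (c y *\<^sub>R f y - c x *\<^sub>R f x - c x *\<^sub>R f' (y - x)) / norm (y - x)) \<longlongrightarrow> 0) (at x)"
    by (rule tendsto_sandwich[OF _ _ tendsto_const lim])
      (use bound in \<open>auto simp: eventually_at_filter\<close>)
  then show ?thesis
    by (simp add: has_derivative_iff_norm bounded_linear_compose[OF bounded_linear_scaleR_right bl])
qed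

text \<open>The derivative of \<open>u = a\<inverse> v\<close> is read off \<open>a x\<^sub>0 (u x - u x\<^sub>0) = - (a x - a x\<^sub>0) (u x)\<close>.\<close>
lemma smooth_on_inverse_family:
  fixes a :: "'a::euclidean_space \<Rightarrow> 'b::euclidean_space \<Rightarrow> 'b"
  assumes U: "open U" and lin: "\<And>x. x \<in> U \<Longrightarrow> linear (a x)" and bij: "\<And>x. x \<in> U \<Longrightarrow> bij (a x)"
    and sm: "\<And>v. smooth_on (\<lambda>x. a x v) U"
  shows "smooth_on (\<lambda>x. inv (a x) v) U"
proof -
  define R where "R x v = inv (a x) v" for x v
  have aR: "a x (R x v) = v" if "x \<in> U" for x v
    using bij[OF that] by (simp add: R_def bij_is_surj surj_f_inv_f)
  have Ra: "R x (a x v) = v" if "x \<in> U" for x v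
    using bij[OF that] by (simp add: R_def bij_is_inj)
  have linR: "linear (R x)" if "x \<in> U" for x
  proof (rule linearI)
    show "R x (b1 + b2) = R x b1 + R x b2" for b1 b2
      using Ra[OF that, of "R x b1 + R x b2"] aR[OF that] linear_add[OF lin[OF that]] by simp
    show "R x (r *\<^sub>R b) = r *\<^sub>R R x b" for r b
      using Ra[OF that, of "r *\<^sub>R R x b"] aR[OF that] linear_cmul[OF lin[OF that]] by simp
  qed
  have expand: "a x u = (\<Sum>b\<in>Basis. (u \<bullet> b) *\<^sub>R a x b)" if "x \<in> U" for x u
    by (rule linear_expand[OF lin[OF that]])
  have expandR: "R x u = (\<Sum>b\<in>Basis. (u \<bullet> b) *\<^sub>R R x b)" if "x \<in> U" for x u
    by (rule linear_expand[OF linR[OF that]])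
  have ca: "isCont (\<lambda>x. a x b) x" if "x \<in> U" for x b
    using smooth_on_imp_continuous[OF sm] that U continuous_on_eq_continuous_at by blast
  have cont: "isCont (\<lambda>x. R x v) x0" if x0: "x0 \<in> U" for x0 v
  proof -
    \<comment> \<open>\<open>m\<close> bounds \<open>a x0\<close> from below and \<open>s x\<close>
      bounds the operator norm of \<open>a x - a x0\<close>. Once \<open>s x < m / 2\<close>, the
      inverses \<open>R x\<close> are uniformly bounded by \<open>2 / m\<close>.\<close>
    obtain m where m: "m > 0" "\<And>u. m * norm u \<le> norm (a x0 u)"
      using linear_inj_bounded_below_pos[OF lin[OF x0]] bij[OF x0] bij_is_inj by blast
    define s where "s x = (\<Sum>b\<in>Basis. norm (a x b - a x0 b))" for x
    have s: "(s \<longlongrightarrow> 0) (at x0)"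
    proof -
      have "isCont s x0" unfolding s_def using ca[OF x0] by (intro continuous_intros)
      then show ?thesis by (simp add: isCont_def s_def)
    qed
    have diff: "norm (a x u - a x0 u) \<le> s x * norm u" if "x \<in> U" for x u
    proof -
      have "a x u - a x0 u = (\<Sum>b\<in>Basis. (u \<bullet> b) *\<^sub>R (a x b - a x0 b))"
        by (subst expand[OF that], subst expand[OF x0]) (simp add: sum_subtractf algebra_simps)
      then have "norm (a x u - a x0 u) \<le> (\<Sum>b\<in>Basis. norm ((u \<bullet> b) *\<^sub>R (a x b - a x0 b)))"
        by (simp only: norm_sum)
      also have "\<dots> \<le> (\<Sum>b\<in>Basis. norm u * norm (a x b - a x0 b))"
        by (intro sum_mono) (simp add: Basis_le_norm mult_right_mono)
      finally show ?thesis by (simp add: s_def sum_distrib_left mult.commute)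
    qed
    have evs: "eventually (\<lambda>x. s x < m / 2) (at x0)"
      using order_tendstoD(2)[OF s, of "m/2"] m(1) by simp
    have evU: "eventually (\<lambda>x. x \<in> U) (at x0)" using U x0 eventually_at_topological by blast
    have "eventually (\<lambda>x. norm (R x v - R x0 v) \<le> s x * (2 / m * norm v) / m) (at x0)"
      using evs evU
    proof eventually_elim
      case (elim x)
      have "m * norm (R x v) \<le> norm (a x0 (R x v))" by (rule m(2))
      also have "\<dots> \<le> norm (a x (R x v)) + norm (a x (R x v) - a x0 (R x v))"
        using norm_triangle_sub[of "a x0 (R x v)" "a x (R x v)"] by (simp add: norm_minus_commute)
      also have "\<dots> \<le> norm v + m / 2 * norm (R x v)"
        using diff[OF elim(2), of "R x v"] aR[OF elim(2), of v] elim(1)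
        by (smt (verit) mult_right_mono norm_ge_zero)
      finally have b: "norm (R x v) \<le> 2 / m * norm v" using m(1) by (simp add: field_simps)
      have "a x0 (R x v - R x0 v) = - (a x (R x v) - a x0 (R x v))"
        using lin[OF x0] by (simp add: linear_diff aR x0 elim(2))
      then have "m * norm (R x v - R x0 v) \<le> norm (a x (R x v) - a x0 (R x v))"
        by (metis m(2) norm_minus_cancel)
      also have "\<dots> \<le> s x * norm (R x v)" by (rule diff[OF elim(2)])
      also have "\<dots> \<le> s x * (2 / m * norm v)"
        by (rule mult_left_mono[OF b]) (simp add: s_def sum_nonneg)
      finally show ?case using m(1) by (simp add: field_simps)
    qed
    moreover have "((\<lambda>x. s x * (2 / m * norm v) / m) \<longlongrightarrow> 0) (at x0)"
      using tendsto_divide[OF tendsto_mult_right[OF s] tendsto_const, of m "2 / m * norm v"] m(1) by simp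
    ultimately have "((\<lambda>x. norm (R x v - R x0 v)) \<longlongrightarrow> 0) (at x0)"
      using tendsto_sandwich[of "\<lambda>_. 0" "\<lambda>x. norm (R x v - R x0 v)" "at x0" "\<lambda>x. s x * (2 / m * norm v) / m" 0]
      by simp
    then show ?thesis by (simp add: isCont_def LIM_zero_iff tendsto_norm_zero_iff)
  qed
  have der: "((\<lambda>x. R x v) has_derivative
      (\<lambda>w. - R x0 (\<Sum>b\<in>Basis. (R x0 v \<bullet> b) *\<^sub>R frechet_derivative (\<lambda>x. a x b) (at x0) w))) (at x0)"
    if x0: "x0 \<in> U" for x0 v
  proof -
    have "((\<lambda>x. a x b - a x0 b) has_derivative frechet_derivative (\<lambda>x. a x b) (at x0)) (at x0)" for b
      using has_derivative_diff[OF smooth_on_frechet(1)[OF sm x0, of b] has_derivative_const[of "a x0 b"]]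
      by simp
    \<comment> \<open>Only continuity of \<open>R x v\<close> is known so far; it suffices because
      \<open>a x b - a x0 b\<close> vanishes at \<open>x0\<close>.\<close>
    then have "((\<lambda>x. (R x v \<bullet> b) *\<^sub>R (a x b - a x0 b)) has_derivative
        (\<lambda>w. (R x0 v \<bullet> b) *\<^sub>R frechet_derivative (\<lambda>x. a x b) (at x0) w)) (at x0)" for b
      by (rule has_derivative_scaleR_zero[OF _ _ isCont_inner[OF cont[OF x0] continuous_const]]) simp
    then have "((\<lambda>x. \<Sum>b\<in>Basis. (R x v \<bullet> b) *\<^sub>R (a x b - a x0 b)) has_derivative
        (\<lambda>w. \<Sum>b\<in>Basis. (R x0 v \<bullet> b) *\<^sub>R frechet_derivative (\<lambda>x. a x b) (at x0) w)) (at x0)"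
      by (intro has_derivative_sum)
    then have d: "((\<lambda>x. R x0 v - R x0 (\<Sum>b\<in>Basis. (R x v \<bullet> b) *\<^sub>R (a x b - a x0 b))) has_derivative
        (\<lambda>w. 0 - R x0 (\<Sum>b\<in>Basis. (R x0 v \<bullet> b) *\<^sub>R frechet_derivative (\<lambda>x. a x b) (at x0) w))) (at x0)"
      by (intro has_derivative_diff[OF has_derivative_const] bounded_linear.has_derivative[of "R x0"]
          linear_linear[THEN iffD2, OF linR[OF x0]])
    have eq: "R x0 v - R x0 (\<Sum>b\<in>Basis. (R x v \<bullet> b) *\<^sub>R (a x b - a x0 b)) = R x v" if "x \<in> U" for x
    proof -
      have "(\<Sum>b\<in>Basis. (R x v \<bullet> b) *\<^sub>R (a x b - a x0 b)) = a x (R x v) - a x0 (R x v)"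
        by (subst expand[OF that], subst expand[OF x0]) (simp add: sum_subtractf algebra_simps)
      then show ?thesis using aR[OF that] Ra[OF x0] linear_diff[OF linR[OF x0]] by simp
    qed
    show ?thesis using has_derivative_transform_within_open[OF d U x0 eq] by simp
  qed
  have "Ck_on k (\<lambda>x. R x v) U" for k v
  proof (induction k arbitrary: v)
    case 0
    show ?case unfolding Ck_on.simps(1) by (rule continuous_at_imp_continuous_on) (use cont in blast)
  next
    case (Suc k)
    have 1: "Ck_on k (\<lambda>x. \<Sum>b\<in>Basis. (R x v \<bullet> b) *\<^sub>R frechet_derivative (\<lambda>x. a x b) (at x) w) U" for w
      using Ck_on_linear_comp[OF U bounded_linear.linear[OF bounded_linear_inner_left] Suc]
        smooth_on_frechet(2)[OF sm] unfolding smooth_on_def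
      by (intro Ck_on_sum Ck_on_scaleR U finite_Basis) auto
    \<comment> \<open>The argument of \<open>R x\<close> varies with \<open>x\<close>; it is
      expanded in the basis so that the induction hypothesis for fixed vectors applies.\<close>
    have 3: "Ck_on k (\<lambda>x. - (\<Sum>c\<in>Basis. ((\<Sum>b\<in>Basis. (R x v \<bullet> b) *\<^sub>R
        frechet_derivative (\<lambda>x. a x b) (at x) w) \<bullet> c) *\<^sub>R R x c)) U" for w
      using Ck_on_linear_comp[OF U bounded_linear.linear[OF bounded_linear_inner_left] 1] Suc
      by (intro Ck_on_linear_comp[OF U module_hom_uminus] Ck_on_sum Ck_on_scaleR U finite_Basis) auto
    have 2: "Ck_on k (\<lambda>x. - R x (\<Sum>b\<in>Basis. (R x v \<bullet> b) *\<^sub>R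
        frechet_derivative (\<lambda>x. a x b) (at x) w)) U" for w
      by (rule Ck_on_cong_imp[OF U _ 3]) (rule arg_cong[of _ _ uminus, OF expandR[symmetric]])
    show ?case by (rule Ck_on_SucI[OF U der 2])
  qed
  then show ?thesis by (simp add: smooth_on_def R_def)
qed

text \<open>The derivative of \<open>g\<close> at \<open>y\<close> is the inverse of the derivative
  of \<open>f\<close> at \<open>g y\<close>. Inversion is smooth, so each class reached by
  \<open>g\<close> yields the next one, starting from continuity.\<close>

theorem smooth_inverse_function_theorem:
  fixes f :: "'a::euclidean_space \<Rightarrow> 'a"
  assumes U: "open U" and p: "p \<in> U" and sm: "smooth_on f U"
    and der: "(f has_derivative f') (at p)" and inj: "inj f'"
  obtains U' V g where "open U'" "U' \<subseteq> U" "p \<in> U'" "open V" "homeomorphism U' V f g" "smooth_on g V"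
proof -
  have lin: "linear (frechet_derivative f (at x))" if "x \<in> U" for x
    using smooth_on_frechet(1)[OF sm that] has_derivative_linear by blast
  define F where "F x = Blinfun (frechet_derivative f (at x))" for x
  have F: "blinfun_apply (F x) = frechet_derivative f (at x)" if "x \<in> U" for x
    using lin[OF that] by (simp add: F_def bounded_linear_Blinfun_apply linear_linear)
  have dF: "(f has_derivative blinfun_apply (F x)) (at x)" if "x \<in> U" for x
    using smooth_on_frechet(1)[OF sm that] F[OF that] by simp
  have cF: "continuous_on U F"
  proof (rule continuous_on_blinfun_componentwise)
    fix i :: 'a assume "i \<in> Basis"
    have "continuous_on U (\<lambda>x. frechet_derivative f (at x) i)"
      by (rule smooth_on_imp_continuous[OF smooth_on_frechet(2)[OF sm]])
    then show "continuous_on U (\<lambda>x. blinfun_apply (F x) i)"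
      by (rule continuous_on_eq) (simp add: F)
  qed
  have f': "f' = frechet_derivative f (at p)" using frechet_derivative_at[OF der] .
  have linf': "linear f'" using lin[OF p] f' by simp
  obtain h where h: "linear h" "h \<circ> f' = id"
    using linear_injective_left_inverse[OF linf' inj] by blast
  have inv: "Blinfun h o\<^sub>L F p = id_blinfun"
    by (rule blinfun_eqI)
      (use h F[OF p] f' in \<open>simp add: bounded_linear_Blinfun_apply linear_linear fun_eq_iff\<close>)
  obtain U' V g g' where 1: "open U'" "U' \<subseteq> U" "p \<in> U'" "open V" "f p \<in> V" "homeomorphism U' V f g"
    and dg: "\<And>y. y \<in> V \<Longrightarrow> (g has_derivative (g' y)) (at y)"
    and g': "\<And>y. y \<in> V \<Longrightarrow> g' y = inv (blinfun_apply (F (g y)))"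
    and bij: "\<And>y. y \<in> V \<Longrightarrow> bij (blinfun_apply (F (g y)))"
    using inverse_function_theorem[OF U dF cF p inv] by metis
  have gU: "g ` V = U'" and cg: "continuous_on V g" using 1(6) by (auto simp: homeomorphism_def)
  have bijU: "bij (frechet_derivative f (at x))" if "x \<in> U'" for x
    using bij gU that F 1(2) by (metis image_iff subsetD)
  have smR: "smooth_on (\<lambda>x. inv (frechet_derivative f (at x)) v) U'" for v
    by (rule smooth_on_inverse_family[OF 1(1)])
      (use lin 1(2) bijU smooth_on_subset[OF smooth_on_frechet(2)[OF sm]] in auto)
  have "Ck_on k g V" for k
  proof (induction k)
    case 0
    then show ?case using cg by simp
  next
    case (Suc k)
    have "Ck_on k (\<lambda>y. inv (frechet_derivative f (at (g y))) v) V" for v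
      by (rule Ck_on_compose[OF 1(4,1) _ _ Suc]) (use gU smR in \<open>auto simp: smooth_on_def\<close>)
    then have "Ck_on k (\<lambda>y. g' y v) V" for v
      by (rule Ck_on_cong_imp[OF 1(4), rotated]) (use g' gU F 1(2) in auto)
    from Ck_on_SucI[OF 1(4) dg this] show ?case .
  qed
  then show ?thesis using that 1 by (auto simp: smooth_on_def)
qed

section \<open>The exponential of an endomorphism\<close>

text \<open>A copy of the type of endomorphisms that can be an instance of the class of Banach algebras,
  which makes the exponential function of the library available.\<close>
typedef (overloaded) 'a endo = "UNIV :: ('a::euclidean_space \<Rightarrow>\<^sub>L 'a) set"
  morphisms blin_of endo_of ..

setup_lifting type_definition_endo

instantiation endo :: (euclidean_space) real_normed_algebra_1
begin

lift_definition zero_endo :: "'a endo" is 0 .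
lift_definition one_endo :: "'a endo" is id_blinfun .
lift_definition plus_endo :: "'a endo \<Rightarrow> 'a endo \<Rightarrow> 'a endo" is "(+)" .
lift_definition minus_endo :: "'a endo \<Rightarrow> 'a endo \<Rightarrow> 'a endo" is "(-)" .
lift_definition uminus_endo :: "'a endo \<Rightarrow> 'a endo" is "uminus" .
lift_definition times_endo :: "'a endo \<Rightarrow> 'a endo \<Rightarrow> 'a endo" is "(o\<^sub>L)" .
lift_definition scaleR_endo :: "real \<Rightarrow> 'a endo \<Rightarrow> 'a endo" is "(*\<^sub>R)" .
lift_definition norm_endo :: "'a endo \<Rightarrow> real" is norm .
definition dist_endo :: "'a endo \<Rightarrow> 'a endo \<Rightarrow> real" where "dist_endo x y = norm (x - y)"
definition sgn_endo :: "'a endo \<Rightarrow> 'a endo" where "sgn_endo x = scaleR (inverse (norm x)) x"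
definition uniformity_endo :: "('a endo \<times> 'a endo) filter" where
  "uniformity_endo = (INF e\<in>{0<..}. principal {(x, y). dist x y < e})"
definition open_endo :: "'a endo set \<Rightarrow> bool" where
  "open_endo U \<longleftrightarrow> (\<forall>x\<in>U. eventually (\<lambda>(x', y). x' = x \<longrightarrow> y \<in> U) uniformity)"

instance
proof
  fix x y z :: "'a endo" and a b :: real
  show "x + y + z = x + (y + z)" by transfer simp
  show "x + y = y + x" by transfer simp
  show "0 + x = x" by transfer simp
  show "- x + x = 0" by transfer simp
  show "x - y = x + - y" by transfer simp
  show "x * y * z = x * (y * z)" by (transfer, rule blinfun_eqI) simp
  show "1 * x = x" "x * 1 = x" by (transfer, auto intro: blinfun_eqI)+
  show "(x + y) * z = x * z + y * z" "x * (y + z) = x * y + x * z"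
    by (transfer, simp add: bounded_bilinear.add_left[OF bounded_bilinear_blinfun_compose] bounded_bilinear.add_right[OF bounded_bilinear_blinfun_compose])+
  show "0 \<noteq> (1 :: 'a endo)"
  proof (transfer, rule notI)
    assume "(0 :: 'a \<Rightarrow>\<^sub>L 'a) = id_blinfun"
    then have "norm (id_blinfun :: 'a \<Rightarrow>\<^sub>L 'a) = 0" by (metis norm_zero)
    then show False by simp
  qed
  show "a *\<^sub>R (x + y) = a *\<^sub>R x + a *\<^sub>R y" by transfer (simp add: scaleR_add_right)
  show "(a + b) *\<^sub>R x = a *\<^sub>R x + b *\<^sub>R x" by transfer (simp add: scaleR_add_left)
  show "a *\<^sub>R b *\<^sub>R x = (a * b) *\<^sub>R x" by transfer simp
  show "1 *\<^sub>R x = x" by transfer simp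
  show "a *\<^sub>R x * y = a *\<^sub>R (x * y)" "x * a *\<^sub>R y = a *\<^sub>R (x * y)"
    by (transfer, simp add: bounded_bilinear.scaleR_left[OF bounded_bilinear_blinfun_compose] bounded_bilinear.scaleR_right[OF bounded_bilinear_blinfun_compose])+
  show "dist x y = norm (x - y)" by (rule dist_endo_def)
  show "sgn x = inverse (norm x) *\<^sub>R x" by (simp add: sgn_endo_def)
  show "uniformity = (INF e\<in>{0<..}. principal {(x, y :: 'a endo). dist x y < e})"
    by (rule uniformity_endo_def)
  show "open U \<longleftrightarrow> (\<forall>x\<in>U. eventually (\<lambda>(x', y). x' = x \<longrightarrow> y \<in> U) uniformity)" for U :: "'a endo set"
    by (rule open_endo_def)
  show "norm x = 0 \<longleftrightarrow> x = 0" by transfer simp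
  show "norm (x + y) \<le> norm x + norm y" by transfer (rule norm_triangle_ineq)
  show "norm (a *\<^sub>R x) = \<bar>a\<bar> * norm x" by transfer simp
  show "norm (x * y) \<le> norm x * norm y" by transfer (rule norm_blinfun_compose)
  show "norm (1 :: 'a endo) = 1" by transfer simp
qed

end

lemma bounded_linear_blin_of: "bounded_linear blin_of"
  by (rule bounded_linear_intro[of _ 1])
    (simp_all add: plus_endo.rep_eq scaleR_endo.rep_eq norm_endo.rep_eq)

lemma bounded_linear_endo_of: "bounded_linear endo_of"
  by (rule bounded_linear_intro[of _ 1])
    (simp_all add: plus_endo.abs_eq scaleR_endo.abs_eq norm_endo.abs_eq)

instance endo :: (euclidean_space) banach
proof
  fix X :: "nat \<Rightarrow> 'a endo"
  assume "Cauchy X"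
  then have "Cauchy (\<lambda>n. blin_of (X n))"
    by (rule bounded_linear.Cauchy[OF bounded_linear_blin_of])
  then obtain l where "(\<lambda>n. blin_of (X n)) \<longlonglongrightarrow> l"
    using Cauchy_convergent convergent_def by blast
  then have "(\<lambda>n. endo_of (blin_of (X n))) \<longlonglongrightarrow> endo_of l"
    by (rule bounded_linear.tendsto[OF bounded_linear_endo_of])
  then show "convergent X" by (auto simp: convergent_def blin_of_inverse)
qed

lemma blin_of_power: "blin_of (x ^ n) = ((o\<^sub>L) (blin_of x) ^^ n) id_blinfun"
  by (induction n) (simp_all add: one_endo.rep_eq times_endo.rep_eq)

lemma blinfun_exp_eq: "blinfun_exp A = blin_of (exp (endo_of A))"
proof -
  have "blin_of (exp (endo_of A)) = (\<Sum>n. blin_of (endo_of A ^ n /\<^sub>R fact n))"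
    unfolding exp_def
    by (rule bounded_linear.suminf[OF bounded_linear_blin_of summable_exp_generic])
  then show ?thesis
    by (simp add: blinfun_exp_def scaleR_endo.rep_eq blin_of_power endo_of_inverse)
qed

lemma blinfun_exp_sums:
  "(\<lambda>n. ((blinfun_apply A ^^ n) v) /\<^sub>R fact n) sums blinfun_exp A v"
proof -
  have "(\<lambda>n. blin_of (endo_of A ^ n /\<^sub>R fact n)) sums blin_of (exp (endo_of A))"
    by (rule bounded_linear.sums[OF bounded_linear_blin_of exp_converges])
  then have "(\<lambda>n. blinfun_apply (blin_of (endo_of A ^ n /\<^sub>R fact n)) v) sums blinfun_exp A v"
    unfolding blinfun_exp_eq by (rule bounded_linear.sums[OF blinfun.bounded_linear_left])
  moreover have "blinfun_apply (((o\<^sub>L) A ^^ n) id_blinfun) v = (blinfun_apply A ^^ n) v" for n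
    by (induction n) auto
  ultimately show ?thesis
    by (simp add: scaleR_endo.rep_eq blin_of_power endo_of_inverse blinfun.scaleR_left)
qed

lemma blinfun_exp_minus:
  "blinfun_exp (- A) o\<^sub>L blinfun_exp A = id_blinfun" "blinfun_exp A o\<^sub>L blinfun_exp (- A) = id_blinfun"
  using exp_minus_inverse[of "endo_of A"] exp_minus_inverse[of "endo_of (- A)"]
  by (simp_all add: blinfun_exp_eq one_endo.rep_eq flip: times_endo.rep_eq uminus_endo.abs_eq)

lemma blinfun_exp_0: "blinfun_exp 0 = id_blinfun"
  by (simp add: blinfun_exp_eq one_endo.rep_eq flip: zero_endo_def)

lemma blinfun_exp_minus_apply [simp]:
  "blinfun_exp (- A) (blinfun_exp A v) = v" "blinfun_exp A (blinfun_exp (- A) v) = v"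
  using arg_cong[OF blinfun_exp_minus(1)[of A], of "\<lambda>f. blinfun_apply f v"]
    arg_cong[OF blinfun_exp_minus(2)[of A], of "\<lambda>f. blinfun_apply f v"] by auto

lemma bij_blinfun_exp: "bij (blinfun_apply (blinfun_exp A))"
  by (rule o_bij[of "blinfun_apply (blinfun_exp (- A))"]) auto

lemma blinfun_exp_has_vector_derivative:
  "((\<lambda>t. blinfun_exp (t *\<^sub>R A)) has_vector_derivative A o\<^sub>L blinfun_exp (t *\<^sub>R A)) (at t)"
proof -
  have "((\<lambda>t. blin_of (exp (t *\<^sub>R endo_of A))) has_vector_derivative
      blin_of (endo_of A * exp (t *\<^sub>R endo_of A))) (at t)"
    by (rule bounded_linear.has_vector_derivative[OF bounded_linear_blin_of
          exp_scaleR_has_vector_derivative_left])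
  then show ?thesis
    by (simp add: blinfun_exp_eq times_endo.rep_eq endo_of_inverse flip: scaleR_endo.abs_eq)
qed

lemma blinfun_exp_intertwine:
  assumes "bounded_linear g" "\<And>v. g (blinfun_apply A v) = blinfun_apply B (g v)"
  shows "g (blinfun_exp A v) = blinfun_exp B (g v)"
proof -
  have "g ((blinfun_apply A ^^ n) v) = (blinfun_apply B ^^ n) (g v)" for n
    by (induction n) (auto simp: assms(2))
  then have "(\<lambda>n. ((blinfun_apply B ^^ n) (g v)) /\<^sub>R fact n) sums g (blinfun_exp A v)"
    using bounded_linear.sums[OF assms(1) blinfun_exp_sums[of A v]]
    by (simp add: linear_cmul bounded_linear.linear[OF assms(1)])
  then show ?thesis using blinfun_exp_sums sums_unique2 by blast
qed

lemma blinfun_exp_commute: "blinfun_apply A (blinfun_exp (t *\<^sub>R A) v) = blinfun_exp (t *\<^sub>R A) (blinfun_apply A v)"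
  by (rule blinfun_exp_intertwine) (auto simp: blinfun.bounded_linear_right blinfun.scaleR_left blinfun.scaleR_right)

lemma blinfun_exp_nilpotent:
  assumes "blinfun_apply A (blinfun_apply A v) = 0"
  shows "blinfun_exp A v = v + blinfun_apply A v"
proof -
  have "(blinfun_apply A ^^ (n + 2)) v = 0" for n
    by (induction n) (auto simp: assms numeral_2_eq_2)
  then have "(blinfun_apply A ^^ n) v /\<^sub>R fact n = 0" if "n \<notin> {..<2}" for n
    using that by (metis add.commute le_Suc_ex lessThan_iff not_less scaleR_zero_right)
  then have "(\<lambda>n. ((blinfun_apply A ^^ n) v) /\<^sub>R fact n) sums (\<Sum>n<2. ((blinfun_apply A ^^ n) v) /\<^sub>R fact n)"
    by (intro sums_finite) auto
  then have "blinfun_exp A v = (\<Sum>n<2. ((blinfun_apply A ^^ n) v) /\<^sub>R fact n)"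
    using blinfun_exp_sums sums_unique2 by blast
  then show ?thesis by (simp add: numeral_2_eq_2)
qed

lemma blinfun_exp_invariant:
  assumes "subspace S" "\<And>v. v \<in> S \<Longrightarrow> blinfun_apply A v \<in> S" "v \<in> S"
  shows "blinfun_exp A v \<in> S"
proof -
  have "(blinfun_apply A ^^ n) v \<in> S" for n by (induction n) (auto simp: assms)
  then have sum: "(\<Sum>n<m. ((blinfun_apply A ^^ n) v) /\<^sub>R fact n) \<in> S" for m
    by (intro subspace_sum[OF assms(1)] subspace_scale[OF assms(1)])
  show ?thesis
    by (rule closed_sequentially[OF closed_subspace[OF assms(1)] sum
          blinfun_exp_sums[of A v, unfolded sums_def]])
qed

text \<open>If \<open>A\<close> and \<open>B\<close> are compatible with a bilinear map in the manner of the Leibniz rule, then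
  \<open>exp (- t B) (h (exp (t A) x, exp (t A) y))\<close> has derivative \<open>0\<close>.\<close>
lemma blinfun_exp_bilinear:
  fixes h :: "'a::euclidean_space \<Rightarrow> 'a \<Rightarrow> 'b::euclidean_space"
  assumes h: "bilinear h"
    and AB: "\<And>x y. blinfun_apply B (h x y) = h (blinfun_apply A x) y + h x (blinfun_apply A y)"
  shows "blinfun_exp B (h x y) = h (blinfun_exp A x) (blinfun_exp A y)"
proof -
  have bb: "bounded_bilinear h" using h bilinear_conv_bounded_bilinear by blast
  define u where "u t = blinfun_apply (blinfun_exp (t *\<^sub>R (- B)))
    (h (blinfun_exp (t *\<^sub>R A) x) (blinfun_exp (t *\<^sub>R A) y))" for t
  have d: "((\<lambda>t. blinfun_exp (t *\<^sub>R A) v) has_vector_derivative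
      blinfun_apply A (blinfun_exp (t *\<^sub>R A) v)) (at t)" for v t
    using bounded_linear.has_vector_derivative[OF blinfun.bounded_linear_left
        blinfun_exp_has_vector_derivative] by simp
  have "(u has_vector_derivative 0) (at t)" for t
  proof -
    have "(u has_vector_derivative
        blinfun_apply (blinfun_exp (t *\<^sub>R (- B)))
          (h (blinfun_exp (t *\<^sub>R A) x) (blinfun_apply A (blinfun_exp (t *\<^sub>R A) y)) +
           h (blinfun_apply A (blinfun_exp (t *\<^sub>R A) x)) (blinfun_exp (t *\<^sub>R A) y)) +
        blinfun_apply ((- B) o\<^sub>L blinfun_exp (t *\<^sub>R (- B)))
          (h (blinfun_exp (t *\<^sub>R A) x) (blinfun_exp (t *\<^sub>R A) y))) (at t)"
      unfolding u_def
      by (rule bounded_bilinear.has_vector_derivative[OF bounded_bilinear_blinfun_apply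
            blinfun_exp_has_vector_derivative
            bounded_bilinear.has_vector_derivative[OF bb d d]])
    moreover have "blinfun_apply ((- B) o\<^sub>L blinfun_exp (t *\<^sub>R (- B))) w
        = - blinfun_apply (blinfun_exp (t *\<^sub>R (- B))) (blinfun_apply B w)" for w
      using blinfun_exp_commute[of "- B" t w] by (simp add: blinfun.minus_left blinfun.minus_right)
    ultimately show ?thesis by (simp add: AB add.commute)
  qed
  then have "u 1 = u 0"
    by (intro has_derivative_zero_unique[of UNIV]) (auto simp: has_vector_derivative_def)
  then have "blinfun_exp (- B) (h (blinfun_exp A x) (blinfun_exp A y)) = h x y"
    by (simp add: u_def blinfun_exp_0)
  then show ?thesis by (metis blinfun_exp_minus_apply(2))
qed

lemma continuous_on_blinfun_exp: "continuous_on UNIV (\<lambda>t. blinfun_exp (t *\<^sub>R A))"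
  by (rule continuous_at_imp_continuous_on)
    (use has_vector_derivative_continuous[OF blinfun_exp_has_vector_derivative] in auto)

lemma blinfun_exp_has_derivative:
  "((\<lambda>p. blinfun_exp (fst p *\<^sub>R A) (snd p)) has_derivative
    (\<lambda>q. blinfun_exp (fst p *\<^sub>R A) (fst q *\<^sub>R blinfun_apply A (snd p) + snd q))) (at p)"
proof -
  have 1: "((\<lambda>p. blinfun_exp (fst p *\<^sub>R A)) has_derivative
      (\<lambda>q. fst q *\<^sub>R (A o\<^sub>L blinfun_exp (fst p *\<^sub>R A)))) (at p)"
    using has_derivative_compose[OF has_derivative_fst[OF has_derivative_ident]
        blinfun_exp_has_vector_derivative[of A "fst p", unfolded has_vector_derivative_def]]
    by simp
  have "((\<lambda>p. blinfun_apply (blinfun_exp (fst p *\<^sub>R A)) (snd p)) has_derivative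
      (\<lambda>q. blinfun_apply (blinfun_exp (fst p *\<^sub>R A)) (snd q) +
        blinfun_apply (fst q *\<^sub>R (A o\<^sub>L blinfun_exp (fst p *\<^sub>R A))) (snd p))) (at p)"
    by (rule bounded_bilinear.FDERIV[OF bounded_bilinear_blinfun_apply 1
          has_derivative_snd[OF has_derivative_ident]])
  then show ?thesis
    by (simp add: blinfun.scaleR_left blinfun_exp_commute blinfun.add_right
        blinfun.scaleR_right add.commute)
qed

text \<open>The derivative at \<open>(t, x)\<close> in direction \<open>(s, z)\<close> is
  \<open>exp (t A) (s A x + z)\<close>: the same function at an argument that depends affinely on
  \<open>(t, x)\<close>. So the induction on the class closes up.\<close>

lemma smooth_on_blinfun_exp:
  "smooth_on (\<lambda>p. blinfun_exp (fst p *\<^sub>R A) (snd p)) (UNIV :: (real \<times> 'a::euclidean_space) set)"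
proof -
  let ?F = "\<lambda>p. blinfun_apply (blinfun_exp (fst p *\<^sub>R A)) (snd p)"
  note d = blinfun_exp_has_derivative[of A]
  have "Ck_on k ?F UNIV" for k
  proof (induction k)
    case 0
    have "isCont ?F p" for p using d has_derivative_continuous by blast
    then show ?case by (simp add: continuous_at_imp_continuous_on)
  next
    case (Suc k)
    have "Ck_on k (\<lambda>p. ?F (fst p, s *\<^sub>R blinfun_apply A (snd p) + z)) (UNIV :: (real \<times> 'a) set)" for s z
    proof (rule Ck_on_compose[OF open_UNIV open_UNIV _ Suc])
      have "linear (\<lambda>p::real \<times> 'a. s *\<^sub>R blinfun_apply A (snd p))"
        by (rule linearI) (auto simp: blinfun.add_right blinfun.scaleR_right algebra_simps)
      then show "Ck_on k (\<lambda>p::real \<times> 'a. (fst p, s *\<^sub>R blinfun_apply A (snd p) + z)) UNIV"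
        by (intro Ck_on_Pair Ck_on_add Ck_on_linear Ck_on_const linear_fst) auto
    qed auto
    then show ?case by (intro Ck_on_SucI[OF open_UNIV d]) simp
  qed
  then show ?thesis by (simp add: smooth_on_def)
qed

section \<open>Diagonalizable endomorphisms\<close>

text \<open>The monic polynomial with the roots \<open>ls\<close>, evaluated at \<open>f\<close> and
  applied to \<open>x\<close>. The factors act on the argument one at a time, which suits inductions
  over vectors.\<close>

primrec shifted_prod :: "real list \<Rightarrow> ('a::real_vector \<Rightarrow> 'a) \<Rightarrow> 'a \<Rightarrow> 'a" where
  "shifted_prod [] f x = x"
| "shifted_prod (l # ls) f x = shifted_prod ls f (f x - l *\<^sub>R x)"

text \<open>The sum of the eigenspaces for eigenvalues in \<open>S\<close>. As \<open>S\<close> may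
  be an interval such as \<open>{0<..}\<close>, it can be formed without knowing the
  spectrum.\<close>

definition eigs :: "('a::real_vector \<Rightarrow> 'a) \<Rightarrow> real set \<Rightarrow> 'a set" where
  "eigs f S = span {x. \<exists>c\<in>S. f x = c *\<^sub>R x}"

text \<open>If the entries of the list are distinct: diagonalizable with all eigenvalues in the list.\<close>
definition diagonal :: "real list \<Rightarrow> ('a::real_vector \<Rightarrow> 'a) \<Rightarrow> bool" where
  "diagonal ls f \<longleftrightarrow> (\<forall>x. shifted_prod ls f x = 0)"

text \<open>The function \<open>h\<close> of the diagonalizable endomorphism \<open>f\<close>, by Lagrange interpolation.\<close>
definition fcalc :: "real list \<Rightarrow> ('a::real_vector \<Rightarrow> 'a) \<Rightarrow> (real \<Rightarrow> real) \<Rightarrow> 'a \<Rightarrow> 'a" where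
  "fcalc ls f h x = (\<Sum>l\<in>set ls. (h l / prod_list (map (\<lambda>m. l - m) (remove1 l ls))) *\<^sub>R
     shifted_prod (remove1 l ls) f x)"

lemma linear_shifted_prod: "linear f \<Longrightarrow> linear (shifted_prod ls f)"
proof (induction ls)
  case Nil
  show ?case by (simp add: linear_ident[unfolded id_def])
next
  case (Cons l ls)
  have "linear (\<lambda>x. f x - l *\<^sub>R x)"
    using Cons.prems by (intro linear_compose_sub linear_scale_self) 
  from linear_compose[OF this Cons.IH[OF Cons.prems]] show ?case
    by (simp add: o_def)
qed

lemma shifted_prod_eigen:
  assumes "linear f" "f x = c *\<^sub>R x"
  shows "shifted_prod ls f x = prod_list (map (\<lambda>m. c - m) ls) *\<^sub>R x"
  using assms(2)
proof (induction ls arbitrary: x)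
  case (Cons l ls)
  have "f x - l *\<^sub>R x = (c - l) *\<^sub>R x" using Cons.prems by (simp add: algebra_simps)
  moreover have "f ((c - l) *\<^sub>R x) = c *\<^sub>R (c - l) *\<^sub>R x"
    by (simp only: linear_cmul[OF assms(1)] Cons.prems scaleR_scaleR mult.commute)
  ultimately show ?case using Cons.IH[of "(c - l) *\<^sub>R x"] by (simp add: mult.commute)
qed simp

lemma shifted_prod_intertwine:
  assumes "linear g" "\<And>x. g (f x) = f' (g x)"
  shows "g (shifted_prod ls f x) = shifted_prod ls f' (g x)"
  by (induction ls arbitrary: x) (simp_all add: linear_diff[OF assms(1)] linear_cmul[OF assms(1)] assms(2))

section \<open>Sums of eigenspaces\<close>

lemma subspace_eigs: "subspace (eigs f S)"
  by (simp add: eigs_def)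

lemma eigs_mono: "S \<subseteq> T \<Longrightarrow> eigs f S \<subseteq> eigs f T"
  unfolding eigs_def by (intro span_mono) auto

lemma eigs_base: "f x = c *\<^sub>R x \<Longrightarrow> c \<in> S \<Longrightarrow> x \<in> eigs f S"
  unfolding eigs_def by (intro span_base) auto

lemma eigs_induct [consumes 1, case_names eigen]:
  assumes "x \<in> eigs f S" "\<And>x c. c \<in> S \<Longrightarrow> f x = c *\<^sub>R x \<Longrightarrow> x \<in> T" "subspace T"
  shows "x \<in> T"
proof -
  have "{x. \<exists>c\<in>S. f x = c *\<^sub>R x} \<subseteq> T" using assms(2) by blast
  from span_minimal[OF this assms(3)] assms(1) show ?thesis unfolding eigs_def by (rule subsetD)
qed

lemma eigs_linear_eqI:
  assumes "x \<in> eigs f S" "linear g" "linear g'" "\<And>x c. c \<in> S \<Longrightarrow> f x = c *\<^sub>R x \<Longrightarrow> g x = g' x"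
  shows "g x = g' x"
  by (rule linear_eq_on_span[OF assms(2,3) _ assms(1)[unfolded eigs_def]]) (use assms(4) in blast)

lemma eigs_map:
  assumes "x \<in> eigs f S" "linear g" "\<And>x c. c \<in> S \<Longrightarrow> f x = c *\<^sub>R x \<Longrightarrow> g x \<in> T" "subspace T"
  shows "g x \<in> T"
proof -
  have "x \<in> g -` T"
    using assms(1)
    by (rule eigs_induct) (use assms linear_subspace_vimage in auto)
  then show ?thesis by simp
qed

lemma eigs_Un:
  assumes "x \<in> eigs f (S \<union> T)"
  obtains a b where "a \<in> eigs f S" "b \<in> eigs f T" "x = a + b"
proof -
  have eq: "{x. \<exists>c\<in>S \<union> T. f x = c *\<^sub>R x} = {x. \<exists>c\<in>S. f x = c *\<^sub>R x} \<union> {x. \<exists>c\<in>T. f x = c *\<^sub>R x}"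
    by blast
  show ?thesis using assms that unfolding eigs_def eq span_Un by blast
qed

lemma eigs_singleton:
  assumes "linear f" "x \<in> eigs f {c}" shows "f x = c *\<^sub>R x"
proof -
  have "subspace {x. f x = c *\<^sub>R x}"
    unfolding subspace_def using assms(1) by (auto simp: linear_add linear_cmul linear_0 algebra_simps)
  then show ?thesis using eigs_induct[OF assms(2), of "{x. f x = c *\<^sub>R x}"] by auto
qed

lemma shifted_prod_eigs:
  assumes "linear f" "x \<in> eigs f (set ls)" shows "shifted_prod ls f x = 0"
proof (rule eigs_linear_eqI[OF assms(2) linear_shifted_prod[OF assms(1)] module_hom_zero])
  fix x c assume "c \<in> set ls" "f x = c *\<^sub>R x"
  then show "shifted_prod ls f x = 0"
    using shifted_prod_eigen[OF assms(1), of x c ls] by (auto simp: prod_list_zero_iff)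
qed

text \<open>By distinctness \<open>l\<close> is not in \<open>ls\<close>, so \<open>f - l\<close>
  maps the eigenspaces for \<open>ls\<close> onto themselves. Thus
  \<open>(f - l) x = (f - l) w\<close> for some \<open>w\<close> in their sum, and
  \<open>x - w\<close> is an eigenvector for \<open>l\<close>.\<close>

lemma shifted_prod_kernel:
  assumes f: "linear f" and "distinct ls" "shifted_prod ls f x = 0"
  shows "x \<in> eigs f (set ls)"
  using assms(2,3)
proof (induction ls arbitrary: x)
  case Nil
  then show ?case by (simp add: subspace_0[OF subspace_eigs])
next
  case (Cons l ls)
  define T where "T = {y. \<exists>w\<in>eigs f (set ls). f w - l *\<^sub>R w = y}"
  have "T = (\<lambda>w. f w - l *\<^sub>R w) ` eigs f (set ls)" by (auto simp: T_def)
  moreover have "linear (\<lambda>w. f w - l *\<^sub>R w)"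
    using f by (intro linear_compose_sub linear_scale_self)
  ultimately have subT: "subspace T" by (simp add: linear_subspace_image subspace_eigs)
  have eigT: "y \<in> T" if "c \<in> set ls" "f y = c *\<^sub>R y" for c y
  proof -
    have "c \<noteq> l" using Cons.prems(1) that(1) by auto
    have "f (a *\<^sub>R y) - l *\<^sub>R (a *\<^sub>R y) = (a * (c - l)) *\<^sub>R y" for a
      by (simp add: linear_cmul[OF f] that(2) algebra_simps)
    from this[of "inverse (c - l)"] have "f (y /\<^sub>R (c - l)) - l *\<^sub>R (y /\<^sub>R (c - l)) = y"
      using \<open>c \<noteq> l\<close> by simp
    moreover have "y /\<^sub>R (c - l) \<in> eigs f (set ls)"
      by (rule subspace_scale[OF subspace_eigs eigs_base[of f y c "set ls", OF that(2,1)]])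
    ultimately show ?thesis unfolding T_def by blast
  qed
  have "f x - l *\<^sub>R x \<in> eigs f (set ls)" using Cons by auto
  then have "f x - l *\<^sub>R x \<in> T" by (rule eigs_induct[OF _ eigT subT])
  then obtain w where w: "w \<in> eigs f (set ls)" "f w - l *\<^sub>R w = f x - l *\<^sub>R x"
    unfolding T_def by blast
  have "f (x - w) = l *\<^sub>R (x - w)" using w(2) by (simp add: linear_diff[OF f] algebra_simps)
  then have "x - w \<in> eigs f (set (l # ls))" by (rule eigs_base) simp
  moreover have "w \<in> eigs f (set (l # ls))" using w(1) eigs_mono[of "set ls" "set (l # ls)" f] by auto
  ultimately show ?case using subspace_add[OF subspace_eigs, of "x - w" f "set (l # ls)" w] by simp
qed

lemma linear_fcalc: "linear f \<Longrightarrow> linear (fcalc ls f h)"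
  unfolding fcalc_def by (intro linear_compose_sum ballI linear_compose_scale_right linear_shifted_prod)

section \<open>Functional calculus of a diagonalizable endomorphism\<close>

locale diagonal_map =
  fixes f :: "'a::real_vector \<Rightarrow> 'a" and ls :: "real list"
  assumes linear: "linear f" and distinct: "distinct ls" and diagonal: "diagonal ls f"
begin

lemma eigs_all: "x \<in> eigs f (set ls)"
  using shifted_prod_kernel[OF linear distinct] diagonal by (simp add: diagonal_def)

lemma eigen_not_in: "f x = c *\<^sub>R x \<Longrightarrow> c \<notin> set ls \<Longrightarrow> x = 0"
  using shifted_prod_eigen[OF linear, of x c ls] diagonal
  by (auto simp: diagonal_def prod_list_zero_iff)

text \<open>The Lagrange polynomial of an entry is 1 there and 0 at the other entries. For
  \<open>c\<close> outside the list the claim is true because then \<open>x = 0\<close>; this is why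
  later computations may take any real eigenvalue.\<close>

lemma fcalc_eigen:
  assumes "f x = c *\<^sub>R x" shows "fcalc ls f h x = h c *\<^sub>R x"
proof (cases "c \<in> set ls")
  case True
  let ?p = "\<lambda>l. prod_list (map (\<lambda>m. l - m) (remove1 l ls))"
  have nz: "?p c \<noteq> 0"
    using distinct by (auto simp: prod_list_zero_iff)
  have "(h l / ?p l) *\<^sub>R shifted_prod (remove1 l ls) f x = (if l = c then h c *\<^sub>R x else 0)"
    if "l \<in> set ls" for l
  proof (cases "l = c")
    case False
    then have "prod_list (map (\<lambda>m. c - m) (remove1 l ls)) = 0"
      using True distinct by (auto simp: prod_list_zero_iff)
    then show ?thesis using False shifted_prod_eigen[OF linear assms] by simp
  qed (use nz shifted_prod_eigen[OF linear assms] in simp)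
  then have "fcalc ls f h x = (\<Sum>l\<in>set ls. if l = c then h c *\<^sub>R x else 0)"
    unfolding fcalc_def by (intro sum.cong) auto
  also have "\<dots> = h c *\<^sub>R x" using True by simp
  finally show ?thesis .
next
  case False
  then have "x = 0" using eigen_not_in assms by blast
  then show ?thesis using linear_0[OF linear_fcalc[OF linear]] by simp
qed

text \<open>Reduces every operator identity below to a computation on eigenvectors.\<close>

lemma linear_eqI:
  assumes "linear g" "linear g'" "\<And>x c. f x = c *\<^sub>R x \<Longrightarrow> g x = g' x"
  shows "g x = g' x"
  by (rule eigs_linear_eqI[OF eigs_all assms(1,2)]) (rule assms(3))

lemma fcalc_fcalc: "fcalc ls f h (fcalc ls f h' x) = fcalc ls f (\<lambda>c. h c * h' c) x"
proof (rule linear_eqI[of "\<lambda>x. fcalc ls f h (fcalc ls f h' x)"])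
  show "linear (\<lambda>x. fcalc ls f h (fcalc ls f h' x))"
    using linear_compose[OF linear_fcalc linear_fcalc, OF linear linear] by (simp add: o_def)
  show "fcalc ls f h (fcalc ls f h' x) = fcalc ls f (\<lambda>c. h c * h' c) x" if "f x = c *\<^sub>R x" for x c
    by (simp add: fcalc_eigen[OF that] linear_cmul[OF linear_fcalc[OF linear]] mult.commute)
qed (rule linear_fcalc[OF linear])

lemma fcalc_1: "fcalc ls f (\<lambda>_. 1) x = x"
proof (rule linear_eqI[of _ "\<lambda>x. x"])
  show "fcalc ls f (\<lambda>_. 1) x = x" if "f x = c *\<^sub>R x" for x c
    using fcalc_eigen[OF that, of "\<lambda>_. 1"] by simp
qed (rule linear_fcalc[OF linear], rule linear_ident[unfolded id_def])

lemma fcalc_add: "fcalc ls f h x + fcalc ls f h' x = fcalc ls f (\<lambda>c. h c + h' c) x"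
  unfolding fcalc_def by (simp add: add_divide_distrib scaleR_add_left flip: sum.distrib)

lemma fcalc_ident: "fcalc ls f (\<lambda>c. c) x = f x"
proof (rule linear_eqI[of _ f])
  show "fcalc ls f (\<lambda>c. c) x = f x" if "f x = c *\<^sub>R x" for x c
    using fcalc_eigen[OF that, of "\<lambda>c. c"] that by simp
qed (rule linear_fcalc[OF linear], rule linear)

lemma fcalc_in_eigs:
  assumes "\<And>c. c \<notin> S \<Longrightarrow> h c = 0" shows "fcalc ls f h x \<in> eigs f S"
proof (rule eigs_map[OF eigs_all linear_fcalc[OF linear] _ subspace_eigs])
  fix x c assume x: "f x = c *\<^sub>R x"
  show "fcalc ls f h x \<in> eigs f S"
    using x assms[of c] eigs_base[of f x c S, OF x] subspace_scale[OF subspace_eigs] subspace_0[OF subspace_eigs]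
    by (cases "c \<in> S") (auto simp: fcalc_eigen[OF x])
qed

lemma fcalc_cong_eigs:
  assumes "x \<in> eigs f S" "\<And>c. c \<in> S \<Longrightarrow> h c = h' c"
  shows "fcalc ls f h x = fcalc ls f h' x"
proof (rule eigs_linear_eqI[OF assms(1)])
  show "fcalc ls f h x = fcalc ls f h' x" if "c \<in> S" "f x = c *\<^sub>R x" for x c
    by (simp add: fcalc_eigen[OF that(2)] assms(2)[OF that(1)])
qed (rule linear_fcalc[OF linear])+

lemma fcalc_eigs_0:
  assumes "x \<in> eigs f S" "\<And>c. c \<in> S \<Longrightarrow> h c = 0"
  shows "fcalc ls f h x = 0"
proof -
  have "fcalc ls f h x = fcalc ls f (\<lambda>_. 0) x" by (rule fcalc_cong_eigs[OF assms])
  then show ?thesis by (simp add: fcalc_def)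
qed

lemma fcalc_eigs_1:
  assumes "x \<in> eigs f S" "\<And>c. c \<in> S \<Longrightarrow> h c = 1"
  shows "fcalc ls f h x = x"
proof -
  have "fcalc ls f h x = fcalc ls f (\<lambda>_. 1) x" by (rule fcalc_cong_eigs[OF assms])
  then show ?thesis by (simp only: fcalc_1)
qed

lemma eigs_Int: "x \<in> eigs f S \<Longrightarrow> x \<in> eigs f (S \<inter> set ls)"
proof (erule eigs_induct[OF _ _ subspace_eigs])
  show "x \<in> eigs f (S \<inter> set ls)" if "c \<in> S" "f x = c *\<^sub>R x" for x c
  proof (cases "c \<in> set ls")
    case True
    show ?thesis by (rule eigs_base[of f x c, OF that(2)]) (use True that in simp)
  next
    case False
    then have "x = 0" by (rule eigen_not_in[OF that(2)])
    then show ?thesis by (simp add: subspace_0[OF subspace_eigs])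
  qed
qed

lemma eigs_disjoint: "x \<in> eigs f S \<Longrightarrow> x \<in> eigs f T \<Longrightarrow> S \<inter> T = {} \<Longrightarrow> x = 0"
  using fcalc_eigs_0[of x S "indicator T"] fcalc_eigs_1[of x T "indicator T"]
  by (auto simp: indicator_def disjoint_iff)

text \<open>The least eigenvalue that occurs in \<open>x\<close>. Operators that raise eigenvalues
  cannot reach this component, so it can be followed through perturbed polynomials.\<close>

lemma lowest_component:
  assumes "x \<noteq> 0" "x \<in> eigs f S"
  obtains c where "c \<in> S" "c \<in> set ls" "fcalc ls f (indicator {c}) x \<noteq> 0" "x \<in> eigs f {c..}"
proof -
  let ?E = "\<lambda>c. fcalc ls f (indicator {c}) x"
  define D where "D = {c \<in> set ls. ?E c \<noteq> 0}"
  have finD: "finite D" by (simp add: D_def)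
  have sum: "(\<Sum>c\<in>set ls. ?E c) = x"
  proof (rule linear_eqI[of "\<lambda>x. \<Sum>c\<in>set ls. fcalc ls f (indicator {c}) x" "\<lambda>x. x"])
    show "linear (\<lambda>x. \<Sum>c\<in>set ls. fcalc ls f (indicator {c}) x)"
      by (intro linear_compose_sum ballI linear_fcalc linear)
    show "(\<Sum>c\<in>set ls. fcalc ls f (indicator {c}) x) = x" if "f x = d *\<^sub>R x" for x d
    proof (cases "d \<in> set ls")
      case True
      have "(\<Sum>c\<in>set ls. fcalc ls f (indicator {c}) x) = (\<Sum>c\<in>set ls. if c = d then x else 0)"
        by (intro sum.cong) (auto simp: fcalc_eigen[OF that])
      then show ?thesis using True by simp
    next
      case False
      then show ?thesis using eigen_not_in[OF that] linear_0[OF linear_fcalc[OF linear]] by simp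
    qed
  qed (simp add: linear_ident[unfolded id_def])
  have "D \<noteq> {}"
  proof
    assume "D = {}"
    then have "(\<Sum>c\<in>set ls. ?E c) = 0" by (intro sum.neutral) (auto simp: D_def)
    then show False using sum assms(1) by simp
  qed
  then have m: "Min D \<in> D" using finD by simp
  have "Min D \<in> S"
  proof (rule ccontr)
    assume "Min D \<notin> S"
    then have "?E (Min D) = 0" by (intro fcalc_eigs_0[OF assms(2)]) (auto simp: indicator_def)
    then show False using m by (simp add: D_def)
  qed
  moreover have "x \<in> eigs f {Min D..}"
  proof -
    have "?E c \<in> eigs f {Min D..}" if "c \<in> set ls" for c
    proof (cases "?E c = 0")
      case False
      then have "Min D \<le> c" using that finD by (intro Min_le) (auto simp: D_def)
      then show ?thesis by (intro fcalc_in_eigs) (auto simp: indicator_def)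
    qed (simp add: subspace_0[OF subspace_eigs])
    then have "(\<Sum>c\<in>set ls. ?E c) \<in> eigs f {Min D..}" by (rule subspace_sum[OF subspace_eigs])
    then show ?thesis by (simp add: sum)
  qed
  ultimately show ?thesis using that m by (auto simp: D_def)
qed

end

section \<open>Simultaneous diagonalization of symmetric endomorphisms\<close>

locale positive_form =
  fixes Q :: "'a::euclidean_space \<Rightarrow> 'a \<Rightarrow> real"
  assumes bilinear: "bilinear Q" and sym: "Q x y = Q y x" and pos: "x \<noteq> 0 \<Longrightarrow> Q x x > 0"
begin

lemmas Q_simps = bilinear_ladd[OF bilinear] bilinear_radd[OF bilinear] bilinear_lmul[OF bilinear]
  bilinear_rmul[OF bilinear] bilinear_lsub[OF bilinear] bilinear_rsub[OF bilinear]
  bilinear_lzero[OF bilinear] bilinear_rzero[OF bilinear] bilinear_lneg[OF bilinear]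
  bilinear_rneg[OF bilinear]

lemma Q_eq_0 [simp]: "Q x x = 0 \<longleftrightarrow> x = 0"
  using pos[of x] by (cases "x = 0") (auto simp: Q_simps)

lemma continuous_on_Q:
  assumes "continuous_on S f" "continuous_on S g" shows "continuous_on S (\<lambda>x. Q (f x) (g x))"
  using bilinear bilinear_conv_bounded_bilinear bounded_bilinear.continuous_on assms by blast

text \<open>The Rayleigh quotient attains its maximum \<open>m\<close> on \<open>W\<close>, taken
  over the Euclidean unit sphere since the quotient is homogeneous of degree 0. Then
  \<open>q = m Q - Q (f _) _\<close> is positive semidefinite on \<open>W\<close> and vanishes at
  \<open>(x, x)\<close>, hence \<open>q x\<close> vanishes on \<open>W\<close>.\<close>

lemma symmetric_has_eigenvector:
  assumes W: "subspace W" "W \<noteq> {0}" and f: "linear f" "f ` W \<subseteq> W"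
    and s: "\<And>x y. Q (f x) y = Q x (f y)"
  obtains x m where "x \<in> W" "x \<noteq> 0" "f x = m *\<^sub>R x"
proof -
  obtain w where w: "w \<in> W" "w \<noteq> 0" using W subspace_0 by blast
  let ?S = "W \<inter> sphere 0 1"
  have "compact ?S" using closed_subspace[OF W(1)] by (simp add: closed_Int_compact)
  moreover have "w /\<^sub>R norm w \<in> ?S" using w subspace_scale[OF W(1)] by simp
  then have "?S \<noteq> {}" by blast
  moreover have "continuous_on ?S (\<lambda>x. Q (f x) x / Q x x)"
    using f(1) by (intro continuous_on_divide continuous_on_Q continuous_on_id linear_continuous_on)
      (auto simp: linear_linear)
  ultimately obtain x where x: "x \<in> ?S" and max: "\<And>y. y \<in> ?S \<Longrightarrow> Q (f y) y / Q y y \<le> Q (f x) x / Q x x"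
    using continuous_attains_sup[of ?S "\<lambda>x. Q (f x) x / Q x x"] by blast
  define m where "m = Q (f x) x / Q x x"
  have x0: "x \<in> W" "x \<noteq> 0" using x by auto
  have le: "Q (f y) y \<le> m * Q y y" if "y \<in> W" for y
  proof (cases "y = 0")
    case False
    have "y /\<^sub>R norm y \<in> ?S" using that False subspace_scale[OF W(1)] by simp
    from max[OF this] have "Q (f y) y / Q y y \<le> m"
      using False by (simp add: m_def linear_cmul[OF f(1)] Q_simps)
    then show ?thesis using pos[OF False] by (simp add: field_simps)
  qed (simp add: Q_simps)
  define q where "q u v = m * Q u v - Q (f u) v" for u v
  have qxx: "q x x = 0" using x0(2) by (simp add: q_def m_def)
  have qsym: "q u v = q v u" for u v using sym[of u v] sym[of "f v" u] s[of u v] by (simp add: q_def)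
  have "q x y = 0" if y: "y \<in> W" for y
  proof -
    have "2 * t * q x y + t^2 * q y y \<ge> 0" for t
    proof -
      have "x + t *\<^sub>R y \<in> W" using x0 y W(1) by (simp add: subspace_add subspace_scale)
      from le[OF this] have "q (x + t *\<^sub>R y) (x + t *\<^sub>R y) \<ge> 0" by (simp add: q_def)
      moreover have "q (x + t *\<^sub>R y) (x + t *\<^sub>R y) = q x x + t * q x y + t * q y x + t^2 * q y y"
        by (simp add: q_def Q_simps linear_add[OF f(1)] linear_cmul[OF f(1)] algebra_simps power2_eq_square)
      ultimately show ?thesis using qxx qsym[of y x] by simp
    qed
    note nonneg = this
    show ?thesis
    proof (rule ccontr)
      assume ne: "q x y \<noteq> 0"
      have qyy: "q y y \<ge> 0" using le[OF y] by (simp add: q_def)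
      \<comment> \<open>Approximately the minimizer of the quadratic polynomial in \<open>t\<close>;
        adding 1 keeps the denominator positive even if \<open>q y y = 0\<close>.\<close>
      define t where "t = - q x y / (q y y + 1)"
      have eq: "2 * t * q x y + t^2 * q y y = - ((q x y)\<^sup>2 * (q y y + 2) / (q y y + 1)\<^sup>2)"
        using qyy unfolding t_def by (simp add: divide_simps power2_eq_square) (simp add: algebra_simps)
      have "(q x y)\<^sup>2 * (q y y + 2) / (q y y + 1)\<^sup>2 > 0"
        using qyy ne by (intro divide_pos_pos mult_pos_pos) auto
      then show False using nonneg[of t] eq by linarith
    qed
  qed
  moreover have "m *\<^sub>R x - f x \<in> W" using x0 f(2) W(1) by (auto intro!: subspace_diff subspace_scale)
  ultimately have "q x (m *\<^sub>R x - f x) = 0" by blast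
  then have "Q (m *\<^sub>R x - f x) (m *\<^sub>R x - f x) = 0"
    by (simp add: q_def Q_simps algebra_simps)
  then have "f x = m *\<^sub>R x" by simp
  then show ?thesis using that x0 by blast
qed

text \<open>If some member of \<open>F\<close> is not scalar on \<open>W\<close>, one of its
  eigenspaces in \<open>W\<close> is nonzero, of smaller dimension, and invariant under
  \<open>F\<close> by commutativity.\<close>

lemma commuting_symmetric_joint_eigenvector:
  assumes "subspace W" "W \<noteq> {0}"
    and "\<And>f. f \<in> F \<Longrightarrow> linear f" "\<And>f. f \<in> F \<Longrightarrow> f ` W \<subseteq> W"
    and "\<And>f x y. f \<in> F \<Longrightarrow> Q (f x) y = Q x (f y)"
    and "\<And>f g x. f \<in> F \<Longrightarrow> g \<in> F \<Longrightarrow> f (g x) = g (f x)"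
  shows "\<exists>x\<in>W. x \<noteq> 0 \<and> (\<forall>f\<in>F. \<exists>m. f x = m *\<^sub>R x)"
  using assms
proof (induction "dim W" arbitrary: W rule: less_induct)
  case less
  show ?case
  proof (cases "\<forall>f\<in>F. \<exists>m. \<forall>x\<in>W. f x = m *\<^sub>R x")
    case True
    then show ?thesis using less.prems(1,2) subspace_0 by blast
  next
    case False
    then obtain f where f: "f \<in> F" "\<And>m. \<exists>x\<in>W. f x \<noteq> m *\<^sub>R x" by blast
    obtain x m where x: "x \<in> W" "x \<noteq> 0" "f x = m *\<^sub>R x"
      using symmetric_has_eigenvector[OF less.prems(1,2) less.prems(3)[OF f(1)] less.prems(4)[OF f(1)]]
        less.prems(5)[OF f(1)] by metis
    define W' where "W' = {x \<in> W. f x = m *\<^sub>R x}"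
    have sub: "subspace W'"
      unfolding W'_def subspace_def using less.prems(1) less.prems(3)[OF f(1)]
      by (auto simp: subspace_0 subspace_add subspace_scale linear_0 linear_add linear_cmul algebra_simps)
    have "W' \<subset> W" using f(2)[of m] by (auto simp: W'_def)
    then have d: "dim W' < dim W" using sub less.prems(1) by (simp add: dim_psubset span_eq_iff[THEN iffD2])
    have ne: "W' \<noteq> {0}" using x by (auto simp: W'_def)
    have inv: "g ` W' \<subseteq> W'" if "g \<in> F" for g
    proof
      fix y assume "y \<in> g ` W'"
      then obtain z where z: "y = g z" "z \<in> W" "f z = m *\<^sub>R z" by (auto simp: W'_def)
      have "f y = m *\<^sub>R y"
        using less.prems(6)[OF f(1) that, of z] z linear_cmul[OF less.prems(3)[OF that]] by simp
      then show "y \<in> W'" using z less.prems(4)[OF that] by (auto simp: W'_def)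
    qed
    have "\<exists>x\<in>W'. x \<noteq> 0 \<and> (\<forall>f\<in>F. \<exists>m. f x = m *\<^sub>R x)"
      by (rule less.hyps[of W', OF d sub ne]; rule less.prems(3) inv less.prems(5) less.prems(6); assumption)
    then show ?thesis by (auto simp: W'_def)
  qed
qed

text \<open>Splits off a joint eigenvector; its \<open>Q\<close>-orthogonal complement in
  \<open>W\<close> is invariant by symmetry. A singleton \<open>F\<close> diagonalizes a single
  \<open>ad p\<close>, the family \<open>ad A\<close> recovers the root spaces.\<close>

lemma commuting_symmetric_span:
  assumes "subspace W"
    and "\<And>f. f \<in> F \<Longrightarrow> linear f" "\<And>f. f \<in> F \<Longrightarrow> f ` W \<subseteq> W"
    and "\<And>f x y. f \<in> F \<Longrightarrow> Q (f x) y = Q x (f y)"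
    and "\<And>f g x. f \<in> F \<Longrightarrow> g \<in> F \<Longrightarrow> f (g x) = g (f x)"
  shows "W \<subseteq> span {x \<in> W. \<forall>f\<in>F. \<exists>m. f x = m *\<^sub>R x}"
  using assms
proof (induction "dim W" arbitrary: W rule: less_induct)
  case less
  show ?case
  proof (cases "W = {0}")
    case True
    then show ?thesis by (simp add: span_0)
  next
    case False
    then obtain x where x: "x \<in> W" "x \<noteq> 0" "\<forall>f\<in>F. \<exists>m. f x = m *\<^sub>R x"
      using commuting_symmetric_joint_eigenvector[of W F] less.prems by blast
    define W' where "W' = {y \<in> W. Q x y = 0}"
    have sub: "subspace W'"
      unfolding W'_def subspace_def using less.prems(1)
      by (auto simp: subspace_0 subspace_add subspace_scale Q_simps)
    have "x \<notin> W'" using x(2) by (simp add: W'_def)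
    moreover have "W' \<subseteq> W" by (auto simp: W'_def)
    ultimately have "W' \<subset> W" using x(1) by blast
    then have d: "dim W' < dim W" using sub less.prems(1) by (simp add: dim_psubset span_eq_iff[THEN iffD2])
    have inv: "g ` W' \<subseteq> W'" if g: "g \<in> F" for g
    proof
      fix y assume "y \<in> g ` W'"
      then obtain z where z: "y = g z" "z \<in> W" "Q x z = 0" by (auto simp: W'_def)
      obtain m where "g x = m *\<^sub>R x" using x(3) g by blast
      then have "Q x y = 0" using z less.prems(4)[OF g, of x z] by (simp add: Q_simps)
      then show "y \<in> W'" using z less.prems(3)[OF g] by (auto simp: W'_def)
    qed
    have IH: "W' \<subseteq> span {x \<in> W'. \<forall>f\<in>F. \<exists>m. f x = m *\<^sub>R x}"
      by (rule less.hyps[of W', OF d sub]; rule less.prems(2) inv less.prems(4) less.prems(5); assumption)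
    have mono: "span {x \<in> W'. \<forall>f\<in>F. \<exists>m. f x = m *\<^sub>R x} \<subseteq> span {x \<in> W. \<forall>f\<in>F. \<exists>m. f x = m *\<^sub>R x}"
      by (rule span_mono) (auto simp: W'_def)
    show ?thesis
    proof
      fix y assume y: "y \<in> W"
      define c where "c = Q x y / Q x x"
      have "Q x (y - c *\<^sub>R x) = 0" using pos[OF x(2)] by (simp add: Q_simps c_def)
      then have "y - c *\<^sub>R x \<in> W'" using y x(1) less.prems(1) by (simp add: W'_def subspace_diff subspace_scale)
      then have 1: "y - c *\<^sub>R x \<in> span {x \<in> W. \<forall>f\<in>F. \<exists>m. f x = m *\<^sub>R x}" using IH mono by blast
      have 2: "c *\<^sub>R x \<in> span {x \<in> W. \<forall>f\<in>F. \<exists>m. f x = m *\<^sub>R x}"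
        using x by (intro span_scale span_base) auto
      show "y \<in> span {x \<in> W. \<forall>f\<in>F. \<exists>m. f x = m *\<^sub>R x}" using span_add[OF 1 2] by simp
    qed
  qed
qed

end

section \<open>The inner product of a Cartan involution\<close>

lemma linear_trace_commute:
  fixes f g :: "'a::euclidean_space \<Rightarrow> 'a"
  assumes "linear f" "linear g"
  shows "linear_trace (\<lambda>x. f (g x)) = linear_trace (\<lambda>x. g (f x))"
proof -
  have e: "linear_trace (\<lambda>x. f (g x)) = (\<Sum>b\<in>Basis. \<Sum>c\<in>Basis. (g b \<bullet> c) * (f c \<bullet> b))"
    if "linear f" for f g :: "'a \<Rightarrow> 'a"
    unfolding linear_trace_def by (subst linear_expand[OF that]) (simp add: inner_sum_left)
  show ?thesis
    unfolding e[OF assms(1), of g] e[OF assms(2), of f]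
    by (subst sum.swap) (simp only: mult.commute)
qed

lemma linear_trace_add: "linear_trace (\<lambda>x. f x + g x) = linear_trace f + linear_trace g"
  by (simp add: linear_trace_def inner_add_left sum.distrib)

lemma linear_trace_diff: "linear_trace (\<lambda>x. f x - g x) = linear_trace f - linear_trace g"
  by (simp add: linear_trace_def inner_diff_left sum_subtractf)

lemma linear_trace_scaleR: "linear_trace (\<lambda>x. c *\<^sub>R f x) = c * linear_trace f"
  by (simp add: linear_trace_def sum_distrib_left)

locale cartan =
  fixes br :: "'a::euclidean_space \<Rightarrow> 'a \<Rightarrow> 'a" and \<theta> :: "'a \<Rightarrow> 'a"
  assumes lie: "lie_algebra br" and cartan: "cartan_involution br \<theta>"
begin

lemma bilinear_br: "bilinear br" using lie by (simp add: lie_algebra_def)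

lemmas br_simps = bilinear_ladd[OF bilinear_br] bilinear_radd[OF bilinear_br] bilinear_lmul[OF bilinear_br]
  bilinear_rmul[OF bilinear_br] bilinear_lsub[OF bilinear_br] bilinear_rsub[OF bilinear_br]
  bilinear_lzero[OF bilinear_br] bilinear_rzero[OF bilinear_br] bilinear_lneg[OF bilinear_br]
  bilinear_rneg[OF bilinear_br]

lemma linear_br: "linear (br x)"
  using bilinear_br by (simp add: bilinear_def)

lemma linear_br_left: "linear (\<lambda>x. br x y)"
  using bilinear_br by (simp add: bilinear_def)

lemma br_self [simp]: "br x x = 0" using lie by (simp add: lie_algebra_def)

lemma br_anti: "br x y = - br y x"
proof -
  have "br x y + br y x = 0" using br_self[of "x + y"] unfolding br_simps(1,2) by (simp add: algebra_simps)
  then show ?thesis by (simp add: eq_neg_iff_add_eq_0)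
qed

lemma br_derivation: "br x (br y z) = br (br x y) z + br y (br x z)"
proof -
  have "br x (br y z) + br y (br z x) + br z (br x y) = 0" using lie by (simp add: lie_algebra_def)
  moreover have "br y (br z x) = - br y (br x z)" using br_anti[of z x] by (simp add: br_simps)
  moreover have "br z (br x y) = - br (br x y) z" by (rule br_anti)
  ultimately show ?thesis by (simp add: algebra_simps)
qed

lemma linear_theta: "linear \<theta>" and theta_theta [simp]: "\<theta> (\<theta> x) = x"
  and theta_br: "\<theta> (br x y) = br (\<theta> x) (\<theta> y)"
  using cartan by (auto simp: cartan_involution_def)

lemmas theta_simps = linear_add[OF linear_theta] linear_diff[OF linear_theta]
  linear_cmul[OF linear_theta] linear_neg[OF linear_theta] linear_0[OF linear_theta]

lemma linear_br_br: "linear (\<lambda>z. br x (br y z))"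
  using linear_compose[OF linear_br linear_br] by (simp add: o_def)

lemma bilinear_killing: "bilinear (killing br)"
  unfolding bilinear_def killing_def
  by (auto intro!: linearI simp: br_simps linear_trace_add linear_trace_scaleR)

lemma killing_sym: "killing br x y = killing br y x"
  unfolding killing_def by (rule linear_trace_commute[OF linear_br linear_br])

lemma killing_invariant: "killing br (br x y) z = killing br x (br y z)"
proof -
  have ad: "br (br u v) w = br u (br v w) - br v (br u w)" for u v w
    using br_derivation[of u v w] by simp
  have "killing br (br x y) z = linear_trace (\<lambda>w. br x (br y (br z w))) - linear_trace (\<lambda>w. br y (br x (br z w)))"
    unfolding killing_def by (simp add: ad linear_trace_diff)
  also have "linear_trace (\<lambda>w. br y (br x (br z w))) = linear_trace (\<lambda>w. br x (br z (br y w)))"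
    by (rule linear_trace_commute[OF linear_br linear_br_br])
  finally show ?thesis unfolding killing_def by (simp add: ad br_simps linear_trace_diff)
qed

lemma killing_theta: "killing br (\<theta> x) (\<theta> y) = killing br x y"
proof -
  have "killing br (\<theta> x) (\<theta> y) = linear_trace (\<lambda>z. \<theta> (br x (br y (\<theta> z))))"
    by (simp add: killing_def theta_br)
  also have "\<dots> = linear_trace (\<lambda>z. br x (br y (\<theta> (\<theta> z))))"
    using linear_compose[OF linear_theta linear_br_br[of x y]]
    by (intro linear_trace_commute[OF linear_theta]) (simp add: o_def)
  finally show ?thesis by (simp add: killing_def)
qed

text \<open>The usual inner product attached to a Cartan involution: \<open>ad\<close> of
  \<open>cartan_s \<theta>\<close> is symmetric and \<open>ad\<close> of
  \<open>cartan_k \<theta>\<close> is skew for it.\<close>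

definition Q :: "'a \<Rightarrow> 'a \<Rightarrow> real" where "Q x y = - killing br x (\<theta> y)"

sublocale positive_form Q
proof
  show "bilinear Q"
    unfolding bilinear_def Q_def
    by (auto intro!: linearI simp: theta_simps bilinear_ladd[OF bilinear_killing]
        bilinear_radd[OF bilinear_killing] bilinear_lmul[OF bilinear_killing] bilinear_rmul[OF bilinear_killing])
  show "Q x y = Q y x" for x y
    using killing_theta[of x "\<theta> y"] killing_sym[of "\<theta> x" y] by (simp add: Q_def)
  show "x \<noteq> 0 \<Longrightarrow> Q x x > 0" for x
    using cartan by (simp add: Q_def cartan_involution_def)
qed

lemma Q_br: "Q (br u x) y = - Q x (br (\<theta> u) y)"
proof -
  have "killing br (br u x) (\<theta> y) = - killing br (br x u) (\<theta> y)"
    by (subst br_anti) (simp add: bilinear_lneg[OF bilinear_killing])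
  then show ?thesis by (simp add: Q_def killing_invariant theta_br)
qed

text \<open>The Killing form vanishes on \<open>c\<close>, and \<open>Q\<close> is definite. This
  turns an equality of operators \<open>ad\<close> into one of elements.\<close>

lemma center_trivial: "(\<And>x. br c x = 0) \<Longrightarrow> c = 0"
proof -
  assume "\<And>x. br c x = 0"
  then have "Q c c = 0" by (simp add: Q_def killing_def linear_trace_def)
  then show "c = 0" by simp
qed

lemma subspace_k: "subspace (cartan_k \<theta>)" and subspace_s: "subspace (cartan_s \<theta>)"
  by (auto simp: subspace_def cartan_k_def cartan_s_def theta_simps)

lemma Q_br_s: "p \<in> cartan_s \<theta> \<Longrightarrow> Q (br p x) y = Q x (br p y)"
  by (simp add: Q_br cartan_s_def br_simps Q_simps)

lemma eigs_br_UNIV: "p \<in> cartan_s \<theta> \<Longrightarrow> x \<in> eigs (br p) UNIV"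
  using commuting_symmetric_span[of UNIV "{br p}"]
  by (auto simp: eigs_def linear_br Q_br_s)

lemma eigs_br:
  assumes "x \<in> eigs (br p) S" "y \<in> eigs (br p) T" "\<And>s t. s \<in> S \<Longrightarrow> t \<in> T \<Longrightarrow> s + t \<in> R"
  shows "br x y \<in> eigs (br p) R"
proof (rule eigs_map[OF assms(1) linear_br_left _ subspace_eigs])
  fix x s assume s: "s \<in> S" "br p x = s *\<^sub>R x"
  show "br x y \<in> eigs (br p) R"
  proof (rule eigs_map[OF assms(2) linear_br _ subspace_eigs])
    fix y t assume t: "t \<in> T" "br p y = t *\<^sub>R y"
    have "br p (br x y) = (s + t) *\<^sub>R br x y"
      by (subst br_derivation) (simp add: s t br_simps scaleR_add_left)
    then show "br x y \<in> eigs (br p) R" by (rule eigs_base) (use assms(3) s t in blast)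
  qed
qed

lemma br_theta_s: "p \<in> cartan_s \<theta> \<Longrightarrow> br p (\<theta> x) = - \<theta> (br p x)"
  by (simp add: theta_br cartan_s_def br_simps)

lemma eigs_theta:
  assumes "p \<in> cartan_s \<theta>" "x \<in> eigs (br p) S" "\<And>s. s \<in> S \<Longrightarrow> - s \<in> R"
  shows "\<theta> x \<in> eigs (br p) R"
proof (rule eigs_map[OF assms(2) linear_theta _ subspace_eigs])
  fix x c assume "c \<in> S" "br p x = c *\<^sub>R x"
  then show "\<theta> x \<in> eigs (br p) R"
    using assms(1,3) eigs_base[of "br p" "\<theta> x" "- c" R] by (simp add: br_theta_s theta_simps)
qed

lemma Q_eigs:
  assumes p: "p \<in> cartan_s \<theta>" and "x \<in> eigs (br p) S" "y \<in> eigs (br p) T" "S \<inter> T = {}"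
  shows "Q x y = 0"
proof -
  have sub: "subspace {x. Q x y = 0}" "subspace {y. Q x y = 0}" for x y
    by (auto simp: subspace_def Q_simps)
  have "x \<in> {x. Q x y = 0}"
  proof (rule eigs_induct[OF assms(2) _ sub(1)])
    fix x c assume c: "c \<in> S" "br p x = c *\<^sub>R x"
    have "y \<in> {y. Q x y = 0}"
    proof (rule eigs_induct[OF assms(3) _ sub(2)])
      fix y d assume d: "d \<in> T" "br p y = d *\<^sub>R y"
      have "c * Q x y = d * Q x y" using Q_br_s[OF p, of x y] c d by (simp add: Q_simps)
      then show "y \<in> {y. Q x y = 0}" using c(1) d(1) assms(4) by auto
    qed
    then show "x \<in> {x. Q x y = 0}" by simp
  qed
  then show ?thesis by simp
qed

text \<open>A maximal independent set of eigenvectors spans and is finite; the list consists of its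
  eigenvalues, in increasing order for the sake of the filtration.\<close>

lemma ex_diagonal:
  assumes p: "p \<in> cartan_s \<theta>"
  obtains ls where "sorted_wrt (<) ls" "diagonal ls (br p)"
proof -
  obtain B where B: "B \<subseteq> {x. \<exists>c\<in>UNIV. br p x = c *\<^sub>R x}" "independent B"
    "{x. \<exists>c\<in>UNIV. br p x = c *\<^sub>R x} \<subseteq> span B"
    using maximal_independent_subset by blast
  have "finite B" using B(2) independent_imp_finite by blast
  have "\<forall>x\<in>B. \<exists>c. br p x = c *\<^sub>R x" using B(1) by auto
  from bchoice[OF this] obtain c where c: "\<And>x. x \<in> B \<Longrightarrow> br p x = c x *\<^sub>R x" by blast
  define ls where "ls = sorted_list_of_set (c ` B)"
  have set: "set ls = c ` B" using \<open>finite B\<close> by (simp add: ls_def)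
  have "B \<subseteq> eigs (br p) (set ls)"
  proof
    fix x assume "x \<in> B"
    then show "x \<in> eigs (br p) (set ls)" using eigs_base[of "br p" x "c x", OF c] set by blast
  qed
  then have "span B \<subseteq> eigs (br p) (set ls)" using span_minimal subspace_eigs by blast
  moreover have "x \<in> span B" for x
    using eigs_br_UNIV[OF p, of x] span_minimal[OF B(3) subspace_span] unfolding eigs_def by (rule rev_subsetD)
  ultimately have "diagonal ls (br p)"
    unfolding diagonal_def using shifted_prod_eigs[OF linear_br] by blast
  then show ?thesis using that[of ls] by (simp add: ls_def)
qed

end

section \<open>Groups of automorphisms\<close>

text \<open>The rule \<open>inverse\<close> presupposes a two-sided inverse; that one exists is
  proved first, by induction over the generation of \<open>g\<close>.\<close>

lemma analytic_subgroup_inverse: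
  assumes "g \<in> analytic_subgroup br S"
  obtains h where "h \<in> analytic_subgroup br S" "g o\<^sub>L h = id_blinfun" "h o\<^sub>L g = id_blinfun"
proof -
  have "\<exists>h. g o\<^sub>L h = id_blinfun \<and> h o\<^sub>L g = id_blinfun"
    using assms
  proof induction
    case (exp X)
    then show ?case using blinfun_exp_minus by blast
  next
    case id
    then show ?case by (intro exI[of _ id_blinfun]) (auto intro: blinfun_eqI)
  next
    case (comp g h)
    then obtain g' h' where gh: "g o\<^sub>L g' = id_blinfun" "g' o\<^sub>L g = id_blinfun"
      "h o\<^sub>L h' = id_blinfun" "h' o\<^sub>L h = id_blinfun" by blast
    have ap: "g (g' x) = x" "g' (g x) = x" "h (h' x) = x" "h' (h x) = x" for x
      using gh by (metis blinfun_apply_blinfun_compose blinfun_apply_id_blinfun)+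
    show ?case by (intro exI[of _ "h' o\<^sub>L g'"] conjI blinfun_eqI) (simp_all add: ap)
  next
    case (inverse g h)
    then show ?case by blast
  qed
  then show ?thesis using that analytic_subgroup.inverse[OF assms] by blast
qed

lemma lie_Aut_inverse:
  assumes "g \<in> lie_Aut br"
  obtains h where "h \<in> lie_Aut br" "\<And>x. g (h x) = x" "\<And>x. h (g x) = x"
proof -
  have bij: "bij (blinfun_apply g)" and hom: "\<And>x y. g (br x y) = br (g x) (g y)"
    using assms by (auto simp: lie_Aut_def)
  define h where "h = Blinfun (inv (blinfun_apply g))"
  have "bounded_linear (inv (blinfun_apply g))"
    by (rule inj_linear_imp_inv_bounded_linear[OF blinfun.bounded_linear_right bij_is_inj[OF bij]])
  then have h: "blinfun_apply h = inv (blinfun_apply g)"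
    by (simp add: h_def bounded_linear_Blinfun_apply)
  have gh: "g (h x) = x" "h (g x) = x" for x
    using bij by (simp_all add: h bij_is_inj bij_is_surj surj_f_inv_f)
  have "h (br x y) = br (h x) (h y)" for x y
    using gh hom by metis
  moreover have "bij (blinfun_apply h)" using bij by (simp add: h bij_imp_bij_inv)
  ultimately show ?thesis using that[of h] gh by (simp add: lie_Aut_def)
qed

lemma lie_Aut_compose: "g \<in> lie_Aut br \<Longrightarrow> h \<in> lie_Aut br \<Longrightarrow> g o\<^sub>L h \<in> lie_Aut br"
proof -
  assume gh: "g \<in> lie_Aut br" "h \<in> lie_Aut br"
  have "blinfun_apply (g o\<^sub>L h) = g \<circ> h" by (auto simp: fun_eq_iff)
  then show ?thesis using gh unfolding lie_Aut_def by (auto simp: bij_comp)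
qed

lemma id_lie_Aut: "id_blinfun \<in> lie_Aut br"
  by (simp add: lie_Aut_def bij_id[unfolded id_def] cong: arg_cong[where f=bij])

lemma lie_Aut0_subset: "lie_Aut0 br \<subseteq> lie_Aut br"
  unfolding lie_Aut0_def by (rule connected_component_subset)

lemma id_lie_Aut0: "id_blinfun \<in> lie_Aut0 br"
  unfolding lie_Aut0_def by (simp add: connected_component_refl id_lie_Aut)

lemma connected_lie_Aut0: "connected (lie_Aut0 br)"
  unfolding lie_Aut0_def by (rule connected_connected_component)

text \<open>Moves the base point of the component, so that connected sets such as translates of
  \<open>lie_Aut0 br\<close> can be tested at any convenient element.\<close>

lemma lie_Aut0_maximal:
  assumes "connected C" "C \<subseteq> lie_Aut br" "g \<in> C" "g \<in> lie_Aut0 br"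
  shows "C \<subseteq> lie_Aut0 br"
proof -
  have "lie_Aut0 br = connected_component_set (lie_Aut br) g"
    using assms(4) unfolding lie_Aut0_def by (metis connected_component_eq)
  then show ?thesis using connected_component_maximal assms by metis
qed

lemma continuous_on_blinfun_compose_left: "continuous_on S (\<lambda>h. g o\<^sub>L h)"
  using bounded_bilinear.continuous_on[OF bounded_bilinear_blinfun_compose continuous_on_const continuous_on_id] .

lemma lie_Aut0_compose:
  assumes "g \<in> lie_Aut0 br" "h \<in> lie_Aut0 br" shows "g o\<^sub>L h \<in> lie_Aut0 br"
proof -
  have "(\<lambda>h. g o\<^sub>L h) ` lie_Aut0 br \<subseteq> lie_Aut0 br"
  proof (rule lie_Aut0_maximal[where g=g])
    show "connected ((\<lambda>h. g o\<^sub>L h) ` lie_Aut0 br)"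
      by (rule connected_continuous_image[OF continuous_on_blinfun_compose_left connected_lie_Aut0])
    show "(\<lambda>h. g o\<^sub>L h) ` lie_Aut0 br \<subseteq> lie_Aut br"
      using assms(1) lie_Aut0_subset lie_Aut_compose by blast
    have "g = g o\<^sub>L id_blinfun" by (auto intro: blinfun_eqI)
    then show "g \<in> (\<lambda>h. g o\<^sub>L h) ` lie_Aut0 br" using id_lie_Aut0 by blast
  qed (rule assms(1))
  then show ?thesis using assms(2) by blast
qed

lemma lie_Aut0_inverse:
  assumes "g \<in> lie_Aut0 br" "h \<in> lie_Aut br" "h o\<^sub>L g = id_blinfun" shows "h \<in> lie_Aut0 br"
proof -
  have "(\<lambda>f. h o\<^sub>L f) ` lie_Aut0 br \<subseteq> lie_Aut0 br"
  proof (rule lie_Aut0_maximal[where g=id_blinfun])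
    show "connected ((\<lambda>f. h o\<^sub>L f) ` lie_Aut0 br)"
      by (rule connected_continuous_image[OF continuous_on_blinfun_compose_left connected_lie_Aut0])
    show "(\<lambda>f. h o\<^sub>L f) ` lie_Aut0 br \<subseteq> lie_Aut br"
      using assms(2) lie_Aut0_subset lie_Aut_compose by blast
    show "id_blinfun \<in> (\<lambda>f. h o\<^sub>L f) ` lie_Aut0 br" using assms(1,3) by (metis imageI)
  qed (rule id_lie_Aut0)
  moreover have "h = h o\<^sub>L id_blinfun" by (auto intro: blinfun_eqI)
  ultimately show ?thesis using id_lie_Aut0 by (metis image_subset_iff)
qed

context cartan
begin

lemma lie_ad_apply [simp]: "blinfun_apply (lie_ad br x) = br x"
  using linear_br by (simp add: lie_ad_def bounded_linear_Blinfun_apply linear_linear)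

lemma lie_ad_scaleR: "lie_ad br (t *\<^sub>R x) = t *\<^sub>R lie_ad br x"
  by (rule blinfun_eqI) (simp add: br_simps blinfun.scaleR_left)

lemma exp_ad_lie_Aut: "blinfun_exp (lie_ad br x) \<in> lie_Aut br"
proof -
  have "blinfun_exp (lie_ad br x) (br y z) = br (blinfun_exp (lie_ad br x) y) (blinfun_exp (lie_ad br x) z)" for y z
    by (rule blinfun_exp_bilinear[OF bilinear_br]) (simp only: lie_ad_apply, rule br_derivation)
  then show ?thesis by (simp add: lie_Aut_def bij_blinfun_exp)
qed

lemma exp_ad_lie_Aut0: "blinfun_exp (lie_ad br x) \<in> lie_Aut0 br"
proof -
  let ?f = "\<lambda>t. blinfun_exp (t *\<^sub>R lie_ad br x)"
  have "range ?f \<subseteq> lie_Aut0 br"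
  proof (rule lie_Aut0_maximal[where g=id_blinfun])
    show "connected (range ?f)"
      by (rule connected_continuous_image[OF continuous_on_blinfun_exp]) simp
    show "range ?f \<subseteq> lie_Aut br" using exp_ad_lie_Aut by (auto simp flip: lie_ad_scaleR)
    have "?f 0 = id_blinfun" by (simp add: blinfun_exp_0)
    then show "id_blinfun \<in> range ?f" by (metis rangeI)
  qed (rule id_lie_Aut0)
  then have "?f 1 \<in> lie_Aut0 br" by blast
  then show ?thesis by simp
qed

lemma analytic_subgroup_lie_Aut0: "g \<in> analytic_subgroup br S \<Longrightarrow> g \<in> lie_Aut0 br"
proof (induction rule: analytic_subgroup.induct)
  case (inverse g h)
  have g: "g \<in> lie_Aut br" using inverse lie_Aut0_subset by blast
  obtain h' where h': "h' \<in> lie_Aut br" "\<And>x. g (h' x) = x" "\<And>x. h' (g x) = x"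
    using lie_Aut_inverse[OF g] by blast
  have "g (h x) = x" for x using inverse(2) by (metis blinfun_apply_blinfun_compose blinfun_apply_id_blinfun)
  then have "h = h'" by (intro blinfun_eqI) (metis h'(3))
  then show ?case using lie_Aut0_inverse inverse h'(1) by blast
qed (auto intro: exp_ad_lie_Aut0 id_lie_Aut0 lie_Aut0_compose)

abbreviation K where "K \<equiv> analytic_subgroup br (cartan_k \<theta>)"

lemma K_hom: "k \<in> K \<Longrightarrow> k (br x y) = br (k x) (k y)"
  using analytic_subgroup_lie_Aut0[of k] lie_Aut0_subset[of br] unfolding lie_Aut_def by blast

lemma K_inverse:
  assumes "k \<in> K" obtains h where "h \<in> K" "\<And>x. k (h x) = x" "\<And>x. h (k x) = x"
  using analytic_subgroup_inverse[OF assms] by (metis blinfun_apply_blinfun_compose blinfun_apply_id_blinfun)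

lemma K_theta_Q: "k \<in> K \<Longrightarrow> (\<forall>x. \<theta> (k x) = k (\<theta> x)) \<and> (\<forall>x y. Q (k x) (k y) = Q x y)"
proof (induction rule: analytic_subgroup.induct)
  case (exp X)
  have X: "\<theta> X = X" using exp by (simp add: cartan_k_def)
  have "\<theta> (blinfun_exp (lie_ad br X) x) = blinfun_exp (lie_ad br X) (\<theta> x)" for x
    by (rule blinfun_exp_intertwine) (auto simp: linear_linear linear_theta theta_br X)
  \<comment> \<open>Invariance of \<open>Q\<close> is the Leibniz rule with the zero operator on the
    reals, because \<open>ad X\<close> is skew for \<open>X\<close> in
    \<open>cartan_k \<theta>\<close>.\<close>
  moreover have "blinfun_exp 0 (Q x y) = Q (blinfun_exp (lie_ad br X) x) (blinfun_exp (lie_ad br X) y)" for x y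
    by (rule blinfun_exp_bilinear[OF bilinear]) (simp add: Q_br X)
  ultimately show ?case by (simp add: blinfun_exp_0)
next
  case (inverse g h)
  have gh: "g (h x) = x" "h (g x) = x" for x
    using inverse(2,3) by (metis blinfun_apply_blinfun_compose blinfun_apply_id_blinfun)+
  have "\<theta> (h x) = h (\<theta> x)" for x
    using inverse(4) gh by metis
  moreover have "Q (h x) (h y) = Q x y" for x y
    using inverse(4) gh by metis
  ultimately show ?case by blast
qed auto

lemma K_theta: "k \<in> K \<Longrightarrow> \<theta> (k x) = k (\<theta> x)" and K_Q: "k \<in> K \<Longrightarrow> Q (k x) (k y) = Q x y"
  using K_theta_Q by blast+

lemma K_s: "k \<in> K \<Longrightarrow> x \<in> cartan_s \<theta> \<Longrightarrow> k x \<in> cartan_s \<theta>"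
  by (simp add: cartan_s_def K_theta blinfun.minus_right)

lemma linear_blinfun: "linear (blinfun_apply g)"
  by (rule bounded_linear.linear[OF blinfun.bounded_linear_right])

lemma K_eigs: "k \<in> K \<Longrightarrow> x \<in> eigs (br p) S \<Longrightarrow> k x \<in> eigs (br (k p)) S"
proof (rule eigs_map[OF _ linear_blinfun _ subspace_eigs])
  assume k: "k \<in> K"
  show "k x \<in> eigs (br (k p)) S" if "c \<in> S" "br p x = c *\<^sub>R x" for x c
    using that eigs_base[of "br (k p)" "k x" c S] by (simp add: K_hom[OF k, symmetric] blinfun.scaleR_right)
qed

end

section \<open>The filtration by eigenvalues\<close>

locale cartan_spectrum = cartan +
  fixes ls :: "real list"
  assumes sorted: "sorted_wrt (<) ls"
begin

lemma distinct_ls: "distinct ls"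
  using sorted by (induction ls) auto

definition Sig :: "'a \<Rightarrow> bool" where "Sig z \<longleftrightarrow> diagonal ls (br z)"

lemma diagonal_map: "Sig z \<Longrightarrow> diagonal_map (br z) ls"
  by (simp add: diagonal_map_def linear_br distinct_ls Sig_def)

abbreviation E :: "real set \<Rightarrow> 'a \<Rightarrow> 'a \<Rightarrow> 'a" where "E S p \<equiv> fcalc ls (br p) (indicator S)"

abbreviation n :: "'a \<Rightarrow> 'a set" where "n p \<equiv> eigs (br p) {0<..}"

lemma Sig_hom:
  assumes "g \<in> lie_Aut br" "Sig z" shows "Sig (g z)"
  unfolding Sig_def diagonal_def
proof
  fix x
  obtain h where h: "h \<in> lie_Aut br" "\<And>x. g (h x) = x" "\<And>x. h (g x) = x"
    by (rule lie_Aut_inverse[OF assms(1)], rule that)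
  have "g (br z y) = br (g z) (g y)" for y using assms(1) by (simp add: lie_Aut_def)
  then have "g (shifted_prod ls (br z) (h x)) = shifted_prod ls (br (g z)) (g (h x))"
    by (intro shifted_prod_intertwine linear_blinfun)
  then show "shifted_prod ls (br (g z)) x = 0"
    using assms(2) by (simp add: h Sig_def diagonal_def)
qed

lemma K_lie_Aut: "k \<in> K \<Longrightarrow> k \<in> lie_Aut br"
  using analytic_subgroup_lie_Aut0 lie_Aut0_subset by blast

lemma fcalc_hom:
  assumes "k \<in> lie_Aut br" shows "k (fcalc ls (br p) h x) = fcalc ls (br (k p)) h (k x)"
proof -
  have "k (br p y) = br (k p) (k y)" for y using assms by (simp add: lie_Aut_def)
  then have "k (shifted_prod m (br p) y) = shifted_prod m (br (k p)) (k y)" for m y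
    by (intro shifted_prod_intertwine linear_blinfun)
  then show ?thesis by (simp add: fcalc_def blinfun.sum_right blinfun.scaleR_right)
qed

text \<open>\<open>\<theta>\<close> exchanges the eigenspaces of \<open>c\<close> and
  \<open>- c\<close>. The rule \<open>fcalc_eigen\<close> covers \<open>- c\<close> whether or not
  it occurs in \<open>ls\<close>.\<close>

lemma fcalc_theta:
  assumes "p \<in> cartan_s \<theta>" "Sig p"
  shows "\<theta> (fcalc ls (br p) h x) = fcalc ls (br p) (\<lambda>c. h (- c)) (\<theta> x)"
proof -
  interpret d: diagonal_map "br p" ls by (rule diagonal_map[OF assms(2)])
  show ?thesis
  proof (rule d.linear_eqI[of "\<lambda>x. \<theta> (fcalc ls (br p) h x)" "\<lambda>x. fcalc ls (br p) (\<lambda>c. h (- c)) (\<theta> x)"])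
    show "linear (\<lambda>x. \<theta> (fcalc ls (br p) h x))" "linear (\<lambda>x. fcalc ls (br p) (\<lambda>c. h (- c)) (\<theta> x))"
      using linear_compose[OF linear_fcalc[OF linear_br] linear_theta]
        linear_compose[OF linear_theta linear_fcalc[OF linear_br]] by (simp_all add: o_def)
    fix x c assume x: "br p x = c *\<^sub>R x"
    then have "br p (\<theta> x) = (- c) *\<^sub>R \<theta> x"
      using br_theta_s[OF assms(1)] by (simp add: theta_simps)
    from d.fcalc_eigen[OF this] d.fcalc_eigen[OF x]
    show "\<theta> (fcalc ls (br p) h x) = fcalc ls (br p) (\<lambda>c. h (- c)) (\<theta> x)"
      by (simp add: theta_simps)
  qed
qed

lemma E_theta:
  assumes "p \<in> cartan_s \<theta>" "Sig p"
  shows "\<theta> (E S p x) = E (uminus ` S) p (\<theta> x)"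
proof -
  have "(\<lambda>c. indicator S (- c) :: real) = indicator (uminus ` S)"
    by (force simp: fun_eq_iff indicator_def image_iff)
  then show ?thesis using fcalc_theta[OF assms, of "indicator S" x] by simp
qed

section \<open>Filtration steps as kernels of polynomials\<close>

text \<open>The upper segments of \<open>ls\<close>. Their eigenspaces sum to the steps of a
  filtration that \<open>ad Y\<close> respects for \<open>Y\<close> in \<open>n p\<close>; lists are
  used because \<open>shifted_prod\<close> recurses over them.\<close>

definition up :: "real list \<Rightarrow> bool" where
  "up m \<longleftrightarrow> distinct m \<and> sorted_wrt (<) m \<and> set m \<subseteq> set ls \<and> (\<forall>l\<in>set m. \<forall>c\<in>set ls. l < c \<longrightarrow> c \<in> set m)"

lemma up_ls: "up ls"
  using sorted distinct_ls by (simp add: up_def)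

lemma up_Cons: "up (l # m) \<Longrightarrow> up m"
  by (fastforce simp: up_def)

lemma up_filter_ge: "up (filter (\<lambda>l. c \<le> l) ls)" and up_filter_gt: "up (filter (\<lambda>l. c < l) ls)"
  using sorted distinct_ls by (auto simp: up_def sorted_wrt_filter)

lemma br_n:
  assumes "Y \<in> n p" "x \<in> eigs (br p) {c..}" shows "br Y x \<in> eigs (br p) {c<..}"
  using eigs_br[OF assms(1,2), of "{c<..}"] by force

text \<open>The first entry \<open>l\<close> of an upper segment is its least one. On the filtration
  step of \<open>l # m\<close>, the factor \<open>ad (p + Y) - l\<close> kills the leading part for
  \<open>l\<close>, and \<open>ad Y\<close> only raises eigenvalues, so the result lies in the step
  of \<open>m\<close>. The last step is zero.\<close>

lemma shifted_prod_n:
  assumes p: "Sig p" and Y: "Y \<in> n p" and "up m" "x \<in> eigs (br p) (set m)"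
  shows "shifted_prod m (br (p + Y)) x = 0"
  using assms(3,4)
proof (induction m arbitrary: x)
  case Nil
  then show ?case by (simp add: eigs_def)
next
  case (Cons l m)
  interpret d: diagonal_map "br p" ls by (rule diagonal_map[OF p])
  have "br (p + Y) x - l *\<^sub>R x \<in> eigs (br p) (set m)"
  proof (rule eigs_map[OF Cons.prems(2) _ _ subspace_eigs])
    show "linear (\<lambda>x. br (p + Y) x - l *\<^sub>R x)"
      by (intro linear_compose_sub linear_scale_self linear_br)
    fix x c assume c: "c \<in> set (l # m)" "br p x = c *\<^sub>R x"
    have "br Y x \<in> eigs (br p) {c<..}"
      by (rule br_n[OF Y eigs_base[of "br p" x c, OF c(2)]]) simp
    then have "br Y x \<in> eigs (br p) ({c<..} \<inter> set ls)" by (rule d.eigs_Int)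
    moreover have "{c<..} \<inter> set ls \<subseteq> set m"
      using Cons.prems(1) c(1) by (fastforce simp: up_def)
    ultimately have "br Y x \<in> eigs (br p) (set m)" using eigs_mono by blast
    moreover have "(c - l) *\<^sub>R x \<in> eigs (br p) (set m)"
    proof (cases "c = l")
      case False
      then show ?thesis
        using c by (intro subspace_scale[OF subspace_eigs] eigs_base[of "br p" x c]) auto
    qed (simp add: subspace_0[OF subspace_eigs])
    ultimately have "br Y x + (c - l) *\<^sub>R x \<in> eigs (br p) (set m)"
      by (rule subspace_add[OF subspace_eigs])
    then show "br (p + Y) x - l *\<^sub>R x \<in> eigs (br p) (set m)"
      using c(2) by (simp add: br_simps algebra_simps)
  qed
  from Cons.IH[OF up_Cons[OF Cons.prems(1)] this] show ?case by simp
qed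

text \<open>Modulo higher eigenvalues, \<open>ad (p + C + Y)\<close> acts on the eigenspace of \<open>c\<close> as \<open>c + ad C\<close>.\<close>
lemma leading_term:
  assumes p: "Sig p" and C: "br p C = 0" and Y: "Y \<in> n p" and x: "x \<in> eigs (br p) {c..}"
  shows "br (p + C + Y) x \<in> eigs (br p) {c..}"
    and "E {c} p (br (p + C + Y) x) = br C (E {c} p x) + c *\<^sub>R E {c} p x"
proof -
  interpret d: diagonal_map "br p" ls by (rule diagonal_map[OF p])
  have brY: "br Y x \<in> eigs (br p) {c<..}" by (rule br_n[OF Y x])
  have Cx: "br p (br C x) = d *\<^sub>R br C x" if "br p x = d *\<^sub>R x" for x d
    using br_derivation[of p C x] by (simp add: C that br_simps)
  have "br (p + C) x \<in> eigs (br p) {c..}"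
  proof (rule eigs_map[OF x linear_br _ subspace_eigs])
    fix x d assume d: "d \<in> {c..}" "br p x = d *\<^sub>R x"
    have "br p (br (p + C) x) = d *\<^sub>R br (p + C) x"
      using Cx[OF d(2)] by (simp add: br_simps d(2) scaleR_add_right)
    then show "br (p + C) x \<in> eigs (br p) {c..}" by (rule eigs_base) (rule d(1))
  qed
  moreover have "br Y x \<in> eigs (br p) {c..}"
    by (rule subsetD[OF eigs_mono brY]) auto
  ultimately show "br (p + C + Y) x \<in> eigs (br p) {c..}"
    using subspace_add[OF subspace_eigs] by (simp add: br_simps)
  have 1: "E {c} p (br Y x) = 0"
    by (rule d.fcalc_eigs_0[OF brY]) (auto simp: indicator_def)
  have 2: "E {c} p (br p x) = c *\<^sub>R E {c} p x"
  proof -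
    have "E {c} p (br p x) = fcalc ls (br p) (\<lambda>d. indicator {c} d * d) x"
      by (subst d.fcalc_ident[symmetric]) (rule d.fcalc_fcalc)
    also have "(\<lambda>d. indicator {c} d * d) = (\<lambda>d. c * indicator {c} d)" by (auto simp: indicator_def)
    also have "fcalc ls (br p) (\<lambda>d. c * indicator {c} d) x = c *\<^sub>R E {c} p x"
      by (simp add: fcalc_def scaleR_sum_right)
    finally show ?thesis .
  qed
  have 3: "E {c} p (br C x) = br C (E {c} p x)"
  proof (rule d.linear_eqI[of "\<lambda>x. E {c} p (br C x)" "\<lambda>x. br C (E {c} p x)"])
    show "linear (\<lambda>x. E {c} p (br C x))" "linear (\<lambda>x. br C (E {c} p x))"
      using linear_compose[OF linear_br linear_fcalc[OF linear_br]]
        linear_compose[OF linear_fcalc[OF linear_br] linear_br] by (simp_all add: o_def)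
    show "E {c} p (br C x) = br C (E {c} p x)" if "br p x = d *\<^sub>R x" for x d
      using d.fcalc_eigen[OF Cx[OF that]] d.fcalc_eigen[OF that] by (simp add: br_simps)
  qed
  show "E {c} p (br (p + C + Y) x) = br C (E {c} p x) + c *\<^sub>R E {c} p x"
    by (simp add: br_simps linear_add[OF linear_fcalc[OF linear_br]] 1 2 3 add.commute)
qed

lemma leading_term_shifted_prod:
  assumes p: "Sig p" and C: "br p C = 0" and Y: "Y \<in> n p" and "x \<in> eigs (br p) {c..}"
  shows "E {c} p (shifted_prod m (br (p + C + Y)) x)
    = shifted_prod m (\<lambda>w. br C w + c *\<^sub>R w) (E {c} p x)"
  using assms(4)
proof (induction m arbitrary: x)
  case (Cons l m)
  let ?z = "p + C + Y"
  have lin: "linear (E {c} p)" by (rule linear_fcalc[OF linear_br])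
  have "br ?z x - l *\<^sub>R x \<in> eigs (br p) {c..}"
    by (intro subspace_diff[OF subspace_eigs] subspace_scale[OF subspace_eigs]
        leading_term(1)[OF p C Y] Cons.prems)
  from Cons.IH[OF this] show ?case
    by (simp add: linear_diff[OF lin] linear_cmul[OF lin] leading_term(2)[OF p C Y Cons.prems])
qed simp

text \<open>Shows that a filtration step of \<open>ad p\<close> depends on \<open>p + Y\<close>
  alone. For the converse, the lowest component outside the step, with eigenvalue \<open>c\<close>,
  is multiplied by the product of all \<open>c - l\<close>, which is nonzero; this is the leading
  term for \<open>C = 0\<close>.\<close>

lemma shifted_prod_n_iff:
  assumes p: "Sig p" and Y: "Y \<in> n p" and m: "up m"
  shows "shifted_prod m (br (p + Y)) x = 0 \<longleftrightarrow> x \<in> eigs (br p) (set m)"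
proof
  assume 0: "shifted_prod m (br (p + Y)) x = 0"
  interpret d: diagonal_map "br p" ls by (rule diagonal_map[OF p])
  have "set ls = (set ls - set m) \<union> set m" using m by (auto simp: up_def)
  then obtain a b where ab: "a \<in> eigs (br p) (set ls - set m)" "b \<in> eigs (br p) (set m)" "x = a + b"
    using eigs_Un d.eigs_all by metis
  have "shifted_prod m (br (p + Y)) a = 0"
    using 0 shifted_prod_n[OF p Y m ab(2)] ab(3)
    by (simp add: linear_add[OF linear_shifted_prod[OF linear_br]])
  have "a = 0"
  proof (rule ccontr)
    assume "a \<noteq> 0"
    then obtain c where c: "c \<in> set ls - set m" "E {c} p a \<noteq> 0" "a \<in> eigs (br p) {c..}"
      using d.lowest_component ab(1) by metis
    have "shifted_prod m (\<lambda>w. br 0 w + c *\<^sub>R w) (E {c} p a) = 0"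
      using leading_term_shifted_prod[OF p _ Y c(3), of 0 m] \<open>shifted_prod m (br (p + Y)) a = 0\<close>
      by (simp add: br_simps linear_0[OF linear_fcalc[OF linear_br]])
    moreover have "shifted_prod m (\<lambda>w. br 0 w + c *\<^sub>R w) (E {c} p a)
        = prod_list (map (\<lambda>l. c - l) m) *\<^sub>R E {c} p a"
      by (rule shifted_prod_eigen) (auto simp: br_simps linear_scale_self)
    ultimately show False using c by (auto simp: prod_list_zero_iff)
  qed
  then show "x \<in> eigs (br p) (set m)" using ab by simp
qed (rule shifted_prod_n[OF p Y m])

lemma Sig_n: "Sig p \<Longrightarrow> Y \<in> n p \<Longrightarrow> Sig (p + Y)"
  using diagonal_map.eigs_all[OF diagonal_map] shifted_prod_n[OF _ _ up_ls]
  by (simp add: Sig_def diagonal_def)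

text \<open>Membership in \<open>n p\<close> becomes one equation that is polynomial in
  \<open>p\<close> and \<open>x\<close> jointly, hence closed under limits in which \<open>p\<close>
  varies too.\<close>

lemma n_iff: "Sig p \<Longrightarrow> x \<in> n p \<longleftrightarrow> shifted_prod (filter (\<lambda>l. 0 < l) ls) (br p) x = 0"
proof -
  assume p: "Sig p"
  interpret d: diagonal_map "br p" ls by (rule diagonal_map[OF p])
  have "x \<in> n p \<longleftrightarrow> x \<in> eigs (br p) (set (filter (\<lambda>l. 0 < l) ls))"
    using d.eigs_Int[of x "{0<..}"] eigs_mono[of "set (filter (\<lambda>l. 0 < l) ls)" "{0<..}" "br p"]
      eigs_mono[of "{0<..} \<inter> set ls" "set (filter (\<lambda>l. 0 < l) ls)" "br p"] by auto
  also have "\<dots> \<longleftrightarrow> shifted_prod (filter (\<lambda>l. 0 < l) ls) (br p) x = 0"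
    using shifted_prod_n_iff[OF p subspace_0[OF subspace_eigs] up_filter_gt[of 0]] by simp
  finally show ?thesis .
qed

text \<open>The eigenvalues of \<open>C\<close> are differences of elements of the list, so a small \<open>C\<close> vanishes.\<close>
lemma Sig_isolated:
  obtains \<delta> where "\<delta> > 0"
    "\<And>p C Y. Sig p \<Longrightarrow> br p C = 0 \<Longrightarrow> Y \<in> n p \<Longrightarrow> Sig (p + C + Y) \<Longrightarrow> norm C < \<delta> \<Longrightarrow> C = 0"
proof -
  obtain B where B: "B > 0" "\<And>x y. norm (br x y) \<le> B * norm x * norm y"
    using bilinear_bounded_pos[OF bilinear_br] by blast
  \<comment> \<open>The nonzero gaps of the spectrum; 1 is inserted so that the minimum exists even
    without gaps. Division by the bound \<open>B\<close> of the bracket is due to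
    \<open>\<bar>l - c\<bar> * norm y \<le> B * norm C * norm y\<close> for an eigenvector
    \<open>y\<close>.\<close>
  define D where "D = insert 1 {\<bar>l - c\<bar> | l c. l \<in> set ls \<and> c \<in> set ls \<and> l \<noteq> c}"
  have "D \<subseteq> insert 1 ((\<lambda>(l, c). \<bar>l - c\<bar>) ` (set ls \<times> set ls))" by (auto simp: D_def)
  then have fin: "finite D" by (rule finite_subset) simp
  have "Min D \<in> D" using fin by (intro Min_in) (auto simp: D_def)
  then have pos: "Min D > 0" by (auto simp: D_def)
  show ?thesis
  proof (rule that[of "Min D / B"])
    show "Min D / B > 0" using pos B by simp
    fix p C Y assume p: "Sig p" and C: "br p C = 0" and Y: "Y \<in> n p" and S: "Sig (p + C + Y)"
      and small: "norm C < Min D / B"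
    interpret d: diagonal_map "br p" ls by (rule diagonal_map[OF p])
    have "br C x = 0" if x: "br p x = c *\<^sub>R x" for x c
    proof (cases "c \<in> set ls")
      case False
      then show ?thesis using d.eigen_not_in[OF x] by (simp add: br_simps)
    next
      case c: True
      have "x \<in> eigs (br p) {c..}" by (rule eigs_base[of "br p" x c, OF x]) simp
      \<comment> \<open>On an eigenvector for \<open>c\<close> the leading term of the vanishing
        polynomial in \<open>ad (p + C + Y)\<close> is the same polynomial in
        \<open>ad C + c\<close>. So \<open>x\<close> is a sum of eigenvectors of \<open>ad C\<close>
        with eigenvalues \<open>l - c\<close>.\<close>
      from leading_term_shifted_prod[OF p C Y this, of ls]
      have "shifted_prod ls (\<lambda>w. br C w + c *\<^sub>R w) x = 0"
        using S d.fcalc_eigen[OF x, of "indicator {c}"]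
        by (simp add: Sig_def diagonal_def linear_0[OF linear_fcalc[OF linear_br]])
      then have mem: "x \<in> eigs (\<lambda>w. br C w + c *\<^sub>R w) (set ls)"
        by (intro shifted_prod_kernel distinct_ls linear_compose_add linear_br linear_scale_self)
      show ?thesis
      proof (rule eigs_linear_eqI[OF mem linear_br module_hom_zero])
        fix y l assume l: "l \<in> set ls" "br C y + c *\<^sub>R y = l *\<^sub>R y"
        have y: "br C y = (l - c) *\<^sub>R y" using l(2) by (simp add: algebra_simps)
        show "br C y = 0"
        proof (rule ccontr)
          assume ne: "br C y \<noteq> 0"
          then have "l \<noteq> c" "y \<noteq> 0" using y by auto
          then have "Min D \<le> \<bar>l - c\<bar>" using l c fin by (intro Min_le) (auto simp: D_def)
          moreover have "\<bar>l - c\<bar> * norm y \<le> B * norm C * norm y"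
            using B(2)[of C y] y by simp
          then have "\<bar>l - c\<bar> \<le> B * norm C" using \<open>y \<noteq> 0\<close> by simp
          moreover have "B * norm C < Min D" using small B(1) by (simp add: field_simps)
          ultimately show False by linarith
        qed
      qed
    qed
    then have "br C x = 0" for x
      by (rule d.linear_eqI[OF linear_br module_hom_zero])
    then show "C = 0" by (rule center_trivial)
  qed
qed

lemma decomposition_unique:
  assumes p: "p \<in> cartan_s \<theta>" "Sig p" "Y \<in> n p" and p': "p' \<in> cartan_s \<theta>" "Sig p'" "Y' \<in> n p'"
    and eq: "p + Y = p' + Y'"
  shows "p = p'"
proof -
  interpret d: diagonal_map "br p" ls by (rule diagonal_map[OF p(2)])
  have same: "x \<in> eigs (br p) (set m) \<longleftrightarrow> x \<in> eigs (br p') (set m)" if "up m" for x m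
    using shifted_prod_n_iff[OF p(2,3) that, of x] shifted_prod_n_iff[OF p'(2,3) that, of x] eq by simp
  have "br p x = br p' x" if x: "br p x = c *\<^sub>R x" for x c
  proof (cases "c \<in> set ls")
    case False
    then show ?thesis using d.eigen_not_in[OF x] by (simp add: br_simps)
  next
    case c: True
    let ?g = "filter (\<lambda>l. c \<le> l) ls" and ?h = "filter (\<lambda>l. c < l) ls"
    have "x \<in> eigs (br p) (set ?g)" by (rule eigs_base[of "br p" x c, OF x]) (simp add: c)
    then have "x \<in> eigs (br p') (set ?g)" using same[OF up_filter_ge] by blast
    also have "set ?g = {c} \<union> set ?h" using c by auto
    finally obtain a b where ab: "a \<in> eigs (br p') {c}" "b \<in> eigs (br p') (set ?h)" "x = a + b"
      using eigs_Un by metis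
    \<comment> \<open>The remainder \<open>b\<close> belongs to the higher step for
      \<open>p'\<close>, hence also for \<open>p\<close>. It is therefore orthogonal both to
      \<open>x\<close> and to \<open>a\<close>, and \<open>x = a + b\<close> leaves
      \<open>Q b b = 0\<close>.\<close>
    have "b \<in> eigs (br p) (set ?h)" using ab(2) same[OF up_filter_gt] by blast
    moreover have "x \<in> eigs (br p) {c}" by (rule eigs_base[of "br p" x c, OF x]) simp
    ultimately have "Q b x = 0" by (intro Q_eigs[OF p(1)]) auto
    moreover have "Q b a = 0" by (rule Q_eigs[OF p'(1) ab(2,1)]) auto
    ultimately have "b = 0" using ab(3) by (simp add: Q_simps)
    then show ?thesis using eigs_singleton[OF linear_br ab(1)] ab(3) x by simp
  qed
  then have "br p x = br p' x" for x by (rule d.linear_eqI[OF linear_br linear_br])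
  then have "br (p - p') x = 0" for x by (simp add: br_simps)
  then show ?thesis using center_trivial[of "p - p'"] by simp
qed

text \<open>With \<open>Y = X / c\<close> for an eigenvector \<open>X\<close> of the lowest eigenvalue \<open>c > 0\<close>, \<open>exp (ad Y)\<close> maps
  \<open>p + X\<close> to \<open>p\<close> and preserves the sum of the higher eigenspaces.\<close>
lemma add_n_in_orbit_aux:
  assumes p: "Sig p" and "up m" "set m \<subseteq> {0<..}" "X \<in> eigs (br p) (set m)"
  shows "\<exists>g\<in>lie_Aut0 br. p + X = g p"
  using assms(2-4)
proof (induction m arbitrary: X)
  case Nil
  then show ?case using id_lie_Aut0 by (intro bexI[of _ id_blinfun]) (auto simp: eigs_def)
next
  case (Cons c m)
  interpret d: diagonal_map "br p" ls by (rule diagonal_map[OF p])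
  have c: "c > 0" using Cons.prems(2) by simp
  have "set (c # m) = {c} \<union> set m" by simp
  then obtain a b where ab: "a \<in> eigs (br p) {c}" "b \<in> eigs (br p) (set m)" "X = a + b"
    using eigs_Un Cons.prems(3) by metis
  define Y where "Y = a /\<^sub>R c"
  have a: "br p a = c *\<^sub>R a" by (rule eigs_singleton[OF linear_br ab(1)])
  have "br Y p = - a" using br_anti[of Y p] c by (simp add: Y_def br_simps a)
  moreover have "br Y a = 0" by (simp add: Y_def br_simps)
  ultimately have 1: "blinfun_exp (lie_ad br Y) (p + a) = p"
    by (subst blinfun_exp_nilpotent) (simp_all add: br_simps)
  have 2: "blinfun_exp (lie_ad br Y) b \<in> eigs (br p) (set m)"
  proof (rule blinfun_exp_invariant[OF subspace_eigs _ ab(2)])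
    fix v assume v: "v \<in> eigs (br p) (set m)"
    have "Y \<in> eigs (br p) {c}" unfolding Y_def by (rule subspace_scale[OF subspace_eigs ab(1)])
    then have "br Y v \<in> eigs (br p) {l + c | l. l \<in> set m}"
      by (rule eigs_br[OF _ v]) (auto simp: add.commute)
    then have A: "br Y v \<in> eigs (br p) ({l + c | l. l \<in> set m} \<inter> set ls)" by (rule d.eigs_Int)
    \<comment> \<open>Adding \<open>c > 0\<close> moves entries of \<open>m\<close> upwards; an
      upper segment contains every sum that is still an eigenvalue.\<close>
    have B: "{l + c | l. l \<in> set m} \<inter> set ls \<subseteq> set m"
      using Cons.prems(1) c by (auto simp: up_def)
    show "blinfun_apply (lie_ad br Y) v \<in> eigs (br p) (set m)"
      using subsetD[OF eigs_mono[OF B] A] by simp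
  qed
  obtain g where g: "g \<in> lie_Aut0 br" "p + blinfun_exp (lie_ad br Y) b = g p"
    using Cons.IH[OF up_Cons[OF Cons.prems(1)] _ 2] Cons.prems(2) by auto
  have "blinfun_exp (lie_ad br Y) (p + X) = g p"
    using g(2) 1 by (simp add: ab(3) blinfun.add_right flip: add.assoc)
  then have "p + X = (blinfun_exp (lie_ad br (- Y)) o\<^sub>L g) p"
    using blinfun_exp_minus_apply(1)[of "lie_ad br Y" "p + X"] lie_ad_scaleR[of "-1" Y] by simp
  then show ?case using lie_Aut0_compose[OF exp_ad_lie_Aut0 g(1)] by blast
qed

lemma add_n_in_orbit:
  assumes p: "Sig p" and X: "X \<in> n p"
  obtains g where "g \<in> lie_Aut0 br" "p + X = g p"
proof -
  let ?m = "filter (\<lambda>l. 0 < l) ls"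
  interpret d: diagonal_map "br p" ls by (rule diagonal_map[OF p])
  have "X \<in> eigs (br p) ({0<..} \<inter> set ls)" by (rule d.eigs_Int[OF X])
  also have "{0<..} \<inter> set ls = set ?m" by auto
  finally show ?thesis using add_n_in_orbit_aux[OF p up_filter_gt] that by auto
qed

end

section \<open>Charts\<close>

lemma differentiable_linear: "linear l \<Longrightarrow> (l has_derivative l) F" for l :: "'a::euclidean_space \<Rightarrow> 'b::euclidean_space"
  by (simp add: linear_linear bounded_linear_imp_has_derivative)

context cartan
begin

text \<open>Coordinates of the second kind on \<open>K\<close>: a product of one-parameter groups,
  one for each basis vector. Its smoothness needs only the exponential along fixed lines, not as a
  function of the endomorphism.\<close>

primrec kprod :: "'a list \<Rightarrow> ('a \<Rightarrow> 'a) \<Rightarrow> 'a \<Rightarrow> ('a \<Rightarrow>\<^sub>L 'a)" where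
  "kprod [] l x = id_blinfun"
| "kprod (b # bs) l x = blinfun_exp ((x \<bullet> b) *\<^sub>R lie_ad br (l b)) o\<^sub>L kprod bs l x"

lemma kprod_K:
  assumes "\<And>x. l x \<in> cartan_k \<theta>" shows "kprod bs l x \<in> K"
proof (induction bs)
  case (Cons b bs)
  have "blinfun_exp (lie_ad br ((x \<bullet> b) *\<^sub>R l b)) \<in> K"
    by (intro analytic_subgroup.exp subspace_scale[OF subspace_k] assms)
  then show ?case using Cons by (auto intro: analytic_subgroup.comp simp: lie_ad_scaleR)
qed (simp add: analytic_subgroup.id)

lemma kprod_0: "kprod bs l 0 = id_blinfun"
  by (induction bs) (auto simp: blinfun_exp_0 intro: blinfun_eqI)

lemma smooth_on_kprod:
  assumes "smooth_on w UNIV" shows "smooth_on (\<lambda>x. kprod bs l x (w x)) UNIV"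
proof (induction bs)
  case (Cons b bs)
  have "smooth_on (\<lambda>x. (x \<bullet> b, kprod bs l x (w x))) UNIV"
    by (intro smooth_on_Pair Cons smooth_on_linear)
      (auto intro: bounded_linear.linear[OF bounded_linear_inner_left])
  from smooth_on_compose[OF open_UNIV open_UNIV _ smooth_on_blinfun_exp this]
  show ?case by simp
qed (use assms in simp)

lemma has_derivative_kprod:
  assumes "(w has_derivative w') (at 0)"
  shows "((\<lambda>x. kprod bs l x (w x)) has_derivative
    (\<lambda>h. (\<Sum>b\<leftarrow>bs. (h \<bullet> b) *\<^sub>R br (l b) (w 0)) + w' h)) (at 0)"
proof (induction bs)
  case (Cons b bs)
  let ?g = "\<lambda>x. (x \<bullet> b, kprod bs l x (w x))"
  have "(?g has_derivative (\<lambda>h. (h \<bullet> b, (\<Sum>b\<leftarrow>bs. (h \<bullet> b) *\<^sub>R br (l b) (w 0)) + w' h))) (at 0)"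
    by (intro has_derivative_Pair Cons bounded_linear_imp_has_derivative bounded_linear_inner_left)
  from has_derivative_compose[OF this blinfun_exp_has_derivative[of "lie_ad br (l b)"]]
  show ?case by (simp add: blinfun_exp_0 kprod_0 add.assoc)
qed (use assms in simp)

text \<open>The common source of both kinds of charts. The map \<open>\<Psi>\<close> has derivative
  \<open>br (l x) z + m x\<close> at 0: \<open>l\<close> selects directions along the
  \<open>K\<close>-orbit and \<open>m\<close> a complement. \<open>W\<close> restricts the
  coordinates so that a smallness condition can be imposed.\<close>

lemma K_chart:
  fixes l m :: "'a \<Rightarrow> 'a"
  assumes l: "linear l" "\<And>x. l x \<in> cartan_k \<theta>" and m: "linear m"
    and inj: "\<And>x. br (l x) z + m x = 0 \<Longrightarrow> x = 0" and W: "open W" "0 \<in> W"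
  obtains U V \<Phi> \<Psi> \<kappa> where "open U" "z \<in> U" "open V" "V \<subseteq> W" "homeomorphism U V \<Phi> \<Psi>"
    "smooth_on \<Phi> U" "smooth_on \<Psi> V" "\<And>x. \<kappa> x \<in> K" "\<And>x. \<Psi> x = blinfun_apply (\<kappa> x) (z + m x)"
    "\<And>v. smooth_on (\<lambda>x. blinfun_apply (\<kappa> x) v) UNIV"
proof -
  obtain bs where bs: "set bs = (Basis :: 'a set)" "distinct bs"
    using finite_distinct_list[OF finite_Basis] by blast
  define \<kappa> where "\<kappa> = kprod bs l"
  define \<Psi> where "\<Psi> = (\<lambda>x. blinfun_apply (\<kappa> x) (z + m x))"
  have "smooth_on (\<lambda>x. z + m x) UNIV"
    by (intro smooth_on_add smooth_on_const smooth_on_linear m) auto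
  then have sm: "smooth_on \<Psi> UNIV" unfolding \<Psi>_def \<kappa>_def by (rule smooth_on_kprod)
  have "((\<lambda>x. z + m x) has_derivative m) (at 0)"
    using has_derivative_add[OF has_derivative_const differentiable_linear[OF m]] by simp
  from has_derivative_kprod[OF this, of bs l]
  have der: "(\<Psi> has_derivative (\<lambda>h. (\<Sum>b\<leftarrow>bs. (h \<bullet> b) *\<^sub>R br (l b) z) + m h)) (at 0)"
    by (simp add: \<Psi>_def \<kappa>_def linear_0[OF m])
  have D: "(\<lambda>h. (\<Sum>b\<leftarrow>bs. (h \<bullet> b) *\<^sub>R br (l b) z) + m h) = (\<lambda>h. br (l h) z + m h)"
  proof
    fix h
    have "linear (\<lambda>h. br (l h) z)"
      using linear_compose[OF l(1) linear_br_left[of z]] by (simp add: o_def)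
    from linear_expand[OF this, of h]
    show "(\<Sum>b\<leftarrow>bs. (h \<bullet> b) *\<^sub>R br (l b) z) + m h = br (l h) z + m h"
      using bs by (simp add: sum_list_distinct_conv_sum_set)
  qed
  have "linear (\<lambda>h. br (l h) z + m h)"
    using linear_compose[OF l(1) linear_br_left[of z]] m by (intro linear_compose_add) (simp_all add: o_def)
  then have inj': "inj (\<lambda>h. br (l h) z + m h)"
    using inj linear_injective_0 by blast
  obtain U' V' g where IFT: "open U'" "U' \<subseteq> W" "0 \<in> U'" "open V'" "homeomorphism U' V' \<Psi> g" "smooth_on g V'"
    using smooth_inverse_function_theorem[OF W smooth_on_subset[OF sm] der[unfolded D] inj'] by blast
  have "\<Psi> 0 = z" by (simp add: \<Psi>_def \<kappa>_def kprod_0 linear_0[OF m])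
  then have "z \<in> V'" using IFT(3,5) unfolding homeomorphism_def by blast
  show ?thesis
  proof (rule that[OF IFT(4) \<open>z \<in> V'\<close> IFT(1,2) homeomorphism_symD[OF IFT(5)] IFT(6)])
    show "smooth_on \<Psi> U'" using smooth_on_subset[OF sm] by blast
    show "\<kappa> x \<in> K" for x unfolding \<kappa>_def by (rule kprod_K[OF l(2)])
    show "\<Psi> x = blinfun_apply (\<kappa> x) (z + m x)" for x by (simp add: \<Psi>_def)
    show "smooth_on (\<lambda>x. blinfun_apply (\<kappa> x) v) UNIV" for v
      unfolding \<kappa>_def by (rule smooth_on_kprod[OF smooth_on_const]) simp
  qed
qed

end

context cartan_spectrum
begin

lemma continuous_on_fcalc: "continuous_on S (fcalc ls (br p) h)"
  using linear_fcalc[OF linear_br] by (simp add: linear_continuous_on linear_linear)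

lemma subspace_E_kernel: "subspace {x. E S p x = 0}"
  unfolding subspace_def using linear_fcalc[OF linear_br]
  by (auto simp: linear_0 linear_add linear_cmul)

lemma Sig_K: "k \<in> K \<Longrightarrow> Sig z \<Longrightarrow> Sig (k z)"
  using Sig_hom K_lie_Aut by blast

lemma Sig_K_iff: "k \<in> K \<Longrightarrow> Sig (k z) \<longleftrightarrow> Sig z"
  by (metis K_inverse Sig_K)

lemma orbit_chart:
  assumes p: "p \<in> cartan_s \<theta>" "Sig p" and X0: "X0 \<in> n p"
  obtains U V \<Phi> \<Psi> \<kappa> where "open U" "p + X0 \<in> U" "open V" "homeomorphism U V \<Phi> \<Psi>"
    "smooth_on \<Phi> U" "smooth_on \<Psi> V" "\<And>x. \<kappa> x \<in> K"
    "\<And>x. E {0} p x = 0 \<Longrightarrow> \<exists>Y\<in>n p. \<Psi> x = blinfun_apply (\<kappa> x) (p + Y)"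
    "\<And>v. smooth_on (\<lambda>x. blinfun_apply (\<kappa> x) v) UNIV"
    "\<And>x. x \<in> V \<Longrightarrow> Sig (\<Psi> x) \<Longrightarrow> E {0} p x = 0"
proof -
  interpret d: diagonal_map "br p" ls by (rule diagonal_map[OF p(2)])
  obtain \<delta> where \<delta>: "\<delta> > 0"
    "\<And>p C Y. Sig p \<Longrightarrow> br p C = 0 \<Longrightarrow> Y \<in> n p \<Longrightarrow> Sig (p + C + Y) \<Longrightarrow> norm C < \<delta> \<Longrightarrow> C = 0"
    using Sig_isolated by blast
  have lE: "linear (E S p)" for S by (rule linear_fcalc[OF linear_br])
  \<comment> \<open>The negative part \<open>a\<close> is completed to \<open>a + \<theta> a\<close>
    in \<open>cartan_k \<theta>\<close>; moving along it accounts for the negative eigenspaces, and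
    \<open>m\<close> adds the remaining ones. The set \<open>W\<close> keeps the zero part within
    reach of isolation of the spectrum.\<close>
  define l where "l x = E {..<0} p x + \<theta> (E {..<0} p x)" for x
  define m where "m x = E {0<..} p x + E {0} p x" for x
  define W where "W = {x. norm (E {0} p x) < \<delta>}"
  have linl: "linear l" unfolding l_def
    using linear_compose[OF lE linear_theta] by (intro linear_compose_add lE) (simp add: o_def)
  have lk: "l x \<in> cartan_k \<theta>" for x by (simp add: l_def cartan_k_def theta_simps add.commute)
  have linm: "linear m" unfolding m_def by (intro linear_compose_add lE)
  have En: "E {0<..} p x \<in> n p" for x by (rule d.fcalc_in_eigs) simp
  have E0: "br p (E {0} p x) = 0" for x
    using eigs_singleton[OF linear_br d.fcalc_in_eigs[of "{0}" "indicator {0}"], of x] by simp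
  have z: "p + X0 \<in> eigs (br p) {0..}"
  proof (rule subspace_add[OF subspace_eigs])
    show "p \<in> eigs (br p) {0..}" by (rule eigs_base[of "br p" p 0]) simp_all
    show "X0 \<in> eigs (br p) {0..}" by (rule subsetD[OF eigs_mono X0]) auto
  qed
  have inj: "x = 0" if x: "br (l x) (p + X0) + m x = 0" for x
  proof -
    define a where "a = E {..<0} p x"
    have a_neg: "a \<in> eigs (br p) {..<0}" unfolding a_def by (rule d.fcalc_in_eigs) simp
    have "\<theta> a \<in> eigs (br p) {0<..}" by (rule eigs_theta[OF p(1) a_neg]) simp
    then have ta: "br (\<theta> a) (p + X0) \<in> eigs (br p) {0<..}" by (rule eigs_br[OF _ z]) simp
    have "a = 0"
    proof (rule ccontr)
      assume "a \<noteq> 0"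
      then obtain c where c: "c < 0" "E {c} p a \<noteq> 0" "a \<in> eigs (br p) {c..}"
        using d.lowest_component[OF _ a_neg] by (metis lessThan_iff)
      \<comment> \<open>At the lowest eigenvalue \<open>c < 0\<close> of \<open>a\<close>, neither
        \<open>X0\<close>, nor \<open>\<theta> a\<close>, nor \<open>m x\<close> contributes. What
        remains of the derivative there is \<open>- c\<close> times the component of
        \<open>a\<close>.\<close>
      have "E {c} p (br (p + 0 + X0) a) = br 0 (E {c} p a) + c *\<^sub>R E {c} p a"
        by (rule leading_term(2)[OF p(2) _ X0 c(3)]) (simp add: br_simps)
      then have "E {c} p (br (p + X0) a) = c *\<^sub>R E {c} p a"
        by (simp add: bilinear_lzero[OF bilinear_br])
      then have "E {c} p (br a (p + X0)) = - c *\<^sub>R E {c} p a"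
        by (subst br_anti) (simp add: linear_neg[OF lE])
      moreover have "E {c} p (br (\<theta> a) (p + X0)) = 0"
        by (rule d.fcalc_eigs_0[OF ta]) (use c in \<open>auto simp: indicator_def\<close>)
      moreover have "E {c} p (m x) = 0"
        unfolding m_def d.fcalc_add d.fcalc_fcalc using c(1)
        by (intro d.fcalc_eigs_0[OF d.eigs_all]) (auto simp: indicator_def)
      moreover have "E {c} p (br (l x) (p + X0) + m x) = 0" using x linear_0[OF lE] by simp
      ultimately have "c *\<^sub>R E {c} p a = 0"
        by (simp add: l_def linear_add[OF lE] bilinear_ladd[OF bilinear_br] flip: a_def)
      then show False using c by simp
    qed
    then have "l x = 0" by (simp add: l_def theta_simps flip: a_def)
    then have "m x = 0" using x by (simp add: br_simps)
    moreover have "a + m x = x"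
    proof -
      have "a + m x = fcalc ls (br p) (\<lambda>_. 1) x"
        unfolding a_def m_def d.fcalc_add
        by (rule d.fcalc_cong_eigs[OF d.eigs_all]) (auto simp: indicator_def)
      then show ?thesis by (simp add: d.fcalc_1)
    qed
    ultimately show "x = 0" using \<open>a = 0\<close> by simp
  qed
  have W: "open W" "0 \<in> W"
    using \<delta>(1) unfolding W_def
    by (auto intro!: open_Collect_less continuous_on_norm continuous_on_fcalc simp: linear_0[OF lE])
  obtain U V \<Phi> \<Psi> \<kappa> where C: "open U" "p + X0 \<in> U" "open V" "V \<subseteq> W" "homeomorphism U V \<Phi> \<Psi>"
    "smooth_on \<Phi> U" "smooth_on \<Psi> V" "\<And>x. \<kappa> x \<in> K" "\<And>x. \<Psi> x = blinfun_apply (\<kappa> x) (p + X0 + m x)"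
    "\<And>v. smooth_on (\<lambda>x. blinfun_apply (\<kappa> x) v) UNIV"
    by (rule K_chart[OF linl lk linm inj W], assumption) (rule that)
  have Yn: "X0 + E {0<..} p x \<in> n p" for x
    by (rule subspace_add[OF subspace_eigs X0 En])
  show ?thesis
  proof (rule that[OF C(1-3,5-8) _ C(10)])
    show "\<exists>Y\<in>n p. \<Psi> x = blinfun_apply (\<kappa> x) (p + Y)" if "E {0} p x = 0" for x
      using Yn[of x] by (intro bexI[of _ "X0 + E {0<..} p x"]) (simp_all add: C(9) m_def that add.assoc)
    show "E {0} p x = 0" if x: "x \<in> V" "Sig (\<Psi> x)" for x
    proof (rule \<delta>(2)[OF p(2) E0 Yn[of x]])
      have "Sig (p + X0 + m x)" using x(2) Sig_K_iff[OF C(8)] by (simp add: C(9))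
      then show "Sig (p + E {0} p x + (X0 + E {0<..} p x))" by (simp add: m_def algebra_simps)
      show "norm (E {0} p x) < \<delta>" using x(1) C(4) by (auto simp: W_def)
    qed
  qed
qed

end

section \<open>The adjoint orbit\<close>

locale cartan_orbit = cartan_spectrum +
  fixes H :: 'a
  assumes H_s: "H \<in> cartan_s \<theta>" and H_Sig: "Sig H"
begin

definition Orb :: "'a set" where "Orb = (\<lambda>k. blinfun_apply k H) ` K"

definition M :: "'a set" where "M = {p + Y | p Y. p \<in> Orb \<and> Y \<in> n p}"

text \<open>The projection of the bundle \<open>M\<close> onto \<open>Orb\<close>; the choice is
  unique by \<open>decomposition_unique\<close>.\<close>

definition base :: "'a \<Rightarrow> 'a" where "base z = (SOME p. p \<in> Orb \<and> z - p \<in> n p)"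

lemma Orb_s: "p \<in> Orb \<Longrightarrow> p \<in> cartan_s \<theta>" and Orb_Sig: "p \<in> Orb \<Longrightarrow> Sig p"
  using K_s[OF _ H_s] Sig_K[OF _ H_Sig] by (auto simp: Orb_def)

lemma H_Orb: "H \<in> Orb"
  unfolding Orb_def using analytic_subgroup.id by (intro image_eqI[of _ _ id_blinfun]) auto

lemma K_Orb:
  assumes "k \<in> K" "p \<in> Orb" shows "k p \<in> Orb"
proof -
  obtain k' where k': "k' \<in> K" "p = k' H" using assms(2) by (auto simp: Orb_def)
  then have "k p = (k o\<^sub>L k') H" by simp
  then show ?thesis unfolding Orb_def using analytic_subgroup.comp[OF assms(1) k'(1)] by blast
qed

lemma K_Orb_iff: "k \<in> K \<Longrightarrow> k p \<in> Orb \<longleftrightarrow> p \<in> Orb"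
  by (metis K_inverse K_Orb)

lemma MI: "p \<in> Orb \<Longrightarrow> Y \<in> n p \<Longrightarrow> p + Y \<in> M"
  by (auto simp: M_def)

lemma base_eq: "p \<in> Orb \<Longrightarrow> Y \<in> n p \<Longrightarrow> base (p + Y) = p"
  unfolding base_def
proof (rule some_equality)
  show "p \<in> Orb \<Longrightarrow> Y \<in> n p \<Longrightarrow> p \<in> Orb \<and> p + Y - p \<in> n p" by simp
  show "q = p" if "p \<in> Orb" "Y \<in> n p" "q \<in> Orb \<and> p + Y - q \<in> n q" for q
    using decomposition_unique[of q "p + Y - q" p Y] that Orb_s Orb_Sig by simp
qed

lemma base_M: "z \<in> M \<Longrightarrow> base z \<in> Orb" "z \<in> M \<Longrightarrow> z - base z \<in> n (base z)"
  using base_eq by (auto simp: M_def)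

lemma K_M: "k \<in> K \<Longrightarrow> p \<in> Orb \<Longrightarrow> Y \<in> n p \<Longrightarrow> k (p + Y) \<in> M"
  using MI[OF K_Orb K_eigs] by (simp add: blinfun.add_right)

lemma M_Sig: "z \<in> M \<Longrightarrow> Sig z"
  using Sig_n Orb_Sig by (auto simp: M_def)

text \<open>One chart serves three ends: slices for the submanifold, openness of \<open>M\<close>
  within \<open>Sig\<close>, and a smooth local extension of \<open>base\<close>.\<close>

lemma M_chart:
  assumes "z \<in> M"
  obtains U V \<Phi> \<Psi> L where "open U" "z \<in> U" "open V" "homeomorphism U V \<Phi> \<Psi>"
    "smooth_on \<Phi> U" "smooth_on \<Psi> V" "subspace L" "L = {x. E {0} (base z) x = 0}"
    "\<Phi> ` (M \<inter> U) = L \<inter> V" "\<And>y. y \<in> U \<Longrightarrow> Sig y \<Longrightarrow> y \<in> M"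
    "\<exists>F. smooth_on F U \<and> (\<forall>y\<in>M \<inter> U. F y = base y)"
proof -
  let ?p = "base z"
  have p: "?p \<in> Orb" "z - ?p \<in> n ?p" using base_M[OF assms] by auto
  obtain U V \<Phi> \<Psi> \<kappa> where C: "open U" "?p + (z - ?p) \<in> U" "open V" "homeomorphism U V \<Phi> \<Psi>"
    "smooth_on \<Phi> U" "smooth_on \<Psi> V" "\<And>x. \<kappa> x \<in> K"
    "\<And>x. E {0} ?p x = 0 \<Longrightarrow> \<exists>Y\<in>n ?p. \<Psi> x = blinfun_apply (\<kappa> x) (?p + Y)"
    "\<And>v. smooth_on (\<lambda>x. blinfun_apply (\<kappa> x) v) UNIV"
    "\<And>x. x \<in> V \<Longrightarrow> Sig (\<Psi> x) \<Longrightarrow> E {0} ?p x = 0"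
    by (rule orbit_chart[OF Orb_s[OF p(1)] Orb_Sig[OF p(1)] p(2)]) (rule that)
  have hom: "\<Phi> y \<in> V" "\<Psi> (\<Phi> y) = y" if "y \<in> U" for y
    using C(4) that by (auto simp: homeomorphism_def)
  have hom': "\<Psi> x \<in> U" "\<Phi> (\<Psi> x) = x" if "x \<in> V" for x
    using C(4) that by (auto simp: homeomorphism_def)
  have MI': "\<Psi> x \<in> M" if "E {0} ?p x = 0" for x
    using C(8)[OF that] K_M[OF C(7) p(1)] by auto
  have L: "E {0} ?p (\<Phi> y) = 0" if "y \<in> U" "Sig y" for y
    using C(10)[of "\<Phi> y"] hom[OF that(1)] that(2) by simp
  show ?thesis
  proof (rule that[OF C(1) _ C(3-6) subspace_E_kernel refl])
    show "z \<in> U" using C(2) by simp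
    show "\<Phi> ` (M \<inter> U) = {x. E {0} ?p x = 0} \<inter> V"
    proof
      show "\<Phi> ` (M \<inter> U) \<subseteq> {x. E {0} ?p x = 0} \<inter> V" using L hom(1) M_Sig by auto
      show "{x. E {0} ?p x = 0} \<inter> V \<subseteq> \<Phi> ` (M \<inter> U)"
      proof
        fix x assume "x \<in> {x. E {0} ?p x = 0} \<inter> V"
        then show "x \<in> \<Phi> ` (M \<inter> U)"
          using MI'[of x] hom'[of x] by (intro image_eqI[of x \<Phi> "\<Psi> x"]) auto
      qed
    qed
    show "y \<in> M" if "y \<in> U" "Sig y" for y
      using MI'[OF L[OF that]] hom(2)[OF that(1)] by simp
    \<comment> \<open>The factor \<open>\<kappa> (\<Phi> y)\<close> that produces \<open>y\<close>
      also carries the base point \<open>?p\<close> to that of \<open>y\<close>, since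
      \<open>K\<close> respects the decomposition.\<close>
    have "smooth_on (\<lambda>y. blinfun_apply (\<kappa> (\<Phi> y)) ?p) U"
      by (rule smooth_on_compose[OF C(1) open_UNIV _ C(9) C(5)]) simp
    moreover have "blinfun_apply (\<kappa> (\<Phi> y)) ?p = base y" if y: "y \<in> M \<inter> U" for y
    proof -
      obtain Y where Y: "Y \<in> n ?p" "y = blinfun_apply (\<kappa> (\<Phi> y)) (?p + Y)"
        using C(8)[OF L, of y] y M_Sig hom(2) by auto
      then have "base y = base (blinfun_apply (\<kappa> (\<Phi> y)) ?p + blinfun_apply (\<kappa> (\<Phi> y)) Y)"
        by (metis blinfun.add_right)
      also have "\<dots> = blinfun_apply (\<kappa> (\<Phi> y)) ?p"
        by (rule base_eq[OF K_Orb[OF C(7) p(1)] K_eigs[OF C(7) Y(1)]])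
      finally show ?thesis by simp
    qed
    ultimately show "\<exists>F. smooth_on F U \<and> (\<forall>y\<in>M \<inter> U. F y = base y)" by blast
  qed
qed

text \<open>An element of \<open>K\<close> taking \<open>H\<close> to \<open>p\<close> conjugates
  the projections. This makes the dimension of the slices constant.\<close>

lemma dim_E_kernel:
  assumes "p \<in> Orb" shows "dim {x. E {0} p x = 0} = dim {x. E {0} H x = 0}"
proof -
  obtain k where k: "k \<in> K" "p = k H" using assms by (auto simp: Orb_def)
  obtain h where h: "h \<in> K" "\<And>x. k (h x) = x" "\<And>x. h (k x) = x"
    using K_inverse[OF k(1)] by blast
  have "{x. E {0} p x = 0} = k ` {x. E {0} H x = 0}"
  proof (rule set_eqI)
    fix x
    have "h (E {0} p x) = E {0} H (h x)"
      using fcalc_hom[OF K_lie_Aut[OF h(1)], of p] by (simp add: k(2) h(3))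
    then have "E {0} p x = 0 \<longleftrightarrow> E {0} H (h x) = 0"
      by (metis h(2) blinfun.zero_right)
    then show "x \<in> {x. E {0} p x = 0} \<longleftrightarrow> x \<in> k ` {x. E {0} H x = 0}"
      using h by (auto simp: image_iff)
  qed
  moreover have "inj (blinfun_apply k)" by (metis h(3) injI)
  ultimately show ?thesis using dim_image_eq[OF linear_blinfun] by (metis inj_on_subset subset_UNIV)
qed

lemma submanifold_M: "submanifold (dim {x. E {0} H x = 0}) M"
  unfolding submanifold_def
proof
  fix z assume z: "z \<in> M"
  obtain U V \<Phi> \<Psi> L where "open U" "z \<in> U" "open V" "homeomorphism U V \<Phi> \<Psi>"
    "smooth_on \<Phi> U" "smooth_on \<Psi> V" "subspace L" "L = {x. E {0} (base z) x = 0}"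
    "\<Phi> ` (M \<inter> U) = L \<inter> V"
    by (rule M_chart[OF z]) (rule that)
  then have "open U \<and> z \<in> U \<and> open V \<and> homeomorphism U V \<Phi> \<Psi> \<and> smooth_on \<Phi> U \<and> smooth_on \<Psi> V \<and>
      subspace L \<and> dim L = dim {x. E {0} H x = 0} \<and> \<Phi> ` (M \<inter> U) = L \<inter> V"
    using dim_E_kernel[OF base_M(1)[OF z]] by (intro conjI) simp_all
  then show "\<exists>U V (\<phi> :: 'a \<Rightarrow> 'a) \<phi>' L. open U \<and> z \<in> U \<and> open V \<and> homeomorphism U V \<phi> \<phi>' \<and>
      smooth_on \<phi> U \<and> smooth_on \<phi>' V \<and> subspace L \<and> dim L = dim {x. E {0} H x = 0} \<and> \<phi> ` (M \<inter> U) = L \<inter> V"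
    by blast
qed

lemma smooth_map_on_base: "smooth_map_on M base"
  unfolding smooth_map_on_def
proof
  fix z assume z: "z \<in> M"
  obtain U where "open U" "z \<in> U" "\<exists>F. smooth_on F U \<and> (\<forall>y\<in>M \<inter> U. F y = base y)"
    by (rule M_chart[OF z]) (rule that)
  then show "\<exists>U F. open U \<and> z \<in> U \<and> smooth_on F U \<and> (\<forall>y\<in>M \<inter> U. F y = base y)" by blast
qed

section \<open>Closedness of the base and of the total space\<close>

lemma continuous_on_shifted_prod: "continuous_on UNIV (\<lambda>q. shifted_prod m (br (fst q)) (snd q))"
proof -
  have "continuous_on UNIV (\<lambda>q. shifted_prod m (br (fst q)) (w q))"
    if "continuous_on UNIV (w :: 'a \<times> 'a \<Rightarrow> 'a)" for w
    using that
  proof (induction m arbitrary: w)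
    case (Cons l m)
    have "bounded_bilinear br" using bilinear_br bilinear_conv_bounded_bilinear by blast
    then have "continuous_on UNIV (\<lambda>q. br (fst q) (w q) - l *\<^sub>R w q)"
      by (intro continuous_on_diff continuous_on_scaleR bounded_bilinear.continuous_on[of br] Cons.prems
          continuous_on_fst continuous_on_id continuous_on_const)
    from Cons.IH[OF this] show ?case by simp
  qed simp
  then show ?thesis by (simp add: continuous_on_snd)
qed

lemma tendsto_shifted_prod:
  assumes "p \<longlonglongrightarrow> q" "x \<longlonglongrightarrow> y"
  shows "(\<lambda>i. shifted_prod m (br (p i)) (x i)) \<longlonglongrightarrow> shifted_prod m (br q) y"
  using continuous_on_tendsto_compose[OF continuous_on_shifted_prod tendsto_Pair[OF assms], of m] by simp

lemma Sig_limit: "(\<And>i. Sig (p i)) \<Longrightarrow> p \<longlonglongrightarrow> q \<Longrightarrow> Sig q"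
  unfolding Sig_def diagonal_def
  using tendsto_shifted_prod[of p q "\<lambda>_. x" x ls for x] LIMSEQ_unique[OF _ tendsto_const] by fastforce

text \<open>A chart of \<open>orbit_chart\<close> exists at the limit \<open>y\<close>, as it asks
  only for \<open>y\<close> in \<open>cartan_s \<theta>\<close> and in \<open>Sig\<close>, both
  closed conditions. A single \<open>p i\<close> in its domain is moved by \<open>K\<close> to
  \<open>y + Y\<close> with \<open>Y\<close> in \<open>n y\<close>, and \<open>Y\<close> must be
  zero.\<close>

lemma closed_Orb: "closed Orb"
  unfolding closed_sequential_limits
proof (intro allI impI, elim conjE)
  fix p y assume p: "\<forall>i. p i \<in> Orb" "p \<longlonglongrightarrow> y"
  have s: "y \<in> cartan_s \<theta>"
    using closed_sequentially[OF closed_subspace[OF subspace_s], of p y] p Orb_s by blast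
  have S: "Sig y" using Sig_limit[of p y] p Orb_Sig by blast
  have 0: "0 \<in> n y" by (rule subspace_0[OF subspace_eigs])
  obtain U V \<Phi> \<Psi> \<kappa> where C: "open U" "y + 0 \<in> U" "open V" "homeomorphism U V \<Phi> \<Psi>"
    "smooth_on \<Phi> U" "smooth_on \<Psi> V" "\<And>x. \<kappa> x \<in> K"
    "\<And>x. E {0} y x = 0 \<Longrightarrow> \<exists>Y\<in>n y. \<Psi> x = blinfun_apply (\<kappa> x) (y + Y)"
    "\<And>v. smooth_on (\<lambda>x. blinfun_apply (\<kappa> x) v) UNIV"
    "\<And>x. x \<in> V \<Longrightarrow> Sig (\<Psi> x) \<Longrightarrow> E {0} y x = 0"
    by (rule orbit_chart[OF s S 0]) (rule that)
  have "eventually (\<lambda>i. p i \<in> U) sequentially"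
    using p(2) C(1,2) topological_tendstoD by force
  then obtain i where i: "p i \<in> U" by (meson eventually_sequentially order_refl)
  have Phi: "\<Phi> (p i) \<in> V" "\<Psi> (\<Phi> (p i)) = p i" using C(4) i by (auto simp: homeomorphism_def)
  have "E {0} y (\<Phi> (p i)) = 0"
    by (rule C(10)[OF Phi(1)]) (use Phi(2) p(1) Orb_Sig in simp)
  then obtain Y where Y: "Y \<in> n y" "p i = blinfun_apply (\<kappa> (\<Phi> (p i))) (y + Y)"
    using C(8) Phi(2) by metis
  let ?k = "\<kappa> (\<Phi> (p i))"
  obtain h where h: "h \<in> K" "\<And>x. h (?k x) = x" by (rule K_inverse[OF C(7)[of "\<Phi> (p i)"]]) (rule that)
  have hp: "h (p i) = y + Y" using Y(2) h(2) by metis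
  have "y + Y \<in> cartan_s \<theta>" unfolding hp[symmetric] by (rule K_s[OF h(1) Orb_s]) (use p in blast)
  then have "Y \<in> cartan_s \<theta>" using subspace_diff[OF subspace_s _ s, of "y + Y"] by simp
  then have "\<theta> Y = - Y" by (simp add: cartan_s_def)
  \<comment> \<open>\<open>\<theta>\<close> maps positive to negative eigenspaces, but here only
    changes the sign of \<open>Y\<close>; so \<open>Y\<close> lies in both.\<close>
  moreover have "\<theta> Y \<in> eigs (br y) {..<0}" by (rule eigs_theta[OF s Y(1)]) simp
  ultimately have "Y \<in> eigs (br y) {..<0}" using subspace_neg[OF subspace_eigs, of "- Y"] by simp
  then have "Y = 0" using Y(1) diagonal_map.eigs_disjoint[OF diagonal_map[OF S]] by force
  then have "h (p i) = y" using hp by simp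
  then show "y \<in> Orb" using K_Orb[OF h(1), of "p i"] p(1) by simp
qed

text \<open>\<open>K\<close> preserves \<open>Q\<close>, and \<open>B\<close>, the minimum of
  \<open>Q\<close> on the unit sphere, compares \<open>Q\<close> with the ambient norm.\<close>

lemma bounded_Orb: "bounded Orb"
proof -
  obtain B where B: "B > 0" "\<And>x. B * (norm x)\<^sup>2 \<le> Q x x"
  proof -
    have cont: "continuous_on (sphere 0 1) (\<lambda>x. Q x x)" by (intro continuous_on_Q continuous_on_id)
    obtain b :: 'a where "b \<in> Basis" using nonempty_Basis by blast
    then have "sphere 0 1 \<noteq> ({} :: 'a set)" using norm_Basis by fastforce
    then obtain u where u: "u \<in> sphere 0 1" "\<And>x. x \<in> sphere 0 1 \<Longrightarrow> Q u u \<le> Q x x"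
      using continuous_attains_inf[OF compact_sphere _ cont] by blast
    have "Q u u * (norm x)\<^sup>2 \<le> Q x x" for x
    proof (cases "x = 0")
      case False
      then have "Q u u \<le> Q (x /\<^sub>R norm x) (x /\<^sub>R norm x)" by (intro u(2)) simp
      also have "\<dots> = Q x x / (norm x)\<^sup>2" by (simp add: Q_simps power2_eq_square divide_simps)
      finally show ?thesis using False by (simp add: field_simps)
    qed (simp add: Q_simps)
    moreover have "Q u u > 0" using u(1) by (intro pos) auto
    ultimately show ?thesis using that by blast
  qed
  have "norm p \<le> sqrt (Q H H / B)" if "p \<in> Orb" for p
  proof (rule real_le_rsqrt)
    have "Q p p = Q H H" using that K_Q by (auto simp: Orb_def)
    then show "(norm p)\<^sup>2 \<le> Q H H / B" using B(2)[of p] B(1) by (simp add: field_simps)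
  qed
  then show ?thesis unfolding bounded_iff by blast
qed

text \<open>Compactness of \<open>Orb\<close> provides a convergent subsequence of base points; the
  fibre condition passes to the limit in the polynomial form of \<open>n_iff\<close>.\<close>

lemma closed_M: "closed M"
  unfolding closed_sequential_limits
proof (intro allI impI, elim conjE)
  fix z w assume z: "\<forall>i. z i \<in> M" "z \<longlonglongrightarrow> w"
  have "compact Orb" using closed_Orb bounded_Orb by (simp add: compact_eq_bounded_closed)
  moreover have "\<forall>i. base (z i) \<in> Orb" using base_M z by blast
  ultimately obtain p r where p: "p \<in> Orb" "strict_mono r" "((\<lambda>i. base (z i)) \<circ> r) \<longlonglongrightarrow> p"
    unfolding compact_def by metis
  have zr: "(z \<circ> r) \<longlonglongrightarrow> w" using z(2) p(2) LIMSEQ_subseq_LIMSEQ by blast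
  let ?m = "filter (\<lambda>l. 0 < l) ls"
  have "(\<lambda>i. shifted_prod ?m (br (base (z (r i)))) (z (r i) - base (z (r i)))) \<longlonglongrightarrow> shifted_prod ?m (br p) (w - p)"
    using p(3) tendsto_diff[OF zr p(3)] by (intro tendsto_shifted_prod) (simp_all add: o_def)
  moreover have "shifted_prod ?m (br (base (z i))) (z i - base (z i)) = 0" for i
    using base_M z(1) n_iff Orb_Sig by blast
  ultimately have "shifted_prod ?m (br p) (w - p) = 0"
    using LIMSEQ_unique[OF _ tendsto_const] by auto
  then have "w - p \<in> n p" using n_iff Orb_Sig p(1) by blast
  then show "w \<in> M" using MI[OF p(1)] by force
qed

theorem adj_orbit_eq: "adj_orbit br H = M"
proof
  have sub: "adj_orbit br H = (\<lambda>g. blinfun_apply g H) ` lie_Aut0 br" by (auto simp: adj_orbit_def)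
  show "M \<subseteq> adj_orbit br H"
  proof
    fix z assume "z \<in> M"
    then obtain p Y where pY: "p \<in> Orb" "Y \<in> n p" "z = p + Y" by (auto simp: M_def)
    obtain k where k: "k \<in> K" "p = k H" using pY(1) by (auto simp: Orb_def)
    obtain g where g: "g \<in> lie_Aut0 br" "p + Y = g p" using add_n_in_orbit[OF Orb_Sig[OF pY(1)] pY(2)] by blast
    have "z = (g o\<^sub>L k) H" using g k pY by simp
    then show "z \<in> adj_orbit br H"
      unfolding sub using lie_Aut0_compose[OF g(1) analytic_subgroup_lie_Aut0[OF k(1)]] by blast
  qed
  have con: "connected (adj_orbit br H)"
    unfolding sub by (intro connected_continuous_image connected_lie_Aut0 linear_continuous_on
        blinfun.bounded_linear_left)
  have HM: "H \<in> M" using MI[OF H_Orb subspace_0[OF subspace_eigs]] by simp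
  have HG: "H \<in> adj_orbit br H" unfolding sub using id_lie_Aut0 by (intro image_eqI[of _ _ id_blinfun]) auto
  have Sig: "Sig y" if "y \<in> adj_orbit br H" for y
    using that Sig_hom[OF _ H_Sig] lie_Aut0_subset unfolding sub by blast
  have "\<exists>T. open T \<and> z \<in> T \<and> adj_orbit br H \<inter> T \<subseteq> M" if z: "z \<in> M" for z
  proof -
    obtain U where "open U" "z \<in> U" "\<And>y. y \<in> U \<Longrightarrow> Sig y \<Longrightarrow> y \<in> M"
      by (rule M_chart[OF z]) (rule that)
    then show ?thesis using Sig by blast
  qed
  then obtain T where T: "\<And>z. z \<in> M \<Longrightarrow> open (T z) \<and> z \<in> T z \<and> adj_orbit br H \<inter> T z \<subseteq> M" by metis
  have "openin (top_of_set (adj_orbit br H)) (adj_orbit br H \<inter> M)"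
  proof -
    have "adj_orbit br H \<inter> M = adj_orbit br H \<inter> (\<Union>z\<in>M. T z)" using T by blast
    moreover have "open (\<Union>z\<in>M. T z)" using T by blast
    ultimately show ?thesis by (metis openin_open_Int)
  qed
  moreover have "closedin (top_of_set (adj_orbit br H)) (adj_orbit br H \<inter> M)"
    by (rule closedin_closed_Int[OF closed_M])
  ultimately have "adj_orbit br H \<inter> M = adj_orbit br H"
    using con HM HG unfolding connected_clopen by blast
  then show "adj_orbit br H \<subseteq> M" by blast
qed

end

section \<open>The limit orbit\<close>

context cartan_orbit
begin

definition kp :: "'a \<Rightarrow> 'a" where "kp x = (1/2) *\<^sub>R (x + \<theta> x)"

definition sp :: "'a \<Rightarrow> 'a" where "sp x = (1/2) *\<^sub>R (x - \<theta> x)"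

lemma linear_kp: "linear kp" and linear_sp: "linear sp"
  by (auto intro!: linearI simp: kp_def sp_def theta_simps algebra_simps)

lemmas kp_simps = linear_add[OF linear_kp] linear_diff[OF linear_kp] linear_0[OF linear_kp] linear_neg[OF linear_kp]
  linear_cmul[OF linear_kp]
lemmas sp_simps = linear_add[OF linear_sp] linear_diff[OF linear_sp] linear_0[OF linear_sp] linear_neg[OF linear_sp]
  linear_cmul[OF linear_sp]

lemma kp_add_sp: "sp x + kp x = x"
  by (simp add: kp_def sp_def flip: scaleR_add_right)

lemma kp_k: "kp x \<in> cartan_k \<theta>" and sp_s: "sp x \<in> cartan_s \<theta>"
  by (simp_all add: kp_def sp_def cartan_k_def cartan_s_def theta_simps add.commute flip: scaleR_minus_right)

lemma kp_on_k: "x \<in> cartan_k \<theta> \<Longrightarrow> kp x = x" and sp_on_k: "x \<in> cartan_k \<theta> \<Longrightarrow> sp x = 0"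
  and kp_on_s: "x \<in> cartan_s \<theta> \<Longrightarrow> kp x = 0" and sp_on_s: "x \<in> cartan_s \<theta> \<Longrightarrow> sp x = x"
  by (simp_all add: kp_def sp_def cartan_k_def cartan_s_def flip: scaleR_2)

lemmas part_simps = kp_on_k[OF kp_k] sp_on_k[OF kp_k] kp_on_s[OF sp_s] sp_on_s[OF sp_s]

lemma K_kp: "k \<in> K \<Longrightarrow> kp (k x) = k (kp x)" and K_sp: "k \<in> K \<Longrightarrow> sp (k x) = k (sp x)"
  by (simp_all add: kp_def sp_def K_theta blinfun.scaleR_right blinfun.add_right blinfun.diff_right)

lemma br_k: "x \<in> cartan_k \<theta> \<Longrightarrow> y \<in> cartan_k \<theta> \<Longrightarrow> br x y \<in> cartan_k \<theta>"
  by (simp add: cartan_k_def theta_br)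

lemma E0_parts:
  assumes "p \<in> cartan_s \<theta>" "Sig p"
  shows "kp (E {0} p x) = E {0} p (kp x)" "sp (E {0} p x) = E {0} p (sp x)"
proof -
  have lin: "linear (E {0} p)" by (rule linear_fcalc[OF linear_br])
  have "\<theta> (E {0} p x) = E {0} p (\<theta> x)" using E_theta[OF assms, of "{0}"] by simp
  then show "kp (E {0} p x) = E {0} p (kp x)" "sp (E {0} p x) = E {0} p (sp x)"
    by (simp_all add: kp_def sp_def linear_add[OF lin] linear_diff[OF lin] linear_cmul[OF lin])
qed

text \<open>The limit orbit by equations: the image of \<open>n p\<close> under
  \<open>\<psi>\<close> consists of the vectors of \<open>cartan_k \<theta>\<close> without
  component in the kernel of \<open>ad p\<close>. The identification is made in
  \<open>limit_orbit_eq\<close>.\<close>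

definition Minf :: "'a set" where "Minf = {w. sp w \<in> Orb \<and> E {0} (sp w) (kp w) = 0}"

definition unpsi :: "'a \<Rightarrow> 'a" where "unpsi w = sp w + E {0<..} (sp w) (kp w)"

lemma psi_parts:
  assumes "p \<in> cartan_s \<theta>" shows "sp (p + psi \<theta> Y) = p" "kp (p + psi \<theta> Y) = psi \<theta> Y"
proof -
  have "psi \<theta> Y \<in> cartan_k \<theta>" by (simp add: psi_def cartan_k_def theta_simps add.commute)
  then show "sp (p + psi \<theta> Y) = p" "kp (p + psi \<theta> Y) = psi \<theta> Y"
    using assms by (simp_all add: kp_simps sp_simps kp_on_k sp_on_k kp_on_s sp_on_s)
qed

lemma E_psi:
  assumes "p \<in> cartan_s \<theta>" "Sig p" "Y \<in> n p"
  shows "E {0} p (psi \<theta> Y) = 0" "E {0<..} p (psi \<theta> Y) = Y"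
proof -
  interpret d: diagonal_map "br p" ls by (rule diagonal_map[OF assms(2)])
  have t: "\<theta> Y \<in> eigs (br p) {..<0}" by (rule eigs_theta[OF assms(1,3)]) simp
  have "E {0} p Y = 0" "E {0<..} p Y = Y" "E {0} p (\<theta> Y) = 0" "E {0<..} p (\<theta> Y) = 0"
    by (rule d.fcalc_eigs_0[OF assms(3)] d.fcalc_eigs_1[OF assms(3)] d.fcalc_eigs_0[OF t];
        auto simp: indicator_def)+
  then show "E {0} p (psi \<theta> Y) = 0" "E {0<..} p (psi \<theta> Y) = Y"
    by (simp_all add: psi_def linear_add[OF linear_fcalc[OF linear_br]])
qed

lemma MinfI: "p \<in> Orb \<Longrightarrow> Y \<in> n p \<Longrightarrow> p + psi \<theta> Y \<in> Minf"
  using psi_parts[OF Orb_s] E_psi(1)[OF Orb_s Orb_Sig] by (simp add: Minf_def)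

lemma unpsi_psi: "p \<in> Orb \<Longrightarrow> Y \<in> n p \<Longrightarrow> unpsi (p + psi \<theta> Y) = p + Y"
  using psi_parts[OF Orb_s] E_psi(2)[OF Orb_s Orb_Sig] by (simp add: unpsi_def)

text \<open>A vector fixed by \<open>\<theta>\<close> has its negative part equal to
  \<open>\<theta>\<close> of its positive part. If the zero part vanishes, it is therefore
  \<open>\<psi>\<close> of the positive part.\<close>

lemma MinfE:
  assumes "w \<in> Minf" obtains p Y where "p \<in> Orb" "Y \<in> n p" "w = p + psi \<theta> Y"
proof (rule that)
  let ?p = "sp w"
  have p: "?p \<in> Orb" "E {0} ?p (kp w) = 0" using assms by (auto simp: Minf_def)
  interpret d: diagonal_map "br ?p" ls by (rule diagonal_map[OF Orb_Sig[OF p(1)]])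
  show "?p \<in> Orb" by (rule p)
  show "E {0<..} ?p (kp w) \<in> n ?p" by (rule d.fcalc_in_eigs) simp
  have "uminus ` {0<..} = {..<0::real}" by (auto simp: image_iff intro!: exI[of _ "- x" for x])
  moreover have "\<theta> (kp w) = kp w" using kp_k by (simp add: cartan_k_def)
  ultimately have "psi \<theta> (E {0<..} ?p (kp w)) = E {0<..} ?p (kp w) + E {..<0} ?p (kp w) + E {0} ?p (kp w)"
    using E_theta[OF sp_s Orb_Sig[OF p(1)], of "{0<..}" "kp w"] by (simp add: psi_def p(2))
  also have "\<dots> = fcalc ls (br ?p) (\<lambda>_. 1) (kp w)"
    unfolding d.fcalc_add by (rule d.fcalc_cong_eigs[OF d.eigs_all]) (auto simp: indicator_def)
  finally show "w = ?p + psi \<theta> (E {0<..} ?p (kp w))" by (simp add: d.fcalc_1 kp_add_sp)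
qed

lemma smooth_on_shifted_prod:
  assumes "smooth_on u (UNIV :: 'a set)" "smooth_on v UNIV"
  shows "smooth_on (\<lambda>w. shifted_prod m (br (u w)) (v w)) UNIV"
  using assms(2)
proof (induction m arbitrary: v)
  case (Cons l m)
  have "smooth_on (\<lambda>w. br (u w) (v w) - l *\<^sub>R v w) UNIV"
    by (intro smooth_on_diff smooth_on_bilinear[OF _ bilinear_br] smooth_on_cmul assms(1) Cons.prems open_UNIV)
  from Cons.IH[OF this] show ?case by simp
qed simp

lemma smooth_on_unpsi: "smooth_on unpsi UNIV"
  unfolding unpsi_def fcalc_def
  by (intro smooth_on_add smooth_on_sum smooth_on_cmul smooth_on_shifted_prod smooth_on_linear
      linear_kp linear_sp) auto

text \<open>The derivative is triangular for the two components: on the part in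
  \<open>cartan_s \<theta>\<close> it is the identity, since \<open>br (l x) Z\<close> stays in
  \<open>cartan_k \<theta>\<close>; once that part vanishes, \<open>l x = 0\<close> and
  \<open>kp x\<close> remains.\<close>

lemma limit_chart:
  assumes w: "w \<in> Minf"
  obtains U V \<Phi> \<Psi> where "open U" "w \<in> U" "open V" "homeomorphism U V \<Phi> \<Psi>"
    "smooth_on \<Phi> U" "smooth_on \<Psi> V" "\<Phi> ` (Minf \<inter> U) = {x. E {0} (sp w) x = 0} \<inter> V"
proof -
  define p where "p = sp w"
  define Z where "Z = kp w"
  have p: "p \<in> Orb" "p \<in> cartan_s \<theta>" "Sig p" and EZ: "E {0} p Z = 0"
    using w Orb_Sig sp_s by (auto simp: Minf_def p_def Z_def)
  have Zk: "Z \<in> cartan_k \<theta>" unfolding Z_def by (rule kp_k)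
  interpret d: diagonal_map "br p" ls by (rule diagonal_map[OF p(3)])
  obtain \<delta> where \<delta>: "\<delta> > 0"
    "\<And>p C Y. Sig p \<Longrightarrow> br p C = 0 \<Longrightarrow> Y \<in> n p \<Longrightarrow> Sig (p + C + Y) \<Longrightarrow> norm C < \<delta> \<Longrightarrow> C = 0"
    using Sig_isolated by blast
  have lF: "linear (fcalc ls (br p) h)" for h by (rule linear_fcalc[OF linear_br])
  \<comment> \<open>The inverse of \<open>ad p\<close> off its kernel. As \<open>1 / 0 = 0\<close>,
    it vanishes on the kernel, and \<open>c * (1 / c)\<close> is the indicator of the nonzero
    eigenvalues.\<close>
  let ?F = "fcalc ls (br p) (\<lambda>c. 1 / c)"
  let ?E = "E {0} p"
  \<comment> \<open>With this choice \<open>br (l x) p\<close> is \<open>sp x\<close> without its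
    zero part. The map \<open>m\<close> supplies that zero part together with \<open>kp x\<close>,
    and is written so that \<open>?E x\<close> appears as the coordinate transverse to the
    slice.\<close>
  define l where "l x = - ?F (sp x)" for x
  define m where "m x = kp x - ?E (kp x) + ?E x" for x
  define W where "W = {x. norm (?E (sp x)) < \<delta>}"
  have linl: "linear l" unfolding l_def
    using linear_compose[OF linear_sp lF] by (intro linear_compose_neg) (simp add: o_def)
  have lk: "l x \<in> cartan_k \<theta>" for x
  proof -
    have "\<theta> (?F (sp x)) = fcalc ls (br p) (\<lambda>c. 1 / (- c)) (\<theta> (sp x))" by (rule fcalc_theta[OF p(2,3)])
    also have "\<theta> (sp x) = - sp x" using sp_s by (simp add: cartan_s_def)
    also have "fcalc ls (br p) (\<lambda>c. 1 / (- c)) (- sp x) = - ?F (- sp x)"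
      by (simp add: fcalc_def sum_negf)
    also have "\<dots> = ?F (sp x)" by (simp only: linear_neg[OF lF] minus_minus)
    finally show ?thesis by (simp add: l_def cartan_k_def theta_simps)
  qed
  have linm: "linear m" unfolding m_def
    using linear_compose[OF linear_kp lF] by (intro linear_compose_add linear_compose_sub linear_kp lF) (simp add: o_def)
  have brl: "br (l x) p = sp x - ?E (sp x)" for x
  proof -
    have "br (l x) p = br p (?F (sp x))" by (subst br_anti) (simp add: l_def br_simps)
    also have "\<dots> = fcalc ls (br p) (\<lambda>c. c * (1 / c)) (sp x)"
      by (subst d.fcalc_ident[symmetric]) (rule d.fcalc_fcalc)
    finally have "br (l x) p + ?E (sp x) = fcalc ls (br p) (\<lambda>c. c * (1 / c) + indicator {0} c) (sp x)"
      by (simp only: d.fcalc_add)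
    also have "\<dots> = fcalc ls (br p) (\<lambda>_. 1) (sp x)"
      by (rule d.fcalc_cong_eigs[OF d.eigs_all]) (auto simp: indicator_def)
    finally show ?thesis by (simp add: d.fcalc_1 algebra_simps)
  qed
  have spm: "sp (m x) = ?E (sp x)" and kpm: "kp (m x) = kp x" for x
    by (simp_all add: m_def sp_simps kp_simps E0_parts[OF p(2,3)] part_simps linear_0[OF lF])
  have inj: "x = 0" if x: "br (l x) (p + Z) + m x = 0" for x
  proof -
    have "sp (br (l x) (p + Z) + m x) = sp x"
      using sp_on_k[OF br_k[OF lk Zk], of x]
      by (simp add: br_simps sp_simps brl spm E0_parts[OF p(2,3)] part_simps)
    then have s0: "sp x = 0" using x by (simp add: sp_simps)
    then have "l x = 0" by (simp add: l_def linear_0[OF lF])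
    then have "kp x = 0" using x kpm[of x] by (simp add: br_simps kp_simps)
    then show "x = 0" using s0 kp_add_sp[of x] by simp
  qed
  have EE: "?E (?E x) = ?E x" for x
    unfolding d.fcalc_fcalc by (rule d.fcalc_cong_eigs[OF d.eigs_all]) (auto simp: indicator_def)
  have E0: "br p (?E x) = 0" for x
    using eigs_singleton[OF linear_br d.fcalc_in_eigs[of "{0}" "indicator {0}"], of x] by simp
  have "linear (\<lambda>x. ?E (sp x))" using linear_compose[OF linear_sp lF] by (simp add: o_def)
  then have "continuous_on UNIV (\<lambda>x. ?E (sp x))"
    by (intro linear_continuous_on) (simp add: linear_linear)
  from open_Collect_less[OF continuous_on_norm[OF this] continuous_on_const] \<delta>(1)
  have W: "open W" "0 \<in> W" by (simp_all add: W_def linear_0[OF lF] sp_simps)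
  obtain U V \<Phi> \<Psi> \<kappa> where C: "open U" "p + Z \<in> U" "open V" "V \<subseteq> W" "homeomorphism U V \<Phi> \<Psi>"
    "smooth_on \<Phi> U" "smooth_on \<Psi> V" "\<And>x. \<kappa> x \<in> K" "\<And>x. \<Psi> x = blinfun_apply (\<kappa> x) (p + Z + m x)"
    "\<And>v. smooth_on (\<lambda>x. blinfun_apply (\<kappa> x) v) UNIV"
    by (rule K_chart[OF linl lk linm inj W], assumption) (rule that)
  have K_Minf: "k x \<in> Minf \<longleftrightarrow> x \<in> Minf" if k: "k \<in> K" for k x
  proof -
    have "E {0} (sp (k x)) (kp (k x)) = k (E {0} (sp x) (kp x))"
      by (simp add: K_sp[OF k] K_kp[OF k] fcalc_hom[OF K_lie_Aut[OF k]])
    moreover have "k y = 0 \<longleftrightarrow> y = 0" for y using K_inverse[OF k] by (metis blinfun.zero_right)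
    ultimately show ?thesis by (simp add: Minf_def K_sp[OF k] K_Orb_iff[OF k])
  qed
  have sp_base: "sp (p + Z + m x) = p + ?E (sp x)" and kp_base: "kp (p + Z + m x) = Z + kp x" for x
    using p(2) Zk by (simp_all add: sp_simps kp_simps spm kpm sp_on_s kp_on_s sp_on_k kp_on_k)
  \<comment> \<open>First the component in \<open>cartan_s \<theta>\<close>, which lies in
    \<open>Orb\<close> and so in \<open>Sig\<close>, forces \<open>?E (sp x) = 0\<close> by
    isolation of the spectrum. The base point of the moved vector is then \<open>p\<close> itself,
    and the equation of the fibre becomes linear in \<open>kp x\<close>.\<close>
  have fwd: "?E x = 0" if x: "x \<in> V" "\<Psi> x \<in> Minf" for x
  proof -
    have T: "p + Z + m x \<in> Minf" using x(2) K_Minf[OF C(8)] by (simp add: C(9))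
    have "Sig (p + ?E (sp x) + 0)" using T Orb_Sig by (simp add: Minf_def sp_base)
    moreover have "norm (?E (sp x)) < \<delta>" using x(1) C(4) by (auto simp: W_def)
    ultimately have s0: "?E (sp x) = 0" using \<delta>(2)[OF p(3) E0 subspace_0[OF subspace_eigs]] by blast
    then have "?E (Z + kp x) = 0" using T by (simp add: Minf_def sp_base kp_base)
    then have "?E (kp x) = 0" by (simp add: linear_add[OF lF] EZ)
    then show "?E x = 0" using s0 linear_add[OF lF, of "indicator {0}" "sp x" "kp x"] by (simp add: kp_add_sp)
  qed
  have bwd: "\<Psi> x \<in> Minf" if x: "?E x = 0" for x
  proof -
    have "?E (sp x) = 0" "?E (kp x) = 0"
      using E0_parts[OF p(2,3), of x] x by (simp_all add: sp_simps kp_simps)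
    then show ?thesis
      unfolding C(9) K_Minf[OF C(8)] by (simp add: Minf_def sp_base kp_base p(1) linear_add[OF lF] EZ)
  qed
  have hom: "\<Phi> y \<in> V" "\<Psi> (\<Phi> y) = y" if "y \<in> U" for y
    using C(5) that by (auto simp: homeomorphism_def)
  have hom': "\<Psi> x \<in> U" "\<Phi> (\<Psi> x) = x" if "x \<in> V" for x
    using C(5) that by (auto simp: homeomorphism_def)
  show ?thesis
  proof (rule that[OF C(1) _ C(3,5,6,7)])
    show "w \<in> U" using C(2) by (simp add: p_def Z_def kp_add_sp)
    show "\<Phi> ` (Minf \<inter> U) = {x. E {0} (sp w) x = 0} \<inter> V"
      unfolding p_def[symmetric]
    proof
      show "\<Phi> ` (Minf \<inter> U) \<subseteq> {x. ?E x = 0} \<inter> V" using fwd hom by auto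
      show "{x. ?E x = 0} \<inter> V \<subseteq> \<Phi> ` (Minf \<inter> U)"
      proof
        fix x assume "x \<in> {x. ?E x = 0} \<inter> V"
        then show "x \<in> \<Phi> ` (Minf \<inter> U)"
          using bwd[of x] hom'[of x] by (intro image_eqI[of x \<Phi> "\<Psi> x"]) auto
      qed
    qed
  qed
qed

lemma submanifold_Minf: "submanifold (dim {x. E {0} H x = 0}) Minf"
  unfolding submanifold_def
proof
  fix w assume w: "w \<in> Minf"
  obtain U V \<Phi> \<Psi> where C: "open U" "w \<in> U" "open V" "homeomorphism U V \<Phi> \<Psi>"
    "smooth_on \<Phi> U" "smooth_on \<Psi> V" "\<Phi> ` (Minf \<inter> U) = {x. E {0} (sp w) x = 0} \<inter> V"
    by (rule limit_chart[OF w]) (rule that)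
  have "sp w \<in> Orb" using w by (simp add: Minf_def)
  note dim = dim_E_kernel[OF this]
  show "\<exists>U V (\<phi> :: 'a \<Rightarrow> 'a) \<phi>' L. open U \<and> w \<in> U \<and> open V \<and> homeomorphism U V \<phi> \<phi>' \<and>
      smooth_on \<phi> U \<and> smooth_on \<phi>' V \<and> subspace L \<and> dim L = dim {x. E {0} H x = 0} \<and> \<phi> ` (Minf \<inter> U) = L \<inter> V"
    using C dim subspace_E_kernel by blast
qed

end

section \<open>Diffeomorphisms\<close>

lemma smooth_on_imp_smooth_map_on: "smooth_on F UNIV \<Longrightarrow> smooth_map_on S F"
  unfolding smooth_map_on_def by (metis UNIV_I open_UNIV)

lemma smooth_map_onE:
  assumes "smooth_map_on S f" "p \<in> S"
  obtains U F where "open U" "p \<in> U" "smooth_on F U" "\<And>x. x \<in> S \<Longrightarrow> x \<in> U \<Longrightarrow> F x = f x"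
proof -
  have "\<exists>U F. open U \<and> p \<in> U \<and> smooth_on F U \<and> (\<forall>x\<in>S \<inter> U. F x = f x)"
    using assms by (simp add: smooth_map_on_def)
  then obtain U where "\<exists>F. open U \<and> p \<in> U \<and> smooth_on F U \<and> (\<forall>x\<in>S \<inter> U. F x = f x)" ..
  then obtain F where UF: "open U \<and> p \<in> U \<and> smooth_on F U \<and> (\<forall>x\<in>S \<inter> U. F x = f x)" ..
  show ?thesis by (rule that[of U F]) (use UF in auto)
qed

lemma smooth_map_on_cong_imp:
  assumes "\<And>x. x \<in> S \<Longrightarrow> f x = g x" "smooth_map_on S f" shows "smooth_map_on S g"
  using assms unfolding smooth_map_on_def by (metis IntD1)

lemma smooth_map_on_compose:
  assumes f: "smooth_map_on S f" and g: "smooth_map_on T g" and "f ` S \<subseteq> T"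
  shows "smooth_map_on S (\<lambda>x. g (f x))"
  unfolding smooth_map_on_def
proof
  fix p assume p: "p \<in> S"
  obtain U F where F: "open U" "p \<in> U" "smooth_on F U" "\<And>x. x \<in> S \<Longrightarrow> x \<in> U \<Longrightarrow> F x = f x"
    by (rule smooth_map_onE[OF f p], rule that)
  have "f p \<in> T" using assms(3) p by blast
  obtain V G where G: "open V" "f p \<in> V" "smooth_on G V" "\<And>x. x \<in> T \<Longrightarrow> x \<in> V \<Longrightarrow> G x = g x"
    by (rule smooth_map_onE[OF g \<open>f p \<in> T\<close>], rule that)
  let ?W = "U \<inter> F -` V"
  have W: "open ?W"
    using continuous_open_preimage[OF smooth_on_imp_continuous[OF F(3)] F(1) G(1)] .
  have "smooth_on (\<lambda>x. G (F x)) ?W"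
    by (rule smooth_on_compose[OF W G(1) _ G(3) smooth_on_subset[OF F(3)]]) auto
  moreover have "p \<in> ?W" using F G p by auto
  moreover have "\<forall>x\<in>S \<inter> ?W. G (F x) = g (f x)" using F(4) G(4) assms(3) by (auto simp: image_subset_iff)
  ultimately show "\<exists>U F. open U \<and> p \<in> U \<and> smooth_on F U \<and> (\<forall>x\<in>S \<inter> U. F x = g (f x))"
    using W by (intro exI[of _ ?W] exI[of _ "\<lambda>x. G (F x)"]) simp
qed

lemma smooth_map_on_add:
  assumes "smooth_map_on S f" "smooth_map_on S g" shows "smooth_map_on S (\<lambda>x. f x + g x)"
  unfolding smooth_map_on_def
proof
  fix p assume p: "p \<in> S"
  obtain U F where F: "open U" "p \<in> U" "smooth_on F U" "\<And>x. x \<in> S \<Longrightarrow> x \<in> U \<Longrightarrow> F x = f x"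
    by (rule smooth_map_onE[OF assms(1) p], rule that)
  obtain V G where G: "open V" "p \<in> V" "smooth_on G V" "\<And>x. x \<in> S \<Longrightarrow> x \<in> V \<Longrightarrow> G x = g x"
    by (rule smooth_map_onE[OF assms(2) p], rule that)
  have "smooth_on (\<lambda>x. F x + G x) (U \<inter> V)"
    using smooth_on_subset[OF F(3)] smooth_on_subset[OF G(3)] F(1) G(1) by (intro smooth_on_add) auto
  then show "\<exists>U F. open U \<and> p \<in> U \<and> smooth_on F U \<and> (\<forall>x\<in>S \<inter> U. F x = f x + g x)"
    using F G by (intro exI[of _ "U \<inter> V"] exI[of _ "\<lambda>x. F x + G x"]) auto
qed

lemma smooth_map_on_linear: "linear l \<Longrightarrow> smooth_map_on S l"
  by (intro smooth_on_imp_smooth_map_on smooth_on_linear open_UNIV)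

lemma smooth_map_on_linear_comp: "linear l \<Longrightarrow> smooth_map_on S f \<Longrightarrow> smooth_map_on S (\<lambda>x. l (f x))"
  using smooth_map_on_compose[OF _ smooth_map_on_linear[of l UNIV]] by blast

lemma diffeomorphismI:
  assumes "submanifold d M" "submanifold e N" "smooth_map_on M f" "smooth_map_on N g"
    "\<And>x. x \<in> M \<Longrightarrow> f x \<in> N" "\<And>y. y \<in> N \<Longrightarrow> g y \<in> M"
    "\<And>x. x \<in> M \<Longrightarrow> g (f x) = x" "\<And>y. y \<in> N \<Longrightarrow> f (g y) = y"
  shows "diffeomorphism M N f"
proof -
  have bij: "bij_betw f M N" by (rule bij_betw_byWitness[where f'=g]) (use assms in auto)
  have "g y = inv_into M f y" if "y \<in> N" for y
    using bij that assms(6,8) by (metis bij_betw_def inv_into_f_f)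
  then have "smooth_map_on N (inv_into M f)" using smooth_map_on_cong_imp assms(4) by metis
  then show ?thesis using bij assms(1-3) unfolding diffeomorphism_def by blast
qed

lemma diffeomorphism_compose_inv:
  assumes f: "diffeomorphism M N f" and g: "diffeomorphism M P g"
  shows "diffeomorphism N P (g \<circ> inv_into M f)"
proof -
  have F: "f ` M = N" "inj_on f M" "smooth_map_on M f" "smooth_map_on N (inv_into M f)"
    and G: "g ` M = P" "inj_on g M" "smooth_map_on M g" "smooth_map_on P (inv_into M g)"
    using f g by (auto simp: diffeomorphism_def bij_betw_def)
  obtain d e where de: "submanifold d N" "submanifold e P" using f g by (auto simp: diffeomorphism_def)
  have iF: "inv_into M f ` N \<subseteq> M" using F(1) by (auto intro: inv_into_into)
  have iG: "inv_into M g ` P \<subseteq> M" using G(1) by (auto intro: inv_into_into)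
  show ?thesis
  proof (rule diffeomorphismI[OF de, where g="\<lambda>y. f (inv_into M g y)"])
    show "smooth_map_on N (g \<circ> inv_into M f)"
      unfolding o_def by (rule smooth_map_on_compose[OF F(4) G(3) iF])
    show "smooth_map_on P (\<lambda>y. f (inv_into M g y))"
      by (rule smooth_map_on_compose[OF G(4) F(3) iG])
    show "(g \<circ> inv_into M f) x \<in> P" if "x \<in> N" for x using that iF G(1) by auto
    show "f (inv_into M g y) \<in> N" if "y \<in> P" for y using that iG F(1) by auto
    show "f (inv_into M g ((g \<circ> inv_into M f) x)) = x" if "x \<in> N" for x
      using that iF F(1) G(2) by (auto simp: image_subset_iff f_inv_into_f)
    show "(g \<circ> inv_into M f) (f (inv_into M g y)) = y" if "y \<in> P" for y
      using that iG G(1) F(2) by (auto simp: image_subset_iff f_inv_into_f)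
  qed
qed

lemma submanifold_linear_image:
  fixes T :: "'a::euclidean_space \<Rightarrow> 'a"
  assumes "submanifold d M" and T: "linear T" "linear T'" "\<And>x. T' (T x) = x" "\<And>x. T (T' x) = x"
  shows "submanifold d (T ` M)"
  unfolding submanifold_def
proof
  fix q assume "q \<in> T ` M"
  then obtain p where p: "p \<in> M" "q = T p" by blast
  obtain U V L and \<phi> \<phi>' :: "'a \<Rightarrow> 'a" where C: "open U" "p \<in> U" "open V" "homeomorphism U V \<phi> \<phi>'"
    "smooth_on \<phi> U" "smooth_on \<phi>' V" "subspace L" "dim L = d" "\<phi> ` (M \<inter> U) = L \<inter> V"
    using assms(1) p(1) unfolding submanifold_def by (elim ballE[of _ _ p] exE conjE) auto
  have TU: "T ` U = T' -` U" using T(3,4) by (auto simp: image_iff) metis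
  have contT: "continuous_on S T" "continuous_on S T'" for S
    using T by (auto simp: linear_continuous_on linear_linear)
  have op: "open (T ` U)" unfolding TU using open_vimage[OF C(1)] contT by blast
  have "homeomorphism (T ` U) U T' T"
    using contT T(3,4) by (auto simp: homeomorphism_def image_image)
  from homeomorphism_compose[OF this C(4)]
  have hom: "homeomorphism (T ` U) V (\<lambda>x. \<phi> (T' x)) (\<lambda>x. T (\<phi>' x))" by (simp add: o_def)
  have s1: "smooth_on (\<lambda>x. \<phi> (T' x)) (T ` U)"
    by (rule smooth_on_compose[OF op C(1) _ C(5) smooth_on_linear[OF op T(2)]]) (auto simp: T(3))
  have s2: "smooth_on (\<lambda>x. T (\<phi>' x)) V" by (rule smooth_on_linear_comp[OF C(3) T(1) C(6)])
  have "T ` M \<inter> T ` U = T ` (M \<inter> U)" by (rule image_Int[symmetric]) (metis T(3) injI)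
  then have im: "(\<lambda>x. \<phi> (T' x)) ` (T ` M \<inter> T ` U) = L \<inter> V" using C(9) by (simp add: image_image T(3))
  have "q \<in> T ` U" using p C(2) by blast
  then show "\<exists>U V (\<phi> :: 'a \<Rightarrow> 'a) \<phi>' L. open U \<and> q \<in> U \<and> open V \<and> homeomorphism U V \<phi> \<phi>' \<and>
      smooth_on \<phi> U \<and> smooth_on \<phi>' V \<and> subspace L \<and> dim L = d \<and> \<phi> ` (T ` M \<inter> U) = L \<inter> V"
    using op C(3,7,8) hom s1 s2 im
    by - (rule exI[of _ "T ` U"], rule exI[of _ V], rule exI[of _ "\<lambda>x. \<phi> (T' x)"],
        rule exI[of _ "\<lambda>x. T (\<phi>' x)"], rule exI[of _ L], simp)
qed

text \<open>Conjugation by \<open>T\<close> sends \<open>lie_Aut0 br\<close> to a connected set of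
  automorphisms containing the identity. The inclusion is stated for one direction and later applied
  to an isomorphism and to its inverse.\<close>

lemma adj_orbit_image_subset:
  fixes br br' :: "'a::euclidean_space \<Rightarrow> 'a \<Rightarrow> 'a"
  assumes T: "linear T" "linear T'" "\<And>x. T' (T x) = x" "\<And>x. T (T' x) = x"
    and hom: "\<And>x y. T (br x y) = br' (T x) (T y)"
  shows "T ` adj_orbit br X \<subseteq> adj_orbit br' (T X)"
proof -
  define B B' where "B = Blinfun T" and "B' = Blinfun T'"
  have B: "blinfun_apply B = T" "blinfun_apply B' = T'"
    using T by (simp_all add: B_def B'_def bounded_linear_Blinfun_apply linear_linear)
  define c where "c g = B o\<^sub>L g o\<^sub>L B'" for g
  have c: "c g x = T (g (T' x))" for g x by (simp add: c_def B)
  have cont: "continuous_on S c" for S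
    unfolding c_def by (intro bounded_bilinear.continuous_on[OF bounded_bilinear_blinfun_compose]
        continuous_on_const continuous_on_id)
  have Aut: "c g \<in> lie_Aut br'" if g: "g \<in> lie_Aut br" for g
  proof -
    obtain h where h: "h \<in> lie_Aut br" "\<And>x. g (h x) = x" "\<And>x. h (g x) = x"
      by (rule lie_Aut_inverse[OF g], rule that)
    have "bij (blinfun_apply (c g))"
      by (rule o_bij[of "\<lambda>x. T (h (T' x))"]) (auto simp: fun_eq_iff c T h)
    moreover have "c g (br' x y) = br' (c g x) (c g y)" for x y
    proof -
      have "T' (br' x y) = br (T' x) (T' y)"
        using hom[of "T' x" "T' y"] T(3)[of "br (T' x) (T' y)"] by (simp add: T(4))
      then show ?thesis using g by (simp add: c lie_Aut_def hom)
    qed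
    ultimately show ?thesis by (simp add: lie_Aut_def)
  qed
  have "c ` lie_Aut0 br \<subseteq> lie_Aut0 br'"
  proof (rule lie_Aut0_maximal[where g=id_blinfun])
    show "connected (c ` lie_Aut0 br)" by (rule connected_continuous_image[OF cont connected_lie_Aut0])
    show "c ` lie_Aut0 br \<subseteq> lie_Aut br'" using Aut lie_Aut0_subset by blast
    have "c id_blinfun = id_blinfun" by (rule blinfun_eqI) (simp add: c T)
    then show "id_blinfun \<in> c ` lie_Aut0 br" using id_lie_Aut0 by (metis imageI)
  qed (rule id_lie_Aut0)
  then show ?thesis by (force simp: adj_orbit_def c T(3) intro: exI[of _ "c g" for g])
qed

lemma deform_map_inverse:
  assumes "cartan_involution br \<theta>" "r > 0"
  shows "deform_map \<theta> (1 / r) (deform_map \<theta> r Z) = Z"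
proof -
  have lin: "linear \<theta>" and inv: "\<theta> (\<theta> X) = X" for X using assms by (auto simp: cartan_involution_def)
  let ?k = "(Z + \<theta> Z) /\<^sub>R 2" and ?s = "(Z - \<theta> Z) /\<^sub>R 2"
  have k: "\<theta> ?k = ?k" and s: "\<theta> ?s = - ?s"
    by (simp_all add: linear_cmul[OF lin] linear_add[OF lin] linear_diff[OF lin] inv algebra_simps)
  have half: "(x + x) /\<^sub>R 2 = x" for x :: 'a by (simp flip: scaleR_2)
  have d: "deform_map \<theta> t (a + b) = t *\<^sub>R a + b" if "\<theta> a = a" "\<theta> b = - b" for t a b
  proof -
    have "a + b + \<theta> (a + b) = a + a" "a + b - \<theta> (a + b) = b + b"
      by (simp_all add: linear_add[OF lin] that)
    then show ?thesis by (simp only: deform_map_def half)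
  qed
  have "Z = ?k + ?s" using half[of Z] by (simp add: algebra_simps)
  then have "deform_map \<theta> r Z = r *\<^sub>R ?k + ?s" using d[OF k s] by metis
  moreover have "deform_map \<theta> (1 / r) (r *\<^sub>R ?k + ?s) = (1 / r) *\<^sub>R r *\<^sub>R ?k + ?s"
    by (rule d[OF trans[OF linear_cmul[OF lin] arg_cong[OF k, of "(*\<^sub>R) r"]] s])
  ultimately show ?thesis using assms(2) \<open>Z = ?k + ?s\<close> by simp
qed

section \<open>The fibre maps\<close>

context cartan_orbit
begin

text \<open>A global formula for both fibre maps: \<open>c = 1\<close> gives \<open>\<psi>\<close>,
  and \<open>c = (r - 1) / (r + 1)\<close> gives \<open>psi_r\<close>. Its smoothness reduces to
  that of \<open>base\<close>.\<close>

definition fmap :: "real \<Rightarrow> 'a \<Rightarrow> 'a" where "fmap c z = z + c *\<^sub>R \<theta> (z - base z)"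

lemma M_iff: "z \<in> M \<longleftrightarrow> (\<exists>k\<in>K. \<exists>X\<in>n H. z = blinfun_apply k (H + X))"
proof
  assume "z \<in> M"
  then obtain k Y where k: "k \<in> K" "Y \<in> n (k H)" "z = k H + Y" by (auto simp: M_def Orb_def)
  obtain h where h: "h \<in> K" "\<And>x. k (h x) = x" "\<And>x. h (k x) = x" by (rule K_inverse[OF k(1)], rule that)
  have "h Y \<in> n H" using K_eigs[OF h(1) k(2)] by (simp add: h(3))
  then show "\<exists>k\<in>K. \<exists>X\<in>n H. z = blinfun_apply k (H + X)"
    using k by (intro bexI[of _ k] bexI[of _ "h Y"]) (simp_all add: blinfun.add_right h(2))
qed (use K_M H_Orb in auto)

lemma fmap_K:
  assumes "k \<in> K" "X \<in> n H"
  shows "fmap c (k (H + X)) = k (H + (X + c *\<^sub>R \<theta> X))"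
proof -
  have "base (k (H + X)) = k H"
    using base_eq[OF K_Orb[OF assms(1) H_Orb] K_eigs[OF assms]] by (simp add: blinfun.add_right)
  then show ?thesis
    by (simp add: fmap_def blinfun.add_right blinfun.scaleR_right K_theta[OF assms(1)])
qed

text \<open>Independence of the choice of \<open>k\<close> and \<open>X\<close> holds because
  \<open>fmap c z\<close> mentions only \<open>z\<close> and its base point.\<close>

lemma fiber_map_eq:
  assumes f: "\<And>X. f X = X + c *\<^sub>R \<theta> X" and "z \<in> M"
  shows "fiber_map K (n H) H f z = fmap c z"
  unfolding fiber_map_def
proof (rule the_equality)
  show "\<exists>k\<in>K. \<exists>X\<in>n H. z = blinfun_apply k (H + X) \<and> fmap c z = blinfun_apply k (H + f X)"
    using assms(2) fmap_K unfolding M_iff f by blast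
  show "W = fmap c z" if "\<exists>k\<in>K. \<exists>X\<in>n H. z = blinfun_apply k (H + X) \<and> W = blinfun_apply k (H + f X)" for W
    using that fmap_K unfolding f by auto
qed

lemma smooth_map_on_fmap: "smooth_map_on M (fmap c)"
proof -
  have lin: "linear (\<lambda>x. x + c *\<^sub>R \<theta> x)" "linear (\<lambda>x. - (c *\<^sub>R \<theta> x))"
    by (auto intro!: linearI simp: theta_simps algebra_simps)
  have "smooth_map_on M (\<lambda>z. (z + c *\<^sub>R \<theta> z) + - (c *\<^sub>R \<theta> (base z)))"
    by (intro smooth_map_on_add smooth_map_on_linear[OF lin(1)] smooth_map_on_linear_comp[OF lin(2) smooth_map_on_base])
  then show ?thesis
    by (rule smooth_map_on_cong_imp[rotated]) (simp add: fmap_def theta_simps algebra_simps)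
qed

lemma fmap_M: "p \<in> Orb \<Longrightarrow> Y \<in> n p \<Longrightarrow> fmap c (p + Y) = p + (Y + c *\<^sub>R \<theta> Y)"
  by (simp add: fmap_def base_eq)

lemma diffeomorphism_fmap_limit: "diffeomorphism M Minf (fmap 1)"
proof (rule diffeomorphismI[OF submanifold_M submanifold_Minf smooth_map_on_fmap
      smooth_on_imp_smooth_map_on[OF smooth_on_unpsi]])
  have f: "fmap 1 (p + Y) = p + psi \<theta> Y" if "p \<in> Orb" "Y \<in> n p" for p Y
    using fmap_M[OF that, of 1] by (simp add: psi_def)
  show "fmap 1 x \<in> Minf" if "x \<in> M" for x using that MinfI f by (auto simp: M_def)
  show "unpsi (fmap 1 x) = x" if "x \<in> M" for x using that unpsi_psi f by (auto simp: M_def)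
  show "unpsi y \<in> M" if "y \<in> Minf" for y by (rule MinfE[OF that]) (simp add: unpsi_psi MI)
  show "fmap 1 (unpsi y) = y" if "y \<in> Minf" for y by (rule MinfE[OF that]) (simp add: unpsi_psi f)
qed

lemma limit_orbit_eq:
  assumes "n_plus br A H = n H" shows "limit_orbit br \<theta> A H = Minf"
proof -
  have "limit_orbit br \<theta> A H = fmap 1 ` M"
    unfolding limit_orbit_def assms using fmap_K[of _ _ 1]
    by (force simp: image_iff M_iff psi_def)
  then show ?thesis using diffeomorphism_fmap_limit by (simp add: diffeomorphism_def bij_betw_def)
qed

lemma linear_deform_map: "linear (deform_map \<theta> r)"
  by (auto intro!: linearI simp: deform_map_def theta_simps algebra_simps)

context
  fixes r :: real
  assumes r: "r > 0"
begin

lemma deform_inverses: "deform_map \<theta> (1 / r) (deform_map \<theta> r x) = x" "deform_map \<theta> r (deform_map \<theta> (1 / r) x) = x"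
  using deform_map_inverse[OF cartan r] deform_map_inverse[OF cartan, of "1 / r"] r by simp_all

lemma inv_deform_map: "inv (deform_map \<theta> r) = deform_map \<theta> (1 / r)"
  by (rule inv_unique_comp) (simp_all add: fun_eq_iff deform_inverses)

lemma deform_map_s: "x \<in> cartan_s \<theta> \<Longrightarrow> deform_map \<theta> r x = x"
  by (simp add: deform_map_def cartan_s_def flip: scaleR_2)

lemma deform_map_eq: "deform_map \<theta> r ((2 / (r + 1)) *\<^sub>R Y) = psi_r \<theta> r Y"
proof -
  have D: "deform_map \<theta> r Y = ((r + 1) / 2) *\<^sub>R Y + ((r - 1) / 2) *\<^sub>R \<theta> Y"
    by (simp add: deform_map_def algebra_simps add_divide_distrib diff_divide_distrib)
  have "(2 / (r + 1)) * ((r + 1) / 2) = 1" "(2 / (r + 1)) * ((r - 1) / 2) = (r - 1) / (r + 1)"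
    using r by (simp_all add: divide_simps) (simp add: algebra_simps)
  then show ?thesis
    by (simp only: linear_cmul[OF linear_deform_map] D psi_r_def scaleR_add_right scaleR_scaleR scaleR_one)
qed

lemma adj_orbit_deform: "adj_orbit (deform_bracket br \<theta> r) H = deform_map \<theta> r ` M"
proof -
  let ?T = "deform_map \<theta> r" and ?T' = "deform_map \<theta> (1 / r)" and ?b = "deform_bracket br \<theta> r"
  have H: "?T H = H" by (rule deform_map_s[OF H_s])
  then have H': "?T' H = H" using deform_inverses(1)[of H] by simp
  have "?T ` adj_orbit br H \<subseteq> adj_orbit ?b (?T H)"
    by (rule adj_orbit_image_subset[OF linear_deform_map linear_deform_map deform_inverses])
      (simp add: deform_bracket_def inv_deform_map deform_inverses)
  moreover have "?T' ` adj_orbit ?b H \<subseteq> adj_orbit br (?T' H)"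
    by (rule adj_orbit_image_subset[OF linear_deform_map linear_deform_map deform_inverses(2,1)])
      (simp add: deform_bracket_def inv_deform_map deform_inverses)
  then have "?T ` ?T' ` adj_orbit ?b H \<subseteq> ?T ` adj_orbit br H" using H' by auto
  ultimately show ?thesis by (simp add: H image_image deform_inverses adj_orbit_eq)
qed

lemma diffeomorphism_fmap_deform: "diffeomorphism M (deform_map \<theta> r ` M) (fmap ((r - 1) / (r + 1)))"
proof -
  let ?T = "deform_map \<theta> r" and ?T' = "deform_map \<theta> (1 / r)"
  let ?s = "2 / (r + 1)" and ?t = "(r + 1) / 2"
  \<comment> \<open>Scaling of the fibres by \<open>?t\<close>, written with \<open>base\<close> to
    show smoothness. It undoes the scaling by \<open>?s\<close> that precedes the deformation map in
    \<open>T\<close>.\<close>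
  define g where "g z = ?t *\<^sub>R z + (1 - ?t) *\<^sub>R base z" for z
  have T: "fmap ((r - 1) / (r + 1)) (p + Y) = ?T (p + ?s *\<^sub>R Y)" if "p \<in> Orb" "Y \<in> n p" for p Y
    using fmap_M[OF that] deform_map_s[OF Orb_s[OF that(1)]]
    by (simp add: linear_add[OF linear_deform_map] deform_map_eq psi_r_def)
  have g: "g (p + Y) = p + ?t *\<^sub>R Y" if "p \<in> Orb" "Y \<in> n p" for p Y
    unfolding g_def base_eq[OF that] by (simp add: scaleR_add_right scaleR_diff_left)
  have sY: "c *\<^sub>R Y \<in> n p" if "Y \<in> n p" for c Y p by (rule subspace_scale[OF subspace_eigs that])
  have st: "?s * ?t = 1" using r by simp
  show ?thesis
  proof (rule diffeomorphismI[OF submanifold_M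
        submanifold_linear_image[OF submanifold_M linear_deform_map linear_deform_map deform_inverses]
        smooth_map_on_fmap, where g="\<lambda>u. g (?T' u)"])
    have "smooth_map_on M g"
      unfolding g_def
      by (rule smooth_map_on_add[OF smooth_map_on_linear[OF linear_scale_self]
            smooth_map_on_linear_comp[OF linear_scale_self smooth_map_on_base]])
    then show "smooth_map_on (?T ` M) (\<lambda>u. g (?T' u))"
      by (rule smooth_map_on_compose[OF smooth_map_on_linear[OF linear_deform_map]]) (auto simp: deform_inverses)
    show "fmap ((r - 1) / (r + 1)) x \<in> ?T ` M" if "x \<in> M" for x
      using that T MI[OF _ sY] by (auto simp: M_def)
    show "g (?T' y) \<in> M" if "y \<in> ?T ` M" for y
      using that g MI[OF _ sY] by (auto simp: M_def deform_inverses)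
    show "g (?T' (fmap ((r - 1) / (r + 1)) x)) = x" if x: "x \<in> M" for x
    proof -
      obtain p Y where "p \<in> Orb" "Y \<in> n p" "x = p + Y" using x by (auto simp: M_def)
      then show ?thesis using st g[OF _ sY, of p Y ?s] by (simp add: T deform_inverses mult.commute)
    qed
    show "fmap ((r - 1) / (r + 1)) (g (?T' y)) = y" if y: "y \<in> ?T ` M" for y
    proof -
      obtain p Y where pY: "p \<in> Orb" "Y \<in> n p" "y = ?T (p + Y)" using y by (auto simp: M_def)
      have "fmap ((r - 1) / (r + 1)) (g (?T' y)) = fmap ((r - 1) / (r + 1)) (p + ?t *\<^sub>R Y)"
        by (simp only: pY(3) deform_inverses g[OF pY(1,2)])
      also have "\<dots> = ?T (p + ?s *\<^sub>R ?t *\<^sub>R Y)" by (rule T[OF pY(1) sY[OF pY(2)]])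
      also have "\<dots> = y" by (simp only: scaleR_scaleR st scaleR_one pY(3))
      finally show ?thesis .
    qed
  qed
qed

end

end

text \<open>A positive eigenspace of \<open>ad H\<close> is invariant under the commuting symmetric
  family \<open>ad A\<close>, hence spanned by joint eigenvectors; each lies in a root space whose
  root takes that eigenvalue at \<open>H\<close>.\<close>

lemma (in cartan) n_plus_eq:
  assumes A: "abelian_subspace br A" "A \<subseteq> cartan_s \<theta>" and H: "H \<in> A"
  shows "n_plus br A H = eigs (br H) {0<..}"
proof
  show "n_plus br A H \<subseteq> eigs (br H) {0<..}"
    unfolding n_plus_def
  proof (rule span_minimal[OF _ subspace_eigs])
    show "(\<Union>\<alpha>\<in>{\<alpha> \<in> roots br A. 0 < \<alpha> H}. root_space br A \<alpha>) \<subseteq> eigs (br H) {0<..}"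
      using H eigs_base[of "br H"] by (fastforce simp: root_space_def)
  qed
  have eigen: "x \<in> n_plus br A H" if c: "c \<in> {0<..}" "br H x = c *\<^sub>R x" for x c
  proof -
    define W where "W = {y. br H y = c *\<^sub>R y}"
    have sub: "subspace W" unfolding W_def subspace_def by (simp add: br_simps scaleR_add_right)
    have comm: "br a (br b y) = br b (br a y)" if "a \<in> A" "b \<in> A" for a b y
      using br_derivation[of a b y] A(1) that by (simp add: abelian_subspace_def br_simps)
    have "W \<subseteq> span {y \<in> W. \<forall>f\<in>br ` A. \<exists>m. f y = m *\<^sub>R y}"
    proof (rule commuting_symmetric_span[OF sub])
      show "f ` W \<subseteq> W" if "f \<in> br ` A" for f
        using that comm[OF H] by (auto simp: W_def br_simps)
      show "linear f" if "f \<in> br ` A" for f using that linear_br by auto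
      show "Q (f x) y = Q x (f y)" if "f \<in> br ` A" for f x y using that A(2) Q_br_s by auto
      show "f (g x) = g (f x)" if "f \<in> br ` A" "g \<in> br ` A" for f g x using that comm by auto
    qed
    moreover have "y \<in> n_plus br A H" if y: "y \<in> W" "\<forall>f\<in>br ` A. \<exists>m. f y = m *\<^sub>R y" for y
    proof (cases "y = 0")
      case True
      then show ?thesis by (simp add: n_plus_def span_0)
    next
      case False
      \<comment> \<open>The quotient of ambient inner products is linear in \<open>a\<close> on the
        whole space, as required of a representative of a root, and equals the eigenvalue on
        \<open>A\<close>.\<close>
      define \<alpha> where "\<alpha> a = (br a y \<bullet> y) / (y \<bullet> y)" for a
      have lin: "linear \<alpha>"
        by (rule linearI) (simp_all add: \<alpha>_def br_simps inner_add_left add_divide_distrib)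
      have a: "br a y = \<alpha> a *\<^sub>R y" if "a \<in> A" for a
      proof -
        have "\<exists>m. br a y = m *\<^sub>R y" using y(2) that by simp
        then obtain m where "br a y = m *\<^sub>R y" by blast
        then show ?thesis using False by (simp add: \<alpha>_def)
      qed
      have "\<alpha> H = c" using y(1) False by (simp add: \<alpha>_def W_def)
      moreover have "y \<in> root_space br A \<alpha>" using a by (simp add: root_space_def)
      ultimately have "\<alpha> \<in> {\<alpha> \<in> roots br A. 0 < \<alpha> H}"
        using lin H c(1) False by (auto simp: roots_def intro!: bexI[of _ H])
      then show ?thesis
        unfolding n_plus_def using \<open>y \<in> root_space br A \<alpha>\<close> by (intro span_base) blast
    qed
    then have "span {y \<in> W. \<forall>f\<in>br ` A. \<exists>m. f y = m *\<^sub>R y} \<subseteq> n_plus br A H"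
      by (intro span_minimal) (auto simp: n_plus_def)
    moreover have "x \<in> W" using c by (simp add: W_def)
    ultimately show ?thesis by blast
  qed
  have sub: "subspace (n_plus br A H)" by (simp add: n_plus_def)
  show "eigs (br H) {0<..} \<subseteq> n_plus br A H"
    by (rule subsetI, erule eigs_induct[OF _ eigen sub])
qed

theorem theorem11:
  fixes br :: "'a::euclidean_space \<Rightarrow> 'a \<Rightarrow> 'a"
    and \<theta> :: "'a \<Rightarrow> 'a" and A C :: "'a set" and H :: 'a and r :: real
    and K :: "('a \<Rightarrow>\<^sub>L 'a) set" and N :: "'a set"
    and psit psit_r :: "'a \<Rightarrow> 'a"
  assumes "semisimple br" and "\<not> compact_lie_algebra br"
    and "cartan_involution br \<theta>"
    and "maximal_abelian_in br (cartan_s \<theta>) A"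
    and "weyl_chamber br A C"
    and "H \<in> closure C"
    and "r > 0"
  defines "K \<equiv> analytic_subgroup br (cartan_k \<theta>)"
    and "N \<equiv> n_plus br A H"
    and "psit \<equiv> fiber_map K N H (psi \<theta>)"
    and "psit_r \<equiv> fiber_map K N H (psi_r \<theta> r)"
  shows "(\<forall>k\<in>K. \<forall>X\<in>N. psit (blinfun_apply k (H + X)) = blinfun_apply k (H + psi \<theta> X)) \<and>
    diffeomorphism (adj_orbit br H) (limit_orbit br \<theta> A H) psit \<and>
    (\<forall>k\<in>K. \<forall>X\<in>N. psit_r (blinfun_apply k (H + X)) = blinfun_apply k (H + psi_r \<theta> r X)) \<and>
    diffeomorphism (adj_orbit br H) (adj_orbit (deform_bracket br \<theta> r) H) psit_r \<and>
    diffeomorphism (adj_orbit (deform_bracket br \<theta> r) H) (limit_orbit br \<theta> A H)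
      (psit \<circ> inv_into (adj_orbit br H) psit_r)"
proof -
  have "lie_algebra br" using assms(1) unfolding semisimple_def by (rule conjunct1)
  then interpret cartan br \<theta> by (rule cartan.intro[OF _ assms(3)])
  have A: "abelian_subspace br A" "A \<subseteq> cartan_s \<theta>"
    using assms(4) by (auto simp: maximal_abelian_in_def)
  have "C \<subseteq> A" using assms(5) in_components_subset by (fastforce simp: weyl_chamber_def)
  moreover have "closed A" using A(1) by (simp add: abelian_subspace_def closed_subspace)
  ultimately have HA: "H \<in> A" using assms(6) closure_minimal by blast
  then have Hs: "H \<in> cartan_s \<theta>" using A(2) by blast
  obtain ls where ls: "sorted_wrt (<) ls" "diagonal ls (br H)" by (rule ex_diagonal[OF Hs])
  interpret cartan_spectrum br \<theta> ls by unfold_locales (rule ls)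
  interpret cartan_orbit br \<theta> ls H
    using Hs ls(2) by unfold_locales (auto simp: Sig_def)
  have N: "N = n H" unfolding N_def by (rule n_plus_eq[OF A HA])
  let ?c = "(r - 1) / (r + 1)"
  have p1: "psit z = fmap 1 z" if "z \<in> M" for z
    unfolding psit_def K_def N by (rule fiber_map_eq[OF _ that]) (simp add: psi_def)
  have pr: "psit_r z = fmap ?c z" if "z \<in> M" for z
    unfolding psit_r_def K_def N by (rule fiber_map_eq[OF _ that]) (simp add: psi_r_def)
  have inM: "k (H + X) \<in> M" if "k \<in> K" "X \<in> N" for k X
    using that unfolding K_def N M_iff by blast
  \<comment> \<open>The fibre maps are known to agree with \<open>fmap\<close> on \<open>M\<close>
    only; \<open>inv_into M\<close> depends on nothing else.\<close>
  have cong: "diffeomorphism M M' g" if "diffeomorphism M M' f" "\<And>z. z \<in> M \<Longrightarrow> g z = f z"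
    for M M' :: "'a set" and f g :: "'a \<Rightarrow> 'a"
  proof -
    have "inv_into M g y = inv_into M f y" for y
      unfolding inv_into_def using that(2) by metis
    then show ?thesis
      using that smooth_map_on_cong_imp[of M f g] bij_betw_cong[of M g f M']
      unfolding diffeomorphism_def by (metis ext)
  qed
  have lim: "diffeomorphism (adj_orbit br H) (limit_orbit br \<theta> A H) psit"
    unfolding adj_orbit_eq limit_orbit_eq[OF N[unfolded N_def]]
    by (rule cong[OF diffeomorphism_fmap_limit p1])
  have def: "diffeomorphism (adj_orbit br H) (adj_orbit (deform_bracket br \<theta> r) H) psit_r"
    unfolding adj_orbit_eq adj_orbit_deform[OF assms(7)]
    by (rule cong[OF diffeomorphism_fmap_deform[OF assms(7)] pr])
  have "psit (k (H + X)) = k (H + psi \<theta> X)" if "k \<in> K" "X \<in> N" for k X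
    using p1[OF inM[OF that]] fmap_K[of k X 1] that by (simp add: K_def N psi_def)
  moreover have "psit_r (k (H + X)) = k (H + psi_r \<theta> r X)" if "k \<in> K" "X \<in> N" for k X
    using pr[OF inM[OF that]] fmap_K[of k X ?c] that by (simp add: K_def N psi_r_def)
  ultimately show ?thesis
    using lim def diffeomorphism_compose_inv[OF def lim] by blast
qed

end
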